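(* Let $(Z,d,\mu)$, $Q$, $X$, $(\psi_x)$ and $T_n$ be as in the context. (i) Let $0<s<1$, $Q/(Q+s)<p\le\infty$, $0<q\le\infty$. Then there is a constant $C'$ such that $\|T_n(Pf)\|_{\dot{\mathcal B}^s_{p,q}(Z)} \le C'\|f\|_{\dot{\mathcal B}^s_{p,q}(Z)}$ for all $f\in\dot{\mathcal B}^s_{p,q}(Z)$ and all $n\in\mathbb Z$. (ii) Let $0<s<1$, $Q/(Q+s)<p\le\infty$, $0<q<\infty$. Then for every $f\in\dot{\mathcal B}^s_{p,q}(Z)$, $T_n(Pf)\to f$ in $\dot{\mathcal B}^s_{p,q}(Z)$ as $n\to\infty$.
   Context: $(Z,d,\mu)$ is a metric measure space, $\mu$ Borel regular, every ball has positive finite measure, and $\mu$ is doubling. Fix constants $C\ge1$, $Q>0$ with $\mu(B(\xi,\lambda r)) \le C\lambda^Q\mu(B(\xi,r))$ for all $\xi\in Z$, $r>0$, $\lambda\ge1$. Hyperbolic filling: for each $n\in\mathbb Z$ let $(\xi_x)_{x\in X_n}$ be a maximal set of points of $Z$ with pairwise distances at least $2^{-n-1}$; $X=\bigsqcup_n X_n$, $|x|:=n$ for $x\in X_n$, $B(x):=B(\xi_x,2^{-n})$. Distinct $x,x'\in X$ are neighbors, $x\sim x'$, iff $B(x)\cap B(x')\ne\emptyset$ and $||x|-|x'||\le1$. For $u:X\to\mathbb C$, $|du(x)| := \big(\sum_{x'\sim x}|u(x')-u(x)|^2\big)^{1/2}$. $\mathcal I^s_{p,q}(X)$: sequences $u:X\to\mathbb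 C$ with $\|u\|_{\mathcal I^s_{p,q}(X)} := \big(\sum_{k\in\mathbb Z}2^{ksq}\|\sum_{x\in X_k}|u(x)|\chi_{B(x)}\|_{L^p(Z)}^q\big)^{1/q}<\infty$ (usual modification for $p$ or $q=\infty$). $Pf(x):=\frac{1}{\mu(B(x))}\int_{B(x)}f\,d\mu$ for $f\in L^1_{\rm loc}(Z)$. $\dot{\mathcal B}^s_{p,q}(Z)$ (for $p>Q/(Q+s)$): $f\in L^1_{\rm loc}(Z)$ with $\|f\|_{\dot{\mathcal B}^s_{p,q}(Z)}:=\|\,|d(Pf)|\,\|_{\mathcal I^s_{p,q}(X)}<\infty$, modulo a.e. constants. $(\psi_x)_{x\in X}$ is a fixed family of non-negative Lipschitz functions on $Z$ with $\psi_x$ supported in $B(x)$, $(\psi_x)_{x\in X_n}$ a partition of unity on $Z$ for each $n$, and ${\rm Lip}\,\psi_x\le C''2^{|x|}$ for a constant $C''$. For $u:X\to\mathbb C$, $T_nu:=\sum_{x\in X_n}u(x)\psi_x$. *)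

theory Defs
  imports "HOL-Analysis.Analysis" "HOL-Probability.Essential_Supremum"
begin

definition hball :: "int \<times> 'a::metric_space \<Rightarrow> 'a set" where
  "hball x = ball (snd x) (2 powr (- real_of_int (fst x)))"

definition filling_vertices :: "(int \<Rightarrow> 'a::metric_space set) \<Rightarrow> (int \<times> 'a) set" where
  "filling_vertices Xs = {(n, xi). xi \<in> Xs n}"

definition maximal_separated :: "real \<Rightarrow> 'a::metric_space set \<Rightarrow> bool" where
  "maximal_separated \<delta> S \<longleftrightarrow>
     (\<forall>a\<in>S. \<forall>b\<in>S. a \<noteq> b \<longrightarrow> \<delta> \<le> dist a b) \<and>
     (\<forall>z. z \<notin> S \<longrightarrow> (\<exists>a\<in>S. dist z a < \<delta>))"

definition hyperbolic_filling :: "(int \<Rightarrow> 'a::metric_space set) \<Rightarrow> bool" where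
  "hyperbolic_filling Xs \<longleftrightarrow> (\<forall>n. maximal_separated (2 powr (- real_of_int n - 1)) (Xs n))"

definition hneighbor :: "(int \<Rightarrow> 'a::metric_space set) \<Rightarrow> int \<times> 'a \<Rightarrow> int \<times> 'a \<Rightarrow> bool" where
  "hneighbor Xs x y \<longleftrightarrow> x \<in> filling_vertices Xs \<and> y \<in> filling_vertices Xs \<and> x \<noteq> y \<and>
     hball x \<inter> hball y \<noteq> {} \<and> \<bar>fst x - fst y\<bar> \<le> 1"

definition dnorm :: "(int \<Rightarrow> 'a::metric_space set) \<Rightarrow> (int \<times> 'a \<Rightarrow> complex) \<Rightarrow> int \<times> 'a \<Rightarrow> real" where
  "dnorm Xs u x = sqrt (\<Sum>y\<in>{y. hneighbor Xs x y}. (cmod (u y - u x))\<^sup>2)"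

text \<open>a^t for a in [0,\<infinity>], t > 0, with \<infinity>^t = \<infinity>.\<close>
definition enn_powr :: "ennreal \<Rightarrow> real \<Rightarrow> ennreal" where
  "enn_powr a t = (if a = \<infinity> then \<infinity> else ennreal (enn2real a powr t))"

definition Lp_enorm :: "'a measure \<Rightarrow> ennreal \<Rightarrow> ('a \<Rightarrow> ennreal) \<Rightarrow> ennreal" where
  "Lp_enorm M p g = (if p = \<infinity> then esssup M g
     else enn_powr (\<integral>\<^sup>+ z. enn_powr (g z) (enn2real p) \<partial>M) (1 / enn2real p))"

definition level_fun :: "(int \<Rightarrow> 'a::metric_space set) \<Rightarrow> (int \<times> 'a \<Rightarrow> real) \<Rightarrow> int \<Rightarrow> 'a \<Rightarrow> ennreal" where
  "level_fun Xs v k z =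
     (\<Sum>\<^sub>\<infinity> xi\<in>Xs k. ennreal (\<bar>v (k, xi)\<bar> * indicator (hball (k, xi)) z))"

definition I_norm :: "'a::metric_space measure \<Rightarrow> (int \<Rightarrow> 'a set) \<Rightarrow> real \<Rightarrow> ennreal \<Rightarrow> ennreal
    \<Rightarrow> (int \<times> 'a \<Rightarrow> real) \<Rightarrow> ennreal" where
  "I_norm M Xs s p q v = (if q = \<infinity>
     then (SUP k. ennreal (2 powr (real_of_int k * s)) * Lp_enorm M p (level_fun Xs v k))
     else enn_powr (\<Sum>\<^sub>\<infinity> k\<in>(UNIV::int set).
            ennreal (2 powr (real_of_int k * s * enn2real q)) *
            enn_powr (Lp_enorm M p (level_fun Xs v k)) (enn2real q)) (1 / enn2real q))"

definition Pavg :: "'a::metric_space measure \<Rightarrow> ('a \<Rightarrow> complex) \<Rightarrow> int \<times> 'a \<Rightarrow> complex" where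
  "Pavg M f x = (LINT z:hball x|M. f z) / complex_of_real (measure M (hball x))"

definition locally_integrable :: "'a::metric_space measure \<Rightarrow> ('a \<Rightarrow> complex) \<Rightarrow> bool" where
  "locally_integrable M f \<longleftrightarrow> (\<forall>xi r. set_integrable M (ball xi r) f)"

definition besov_norm :: "'a::metric_space measure \<Rightarrow> (int \<Rightarrow> 'a set) \<Rightarrow> real \<Rightarrow> ennreal \<Rightarrow> ennreal
    \<Rightarrow> ('a \<Rightarrow> complex) \<Rightarrow> ennreal" where
  "besov_norm M Xs s p q f = I_norm M Xs s p q (dnorm Xs (Pavg M f))"

definition besov_space :: "'a::metric_space measure \<Rightarrow> (int \<Rightarrow> 'a set) \<Rightarrow> real \<Rightarrow> ennreal \<Rightarrow> ennreal
    \<Rightarrow> ('a \<Rightarrow> complex) set" where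
  "besov_space M Xs s p q = {f. locally_integrable M f \<and> besov_norm M Xs s p q f < \<infinity>}"

definition Tn :: "(int \<Rightarrow> 'a::metric_space set) \<Rightarrow> (int \<times> 'a \<Rightarrow> 'a \<Rightarrow> real) \<Rightarrow> int
    \<Rightarrow> (int \<times> 'a \<Rightarrow> complex) \<Rightarrow> 'a \<Rightarrow> complex" where
  "Tn Xs \<psi> n u z = (\<Sum>\<^sub>\<infinity> xi\<in>Xs n. u (n, xi) * complex_of_real (\<psi> (n, xi) z))"

definition doubling_mms :: "'a::metric_space measure \<Rightarrow> real \<Rightarrow> real \<Rightarrow> bool" where
  "doubling_mms M C Q \<longleftrightarrow> sets M = sets borel \<and> C \<ge> 1 \<and> Q > 0 \<and>
     (\<forall>xi r. r > 0 \<longrightarrow> 0 < emeasure M (ball xi r) \<and> emeasure M (ball xi r) < \<infinity>) \<and>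
     (\<forall>xi r t. r > 0 \<longrightarrow> t \<ge> 1 \<longrightarrow>
        emeasure M (ball xi (t * r)) \<le> ennreal (C * t powr Q) * emeasure M (ball xi r))"

definition lipschitz_pou :: "(int \<Rightarrow> 'a::metric_space set) \<Rightarrow> (int \<times> 'a \<Rightarrow> 'a \<Rightarrow> real) \<Rightarrow> real \<Rightarrow> bool" where
  "lipschitz_pou Xs \<psi> C'' \<longleftrightarrow>
     (\<forall>x\<in>filling_vertices Xs.
        (\<forall>z. 0 \<le> \<psi> x z) \<and> (\<forall>z. z \<notin> hball x \<longrightarrow> \<psi> x z = 0) \<and>
        (C'' * 2 powr real_of_int (fst x))-lipschitz_on UNIV (\<psi> x)) \<and>
     (\<forall>n z. (\<Sum>\<^sub>\<infinity> xi\<in>Xs n. \<psi> (n, xi) z) = 1)"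

end

theory Submission
  imports Defs
begin

text \<open>
  Write \<open>v = |d(Pf)|\<close> and \<open>h = T\<^sub>n(Pf) - f\<close>. On a level \<open>k \<ge> n + 3\<close> the function \<open>T\<^sub>n(Pf)\<close> is Lipschitz
  at the scale \<open>2\<^sup>-\<^sup>n\<close> with constant controlled by \<open>v\<close> at a parent vertex of level \<open>n - 1\<close>, so that
  \<open>|d(PT\<^sub>n(Pf))|\<close> gains the factor \<open>2\<^bsup>-(k-n)\<^esup>\<close>. On a level \<open>k \<le> n + 2\<close> one telescopes
  \<open>f - T\<^sub>n(Pf) = \<Sum>\<^sub>m (T\<^sub>m\<^sub>+\<^sub>1(Pf) - T\<^sub>m(Pf))\<close> over \<open>m \<ge> n\<close>, with convergence in local \<open>L\<^sup>1\<close>; each term is bounded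
  by \<open>v\<close> on level \<open>m\<close>, and averaging it over a ball of radius \<open>2\<^sup>-\<^sup>k\<close> costs at most
  \<open>2\<^bsup>(m-k)Q(1-p)\<^esup>\<close> in the \<open>p\<close>-th power of the level norm (nothing if \<open>p \<ge> 1\<close>), which the weight
  \<open>2\<^bsup>(k-m)sp\<^esup>\<close> absorbs exactly when \<open>p > Q/(Q+s)\<close>. If \<open>b\<^sub>k\<close> are the weighted level norms of \<open>v\<close> and
  \<open>S = sup\<^bsub>m \<ge> n-1\<^esub> b\<^sub>m\<close>, then those of \<open>|d(Ph)|\<close> are at most
  \<open>K (b\<^sub>k 1\<^bsub>k \<ge> n\<^esub> + 2\<^bsup>-\<epsilon>|k-n|\<^esup> S)\<close>. Summing \<open>q\<close>-th powers bounds the norm of \<open>h\<close> by the tail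
  \<open>k \<ge> n - 1\<close> of the norm of \<open>f\<close>, which gives both claims.
\<close>

subsection \<open>Powers of sums\<close>

text \<open>For p < 1 or q < 1 the level norms and their q-sums are only quasi-norms, so a triangle
  inequality cannot be iterated over an infinite telescope. Such a sum is instead compared with its
  largest weighted term, at the price of part of its geometric decay. The limit of T_m(Pf) in local
  L^1 comes from density and uniform boundedness. The telescope is cut at a finite level, and its
  remainder tends to 0 at each vertex without a uniform rate; level norms are therefore phrased as
  bounds for all finite sets of vertices, where pointwise convergence suffices. The split at n + 3
  comes from 5/8 < 1: the balls of all neighbours of a vertex of level k \<ge> n + 3 lie in a single
  ball of level n - 1. On those levels h carries the oscillation of f itself, whence the summand
  \<open>b\<^sub>k\<close>. It is absent for k < n, so h sees only the tail of f; the tail of a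
  convergent q-sum vanishes, while the tail of a bounded supremum (q = \<infinity>) need
  not.\<close>

lemma sum_powr_le_ge1:
  fixes w v :: "'b \<Rightarrow> real"
  assumes "finite B" "\<And>b. b \<in> B \<Longrightarrow> 0 \<le> w b" "\<And>b. b \<in> B \<Longrightarrow> 0 \<le> v b"
    and "(\<Sum>b\<in>B. w b) \<le> W" "0 < W" "1 \<le> r"
  shows "(\<Sum>b\<in>B. w b * v b) powr r \<le> W powr (r - 1) * (\<Sum>b\<in>B. w b * v b powr r)"
proof -
  \<comment> \<open>Jensen's inequality is applied to positive values only. Indices with
    \<open>v b = 0\<close> add nothing to either side, as \<open>0 powr r = 0\<close>, but they may
    carry weight; the remaining total \<open>W'\<close> is only bounded by W, which suffices because
    r - 1 \<ge> 0.\<close>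
  define B' where "B' = {b\<in>B. 0 < v b}"
  define W' where "W' = (\<Sum>b\<in>B'. w b)"
  have B': "finite B'" "B' \<subseteq> B" using assms(1) by (auto simp: B'_def)
  have W'0: "0 \<le> W'" unfolding W'_def using assms B' by (intro sum_nonneg) auto
  have "W' \<le> (\<Sum>b\<in>B. w b)" unfolding W'_def using assms B' by (intro sum_mono2) auto
  then have W'W: "W' \<le> W" using assms(4) by simp
  have e1: "(\<Sum>b\<in>B. w b * v b) = (\<Sum>b\<in>B'. w b * v b)"
    using assms by (intro sum.mono_neutral_right) (force simp: B'_def)+
  have e2: "(\<Sum>b\<in>B. w b * v b powr r) = (\<Sum>b\<in>B'. w b * v b powr r)"
    using assms by (intro sum.mono_neutral_right) (force simp: B'_def)+
  show ?thesis
  proof (cases "W' = 0")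
    case True
    then have "\<forall>b\<in>B'. w b = 0"
      unfolding W'_def using assms B' by (subst (asm) sum_nonneg_eq_0_iff) auto
    then show ?thesis unfolding e1 e2 by simp
  next
    case False
    then have W'p: "0 < W'" using W'0 by simp
    have sum1: "(\<Sum>b\<in>B'. w b / W') = 1"
      using W'p by (simp add: W'_def flip: sum_divide_distrib)
    have ne: "B' \<noteq> {}" using False by (auto simp: W'_def)
    have "(\<Sum>b\<in>B'. (w b / W') *\<^sub>R v b) powr r \<le> (\<Sum>b\<in>B'. (w b / W') * (v b powr r))"
      using assms B' W'p sum1 ne by (intro convex_on_sum[OF _ _ powr_convex]) (auto simp: B'_def)
    then have "((\<Sum>b\<in>B'. w b * v b) / W') powr r \<le> (\<Sum>b\<in>B'. w b * (v b powr r)) / W'"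
      by (simp add: sum_divide_distrib)
    then have "(\<Sum>b\<in>B'. w b * v b) powr r \<le> W' powr r * ((\<Sum>b\<in>B'. w b * (v b powr r)) / W')"
      using W'p assms B' by (subst (asm) powr_divide) (auto simp: field_simps intro!: sum_nonneg)
    also have "\<dots> = W' powr (r - 1) * (\<Sum>b\<in>B'. w b * (v b powr r))"
      using W'p by (simp add: powr_diff)
    also have "\<dots> \<le> W powr (r - 1) * (\<Sum>b\<in>B'. w b * (v b powr r))"
      using W'p W'W assms B' by (intro mult_right_mono powr_mono2 sum_nonneg) auto
    finally show ?thesis unfolding e1 e2 .
  qed
qed

text \<open>Divided by x + y, the two terms lie in [0,1] and add up to 1, and on [0,1] one has u
  \<le> \<open>u powr r\<close>.\<close>

lemma powr_add_le_le1:
  fixes x y r :: real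
  assumes "0 \<le> x" "0 \<le> y" "0 < r" "r \<le> 1"
  shows "(x + y) powr r \<le> x powr r + y powr r"
proof (cases "x + y = 0")
  case True
  then show ?thesis by simp
next
  case False
  let ?t = "x + y"
  have t: "?t > 0" using False assms by auto
  have l: "u \<le> u powr r" if "0 \<le> u" "u \<le> 1" for u :: real
  proof (cases "u = 0")
    case False
    then show ?thesis using that assms powr_mono'[of r 1 u] by simp
  qed simp
  have "1 = x / ?t + y / ?t" using t by (simp add: add_divide_distrib[symmetric])
  also have "\<dots> \<le> (x / ?t) powr r + (y / ?t) powr r"
    using assms t by (intro add_mono l) auto
  also have "\<dots> = (x powr r + y powr r) / ?t powr r"
    using assms t by (simp add: powr_divide add_divide_distrib)
  finally show ?thesis using t by (simp add: field_simps)
qed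

lemma sum_powr_le_le1:
  fixes x :: "'b \<Rightarrow> real"
  assumes "finite B" "\<And>b. b \<in> B \<Longrightarrow> 0 \<le> x b" "0 < r" "r \<le> 1"
  shows "(\<Sum>b\<in>B. x b) powr r \<le> (\<Sum>b\<in>B. x b powr r)"
  using assms(1,2)
proof (induction B rule: finite_induct)
  case (insert b B)
  have "(x b + sum x B) powr r \<le> x b powr r + (sum x B) powr r"
    using insert assms by (intro powr_add_le_le1 sum_nonneg) auto
  then show ?case using insert by auto
qed simp

lemma powr_add_le:
  fixes x y r :: real
  assumes "0 \<le> x" "0 \<le> y" "0 < r"
  shows "(x + y) powr r \<le> 2 powr r * (x powr r + y powr r)"
proof -
  have "(x + y) powr r \<le> (2 * max x y) powr r"
    using assms by (intro powr_mono2) auto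
  also have "\<dots> = 2 powr r * max x y powr r" using assms by (simp add: powr_mult)
  also have "\<dots> \<le> 2 powr r * (x powr r + y powr r)"
    by (intro mult_left_mono) (auto simp: max_def)
  finally show ?thesis .
qed

lemma geometric_powr_sum_le:
  fixes d :: real
  assumes "0 < d"
  shows "(\<Sum>i<N. 2 powr (- d * real i)) \<le> 1 / (1 - 2 powr (- d))"
proof -
  have q: "2 powr (- d) < 1" "0 \<le> 2 powr (- d)" using assms by (auto simp: powr_less_one)
  have "2 powr (- d * real i) = (2 powr (- d)) ^ i" for i
    by (simp add: powr_realpow[symmetric] powr_powr)
  then have "(\<Sum>i<N. 2 powr (- d * real i)) = (\<Sum>i<N. (2 powr (- d)) ^ i)" by simp
  also have "\<dots> \<le> (\<Sum>i. (2 powr (- d)) ^ i)"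
    using q by (intro sum_le_suminf summable_geometric) auto
  also have "\<dots> = 1 / (1 - 2 powr (- d))" using q by (intro suminf_geometric) auto
  finally show ?thesis .
qed

text \<open>A substitute for the triangle inequality in every \<open>\<ell>\<^sup>r\<close>, valid also for \<open>r < 1\<close>: a geometric
  factor is traded for the comparison of a sum with its largest weighted term.\<close>
lemma sum_powr_le_geometric:
  fixes A :: "nat \<Rightarrow> real"
  assumes "\<And>i. 0 \<le> A i" "0 < r" "0 < d"
  shows "(\<Sum>i<N. A i) powr r \<le> (1 / (1 - 2 powr (- d))) powr r * (\<Sum>i<N. 2 powr (r * d * real i) * A i powr r)"
proof (cases "N = 0")
  case False
  let ?c = "1 / (1 - 2 powr (- d))"
  define m where "m = Max ((\<lambda>i. 2 powr (d * real i) * A i) ` {..<N})"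
  have fin: "finite ((\<lambda>i. 2 powr (d * real i) * A i) ` {..<N})" "(\<lambda>i. 2 powr (d * real i) * A i) ` {..<N} \<noteq> {}"
    using False by auto
  have mge: "2 powr (d * real i) * A i \<le> m" if "i < N" for i
    unfolding m_def using fin that by (intro Max_ge) auto
  obtain j where j: "j < N" "m = 2 powr (d * real j) * A j"
    using Max_in[OF fin] by (auto simp: m_def)
  have m0: "0 \<le> m" using j assms by simp
  have c0: "0 < ?c" using assms by (simp add: powr_less_one)
  have "(\<Sum>i<N. A i) \<le> (\<Sum>i<N. 2 powr (- d * real i) * m)"
  proof (intro sum_mono)
    fix i assume "i \<in> {..<N}"
    then have "2 powr (- d * real i) * (2 powr (d * real i) * A i) \<le> 2 powr (- d * real i) * m"
      by (intro mult_left_mono mge) auto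
    then show "A i \<le> 2 powr (- d * real i) * m"
      by (simp add: powr_minus field_simps)
  qed
  also have "\<dots> = (\<Sum>i<N. 2 powr (- d * real i)) * m" by (simp add: sum_distrib_right)
  also have "\<dots> \<le> ?c * m" using m0 assms by (intro mult_right_mono geometric_powr_sum_le)
  finally have "(\<Sum>i<N. A i) powr r \<le> (?c * m) powr r"
    using assms by (intro powr_mono2) (auto intro: sum_nonneg)
  also have "\<dots> = ?c powr r * m powr r" using c0 m0 by (simp only: powr_mult)
  also have "?c powr r * m powr r \<le> ?c powr r * (\<Sum>i<N. 2 powr (r * d * real i) * A i powr r)"
  proof (intro mult_left_mono)
    have "m powr r = 2 powr (r * d * real j) * A j powr r"
      unfolding j(2) using assms by (simp add: powr_mult powr_powr mult_ac)
    also have "\<dots> \<le> (\<Sum>i<N. 2 powr (r * d * real i) * A i powr r)"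
      using j(1) by (intro member_le_sum) auto
    finally show "m powr r \<le> (\<Sum>i<N. 2 powr (r * d * real i) * A i powr r)" .
  qed simp
  finally show ?thesis .
qed simp

text \<open>A sum of at most c terms is at most c times its largest term, and each term is at most
  the sum. This works for every r > 0, and it is how bounded overlap of the balls turns
  \<open>L\<^sup>p\<close> norms into weighted sums over vertices and back.\<close>

lemma sum_powr_card_le:
  fixes w :: "'b \<Rightarrow> real"
  assumes "finite B" "\<And>b. b \<in> B \<Longrightarrow> 0 \<le> w b" "real (card B) \<le> c" "0 < r"
  shows "(\<Sum>b\<in>B. w b) powr r \<le> c powr r * (\<Sum>b\<in>B. w b powr r)"
    and "(\<Sum>b\<in>B. w b powr r) \<le> c * (\<Sum>b\<in>B. w b) powr r"
proof -
  show "(\<Sum>b\<in>B. w b powr r) \<le> c * (\<Sum>b\<in>B. w b) powr r"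
  proof -
    have "(\<Sum>b\<in>B. w b powr r) \<le> (\<Sum>b\<in>B. (\<Sum>b\<in>B. w b) powr r)"
      using assms by (intro sum_mono powr_mono2 member_le_sum) auto
    also have "\<dots> = real (card B) * (\<Sum>b\<in>B. w b) powr r" by simp
    also have "\<dots> \<le> c * (\<Sum>b\<in>B. w b) powr r" using assms by (intro mult_right_mono) auto
    finally show ?thesis .
  qed
  show "(\<Sum>b\<in>B. w b) powr r \<le> c powr r * (\<Sum>b\<in>B. w b powr r)"
  proof (cases "B = {}")
    case False
    define m where "m = Max (w ` B)"
    obtain j where j: "j \<in> B" "m = w j"
      using Max_in[of "w ` B"] assms(1) False unfolding m_def by blast
    have "(\<Sum>b\<in>B. w b) \<le> (\<Sum>b\<in>B. m)"
      unfolding m_def using assms(1) by (intro sum_mono Max_ge) auto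
    also have "\<dots> = real (card B) * m" by simp
    also have "\<dots> \<le> c * m" using assms j by (intro mult_right_mono) auto
    finally have "(\<Sum>b\<in>B. w b) powr r \<le> (c * m) powr r"
      using assms by (intro powr_mono2) (auto intro: sum_nonneg)
    also have "\<dots> = c powr r * w j powr r" unfolding j(2) by (rule powr_mult)
    also have "\<dots> \<le> c powr r * (\<Sum>b\<in>B. w b powr r)"
      using assms j by (intro mult_left_mono member_le_sum) auto
    finally show ?thesis .
  qed (use assms in simp)
qed

lemma sum_geometric_int_le:
  fixes d :: real
  assumes "0 < d" "finite J"
  shows "(\<Sum>k\<in>J. 2 powr (- d * \<bar>real_of_int (k - n)\<bar>)) \<le> 2 / (1 - 2 powr (- d))"
proof -
  let ?G = "1 / (1 - 2 powr (- d))"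
  have half: "(\<Sum>k\<in>A. 2 powr (- d * \<bar>real_of_int (k - n)\<bar>)) \<le> ?G"
    if fin: "finite A" and inj: "inj_on (\<lambda>k. nat \<bar>k - n\<bar>) A" for A
  proof -
    let ?i = "\<lambda>k. nat \<bar>k - n\<bar>"
    obtain N where N: "?i ` A \<subseteq> {..<N}"
      using finite_nat_bounded[OF finite_imageI[OF fin]] by blast
    have "(\<Sum>k\<in>A. 2 powr (- d * \<bar>real_of_int (k - n)\<bar>)) = (\<Sum>k\<in>A. 2 powr (- d * real (?i k)))"
      by (intro sum.cong refl) simp
    also have "\<dots> = (\<Sum>i\<in>?i ` A. 2 powr (- d * real i))"
      using inj by (simp add: sum.reindex)
    also have "\<dots> \<le> (\<Sum>i<N. 2 powr (- d * real i))"
      using N by (intro sum_mono2) auto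
    also have "\<dots> \<le> ?G" by (rule geometric_powr_sum_le[OF assms(1)])
    finally show ?thesis .
  qed
  have "J = {k\<in>J. n \<le> k} \<union> {k\<in>J. k < n}" by auto
  then have "(\<Sum>k\<in>J. 2 powr (- d * \<bar>real_of_int (k - n)\<bar>))
      = (\<Sum>k\<in>{k\<in>J. n \<le> k} \<union> {k\<in>J. k < n}. 2 powr (- d * \<bar>real_of_int (k - n)\<bar>))"
    by (rule sum.cong) simp
  also have "\<dots> = (\<Sum>k\<in>{k\<in>J. n \<le> k}. 2 powr (- d * \<bar>real_of_int (k - n)\<bar>))
      + (\<Sum>k\<in>{k\<in>J. k < n}. 2 powr (- d * \<bar>real_of_int (k - n)\<bar>))"
    using assms(2) by (intro sum.union_disjoint) auto
  also have "\<dots> \<le> ?G + ?G"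
    using assms(2) by (intro add_mono half) (auto simp: inj_on_def)
  finally show ?thesis by simp
qed

text \<open>The passage from level-wise bounds to the q-sum. T dominates both the partial sums of
  \<open>c k powr r\<close> over A and \<open>S powr r\<close>, so it can be factored out.
  Boundedness uses A = UNIV, convergence uses A = {n..}.\<close>

lemma sum_levels_le:
  fixes c b :: "int \<Rightarrow> real"
  assumes "0 < r" "0 < e" "0 \<le> K" "0 \<le> S" "S powr r \<le> T" "finite J"
    and c: "\<And>k. 0 \<le> c k" and T: "\<And>J. finite J \<Longrightarrow> J \<subseteq> A \<Longrightarrow> (\<Sum>k\<in>J. c k powr r) \<le> T"
    and b: "\<And>k. 0 \<le> b k" "\<And>k. b k \<le> K * ((if k \<in> A then c k else 0) + 2 powr (- e * \<bar>real_of_int (k - n)\<bar>) * S)"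
  shows "(\<Sum>k\<in>J. b k powr r) \<le> K powr r * (2 powr r * (1 + 2 / (1 - 2 powr (- (r * e))))) * T"
proof -
  let ?c = "\<lambda>k. if k \<in> A then c k else 0"
  let ?w = "\<lambda>k. 2 powr (- e * \<bar>real_of_int (k - n)\<bar>)"
  have "(\<Sum>k\<in>J. b k powr r) \<le> (\<Sum>k\<in>J. K powr r * (2 powr r * (?c k powr r + 2 powr (- (r * e) * \<bar>real_of_int (k - n)\<bar>) * S powr r)))"
  proof (intro sum_mono)
    fix k
    have "b k powr r \<le> (K * (?c k + ?w k * S)) powr r"
      using assms by (intro powr_mono2 b) auto
    also have "\<dots> = K powr r * (?c k + ?w k * S) powr r" by (rule powr_mult)
    also have "\<dots> \<le> K powr r * (2 powr r * (?c k powr r + (?w k * S) powr r))"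
      using assms by (intro mult_left_mono powr_add_le) auto
    also have "(?w k * S) powr r = 2 powr (- (r * e) * \<bar>real_of_int (k - n)\<bar>) * S powr r"
      by (simp add: powr_mult powr_powr mult_ac)
    finally show "b k powr r \<le> K powr r * (2 powr r * (?c k powr r + 2 powr (- (r * e) * \<bar>real_of_int (k - n)\<bar>) * S powr r))" .
  qed
  also have "\<dots> = K powr r * (2 powr r * ((\<Sum>k\<in>J. ?c k powr r) + (\<Sum>k\<in>J. 2 powr (- (r * e) * \<bar>real_of_int (k - n)\<bar>)) * S powr r))"
    by (simp only: sum_distrib_right sum.distrib[symmetric] sum_distrib_left)
  also have "\<dots> \<le> K powr r * (2 powr r * (T + 2 / (1 - 2 powr (- (r * e))) * T))"
  proof (intro mult_left_mono add_mono)
    have "(\<Sum>k\<in>J. ?c k powr r) = (\<Sum>k\<in>J \<inter> A. c k powr r)"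
      using assms by (intro sum.mono_neutral_cong_right) auto
    also have "\<dots> \<le> T" using assms by (intro T) auto
    finally show "(\<Sum>k\<in>J. ?c k powr r) \<le> T" .
    show "(\<Sum>k\<in>J. 2 powr (- (r * e) * \<bar>real_of_int (k - n)\<bar>)) * S powr r \<le> 2 / (1 - 2 powr (- (r * e))) * T"
      using assms by (intro mult_mono sum_geometric_int_le) (auto simp: powr_less_one less_imp_le)
  qed auto
  finally show ?thesis by (simp add: algebra_simps)
qed

lemma tendsto_0_upper:
  fixes f h :: "'b \<Rightarrow> real"
  assumes "(h \<longlongrightarrow> 0) G" "\<And>j. f j \<le> h j" "\<And>j. 0 \<le> f j"
  shows "(f \<longlongrightarrow> 0) G"
  using assms by (intro tendsto_sandwich[of "\<lambda>_. 0" f G h 0]) auto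

subsection \<open>Powers of extended non-negative reals\<close>

lemma enn_powr_ennreal: "0 \<le> x \<Longrightarrow> enn_powr (ennreal x) t = ennreal (x powr t)"
  by (simp add: enn_powr_def)

lemma enn_powr_mono:
  assumes "a \<le> b" "0 \<le> t"
  shows "enn_powr a t \<le> enn_powr b t"
proof (cases "b = \<infinity>")
  case False
  then have "a \<noteq> \<infinity>" using assms(1) by (auto simp: top_unique)
  then show ?thesis
    using assms False by (auto simp: enn_powr_def less_top intro!: ennreal_leI powr_mono2 enn2real_mono)
qed (simp add: enn_powr_def)

lemma enn_powr_powr: "0 < t \<Longrightarrow> enn_powr (enn_powr a t) (1 / t) = a"
  by (cases a) (auto simp: enn_powr_ennreal powr_powr enn_powr_def)

lemma enn_powr_le_imp:
  assumes "enn_powr a (1 / t) \<le> ennreal b" "0 < t" "0 \<le> b"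
  shows "a \<le> ennreal (b powr t)"
proof -
  have "enn_powr (enn_powr a (1 / t)) t \<le> enn_powr (ennreal b) t"
    using assms by (intro enn_powr_mono) auto
  then show ?thesis
    using enn_powr_powr[of "1 / t" a] assms by (simp add: enn_powr_ennreal)
qed

lemma enn_powr_mult:
  assumes "0 < c"
  shows "enn_powr (ennreal c * a) t = ennreal (c powr t) * enn_powr a t"
proof (cases a)
  case (real x)
  then have "ennreal c * a = ennreal (c * x)" using assms by (simp add: ennreal_mult)
  then show ?thesis
    using real assms by (simp add: enn_powr_ennreal powr_mult ennreal_mult del: ennreal_mult')
      (simp add: enn_powr_ennreal powr_mult flip: ennreal_mult)
next
  case top
  then show ?thesis using assms by (simp add: enn_powr_def ennreal_mult_top)
qed

subsection \<open>Geometry of the filling\<close>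

definition rad :: "int \<Rightarrow> real" where
  "rad k = 2 powr (- real_of_int k)"

lemma rad_pos [simp]: "0 < rad k" and rad_nonneg [simp]: "0 \<le> rad k" and rad_neq_0 [simp]: "rad k \<noteq> 0"
  by (simp_all add: rad_def)

lemma rad_Suc: "rad (k + 1) = rad k / 2"
  by (simp add: rad_def powr_diff)

lemma rad_pred: "rad (k - 1) = 2 * rad k"
  using rad_Suc[of "k - 1"] by simp

lemma rad_mono: "k \<le> m \<Longrightarrow> rad m \<le> rad k"
  by (simp add: rad_def)

lemma rad_minus: "rad (m - k) = rad m / rad k"
  by (simp add: rad_def powr_diff powr_minus field_simps)

lemma rad_add: "rad (m + k) = rad m * rad k"
  by (simp add: rad_def powr_add[symmetric])

lemma hball_rad [simp]: "hball (k, xi) = ball xi (rad k)"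
  by (simp add: hball_def rad_def)

locale besov_filling =
  fixes M :: "'a::metric_space measure" and C Q C'' :: real
    and Xs :: "int \<Rightarrow> 'a set" and \<psi> :: "int \<times> 'a \<Rightarrow> 'a \<Rightarrow> real"
  assumes doubling: "doubling_mms M C Q"
    and filling: "hyperbolic_filling Xs"
    and pou: "lipschitz_pou Xs \<psi> C''"
begin

definition mu :: "int \<times> 'a \<Rightarrow> real" where
  "mu x = measure M (hball x)"

lemma sets_M [measurable_cong, simp]: "sets M = sets borel"
  using doubling by (simp add: doubling_mms_def)

lemma space_M [simp]: "space M = UNIV"
  using sets_eq_imp_space_eq[OF sets_M] by simp

lemma C_ge_1: "1 \<le> C" and Q_pos: "0 < Q"
  using doubling by (simp_all add: doubling_mms_def)

lemma emeasure_ball_finite [simp]: "emeasure M (ball x r) < top"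
proof (cases "r > 0")
  case True
  then show ?thesis
    using doubling by (auto simp: doubling_mms_def)
next
  case False
  then have "ball x r = {}" by (simp add: ball_empty)
  then show ?thesis by (simp only: emeasure_empty) simp
qed

lemma ball_fmeasurable [simp]: "ball x r \<in> fmeasurable M"
  using emeasure_ball_finite[of x r] by (intro fmeasurableI) auto

lemma emeasure_ball_eq: "emeasure M (ball x r) = ennreal (measure M (ball x r))"
  using emeasure_ball_finite[of x r] by (simp add: emeasure_eq_ennreal_measure less_top)

lemma measure_ball_pos: "r > 0 \<Longrightarrow> 0 < measure M (ball x r)"
  using doubling unfolding doubling_mms_def emeasure_ball_eq by (metis ennreal_less_zero_iff)

lemma mu_pos: "0 < mu x"
  by (cases x) (simp add: mu_def measure_ball_pos)

lemma mu_nonneg [simp]: "0 \<le> mu x"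
  using mu_pos[of x] by simp

lemma mu_neq_0 [simp]: "mu x \<noteq> 0"
  using mu_pos[of x] by simp

lemma measure_doubling:
  assumes "r > 0" "t \<ge> 1"
  shows "measure M (ball x (t * r)) \<le> C * t powr Q * measure M (ball x r)"
proof -
  have "emeasure M (ball x (t * r)) \<le> ennreal (C * t powr Q) * emeasure M (ball x r)"
    using doubling assms by (auto simp: doubling_mms_def)
  then have "ennreal (measure M (ball x (t * r))) \<le> ennreal (C * t powr Q * measure M (ball x r))"
    using C_ge_1 by (simp add: emeasure_ball_eq ennreal_mult)
  then show ?thesis
    using C_ge_1 by (subst (asm) ennreal_le_iff) auto
qed

lemma measure_le_doubling:
  assumes "A \<subseteq> ball x (t * r)" "A \<in> sets borel" "r > 0" "t \<ge> 1"
  shows "measure M A \<le> C * t powr Q * measure M (ball x r)"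
proof -
  have "measure M A \<le> measure M (ball x (t * r))"
    using assms by (intro measure_mono_fmeasurable) auto
  also have "\<dots> \<le> C * t powr Q * measure M (ball x r)"
    using assms by (intro measure_doubling) auto
  finally show ?thesis .
qed

lemma measure_ball_le_mu:
  assumes "dist x a + r \<le> t * rad k" "t \<ge> 1"
  shows "measure M (ball a r) \<le> C * t powr Q * mu (k, x)"
proof -
  have "ball a r \<subseteq> ball x (t * rad k)"
  proof
    fix z assume "z \<in> ball a r"
    then show "z \<in> ball x (t * rad k)"
      using assms(1) dist_triangle[of x z a] by auto
  qed
  then show ?thesis
    unfolding mu_def hball_rad using assms by (intro measure_le_doubling) auto
qed

lemma separated: "a \<in> Xs k \<Longrightarrow> b \<in> Xs k \<Longrightarrow> a \<noteq> b \<Longrightarrow> rad k / 2 \<le> dist a b"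
  using filling by (auto simp: hyperbolic_filling_def maximal_separated_def rad_def powr_diff)

text \<open>Maximality gives a distance below half the radius of the vertex balls. The spare half is
  what lets the ball of a vertex of a finer level fit into the ball of its parent in
  \<open>nb_parent\<close>.\<close>

lemma net: "\<exists>a\<in>Xs k. dist z a < rad k / 2"
proof (cases "z \<in> Xs k")
  case True
  then show ?thesis by (intro bexI[of _ z]) auto
next
  case False
  then show ?thesis
    using filling by (auto simp: hyperbolic_filling_def maximal_separated_def rad_def powr_diff)
qed

text \<open>Concentric balls of a quarter of the radius are disjoint.\<close>
lemma sum_mu_le:
  assumes "finite F" "F \<subseteq> Xs k" "\<And>a. a \<in> F \<Longrightarrow> ball a (rad k) \<subseteq> A" "A \<in> fmeasurable M"
  shows "(\<Sum>a\<in>F. mu (k, a)) \<le> C * 4 powr Q * measure M A"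
proof -
  have disj: "disjoint_family_on (\<lambda>a. ball a (rad k / 4)) F"
    unfolding disjoint_family_on_def
  proof (intro ballI impI)
    fix a b assume ab: "a \<in> F" "b \<in> F" "a \<noteq> b"
    have sep: "rad k / 2 \<le> dist a b"
      using separated ab assms(2) by blast
    show "ball a (rad k / 4) \<inter> ball b (rad k / 4) = {}"
    proof (rule ccontr)
      assume "ball a (rad k / 4) \<inter> ball b (rad k / 4) \<noteq> {}"
      then obtain z where "dist a z < rad k / 4" "dist b z < rad k / 4" by auto
      then show False
        using sep dist_triangle2[of a b z] by auto
    qed
  qed
  have "(\<Sum>a\<in>F. mu (k, a)) \<le> (\<Sum>a\<in>F. C * 4 powr Q * measure M (ball a (rad k / 4)))"
    unfolding mu_def hball_rad using measure_doubling[of "rad k / 4" 4] by (intro sum_mono) auto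
  also have "\<dots> = C * 4 powr Q * measure M (\<Union>a\<in>F. ball a (rad k / 4))"
    using disj assms(1) emeasure_ball_finite
    by (subst measure_finite_Union) (auto simp: sum_distrib_left less_top)
  also have "\<dots> \<le> C * 4 powr Q * measure M A"
  proof (intro mult_left_mono measure_mono_fmeasurable)
    show "(\<Union>a\<in>F. ball a (rad k / 4)) \<subseteq> A"
    proof (intro UN_least)
      fix a assume "a \<in> F"
      have "ball a (rad k / 4) \<subseteq> ball a (rad k)" by (intro subset_ball) simp
      then show "ball a (rad k / 4) \<subseteq> A" using assms(3)[OF \<open>a \<in> F\<close>] by blast
    qed
    show "0 \<le> C * 4 powr Q" using C_ge_1 by simp
    show "(\<Union>a\<in>F. ball a (rad k / 4)) \<in> sets M" using assms(1) by auto
  qed (use assms in auto)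
  finally show ?thesis .
qed

text \<open>\<open>C * 4 powr Q\<close> is the packing constant of \<open>sum_mu_le\<close>. The
  other factor compares the ball of radius \<open>(t + 1) * rad k\<close> around z with a vertex
  ball whose centre is within \<open>t * rad k\<close> of z.\<close>

definition cnt :: "real \<Rightarrow> real" where
  "cnt t = C * 4 powr Q * (C * (2 * t + 1) powr Q)"

lemma cnt_ge_1: "t \<ge> 1 \<Longrightarrow> 1 \<le> cnt t"
proof -
  assume t: "t \<ge> 1"
  have a: "1 \<le> 4 powr Q" "1 \<le> (2 * t + 1) powr Q"
    using Q_pos t by (auto intro!: ge_one_powr_ge_zero)
  have "1 \<le> C * 4 powr Q"
    using mult_mono[of 1 C 1 "4 powr Q"] a C_ge_1 by simp
  moreover have "1 \<le> C * (2 * t + 1) powr Q"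
    using mult_mono[of 1 C 1 "(2 * t + 1) powr Q"] a C_ge_1 by simp
  ultimately show ?thesis
    using mult_mono[of 1 "C * 4 powr Q" 1 "C * (2 * t + 1) powr Q"] C_ge_1 by (simp add: cnt_def)
qed

text \<open>Volume count: the vertex balls lie in one ball around z, each has measure comparable to
  it, and by \<open>sum_mu_le\<close> their measures add up to at most a multiple of it. F is taken
  finite because \<open>finite_near\<close> is itself derived from this bound, which does not depend
  on F.\<close>

lemma card_near_finite:
  assumes "finite F" "F \<subseteq> Xs k" "\<And>a. a \<in> F \<Longrightarrow> dist z a < t * rad k" "t \<ge> 1"
  shows "real (card F) \<le> cnt t"
proof -
  let ?A = "ball z ((t + 1) * rad k)"
  have pos: "0 < measure M ?A" using assms(4) by (intro measure_ball_pos) auto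
  have "real (card F) * measure M ?A = (\<Sum>a\<in>F. measure M ?A)" by simp
  also have "\<dots> \<le> (\<Sum>a\<in>F. C * (2 * t + 1) powr Q * mu (k, a))"
  proof (intro sum_mono measure_ball_le_mu)
    fix a assume "a \<in> F"
    then show "dist a z + (t + 1) * rad k \<le> (2 * t + 1) * rad k"
      using assms(3)[of a] by (simp add: dist_commute algebra_simps)
  qed (use assms in auto)
  also have "\<dots> = C * (2 * t + 1) powr Q * (\<Sum>a\<in>F. mu (k, a))"
    by (simp add: sum_distrib_left)
  also have "\<dots> \<le> C * (2 * t + 1) powr Q * (C * 4 powr Q * measure M ?A)"
  proof (intro mult_left_mono sum_mu_le)
    fix a assume "a \<in> F"
    then have "dist z a < t * rad k" using assms(3) by auto
    then show "ball a (rad k) \<subseteq> ?A"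
      using dist_triangle_less_add[of z a "t * rad k" _ "rad k"]
      by (force simp: algebra_simps dist_commute)
  qed (use assms C_ge_1 in auto)
  finally have "real (card F) * measure M ?A \<le> cnt t * measure M ?A"
    by (simp add: cnt_def algebra_simps)
  then show ?thesis using pos by simp
qed

text \<open>Only vertices in \<open>near k z (rad k)\<close> can contribute at z to an infinite sum
  over level k, since all summands are supported in the vertex balls; every such sum thus becomes
  finite.\<close>

definition near :: "int \<Rightarrow> 'a \<Rightarrow> real \<Rightarrow> 'a set" where
  "near k z r = {a \<in> Xs k. dist z a < r}"

lemma finite_near [simp]: "finite (near k z r)"
proof (rule ccontr)
  assume inf: "infinite (near k z r)"
  define t where "t = max 1 (r / rad k)"
  have "t \<ge> 1" and rt: "r \<le> t * rad k"
  proof -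
    show "t \<ge> 1" by (simp add: t_def)
    have "r = r / rad k * rad k" by simp
    also have "\<dots> \<le> t * rad k" by (intro mult_right_mono) (auto simp: t_def)
    finally show "r \<le> t * rad k" .
  qed
  obtain F where F: "F \<subseteq> near k z r" "finite F" "card F = nat \<lceil>cnt t\<rceil> + 1"
    using infinite_arbitrarily_large[OF inf] by blast
  have "real (card F) \<le> cnt t"
    using F \<open>t \<ge> 1\<close> rt by (intro card_near_finite[where z = z and k = k]) (auto simp: near_def)
  then show False using F(3) cnt_ge_1[OF \<open>t \<ge> 1\<close>] by linarith
qed

lemma card_near: "t \<ge> 1 \<Longrightarrow> r \<le> t * rad k \<Longrightarrow> real (card (near k z r)) \<le> cnt t"
  using finite_near[of k z r] by (intro card_near_finite[where z = z and k = k]) (auto simp: near_def)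

lemma near_subset: "near k z r \<subseteq> Xs k"
  by (auto simp: near_def)

subsection \<open>Averages and differences\<close>

lemma dnorm_nonneg [simp]: "0 \<le> dnorm Xs u x"
  by (simp add: dnorm_def sum_nonneg)

lemma hneighbor_dist:
  assumes "hneighbor Xs (k, a) (m, b)"
  shows "dist a b < rad k + rad m" "b \<in> Xs m" "a \<in> Xs k" "\<bar>k - m\<bar> \<le> 1"
proof -
  obtain z where "dist a z < rad k" "dist b z < rad m"
    using assms by (auto simp: hneighbor_def)
  then show "dist a b < rad k + rad m"
    using dist_triangle2[of a b z] by auto
qed (use assms in \<open>auto simp: hneighbor_def filling_vertices_def\<close>)

lemma rad_neighbor: "\<bar>k - m\<bar> \<le> 1 \<Longrightarrow> rad m \<le> 2 * rad k"
  using rad_mono[of "k - 1" m] by (simp add: rad_pred)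

lemma neighbors_subset:
  "{y. hneighbor Xs (k, a) y} \<subseteq> (\<Union>m\<in>{k-1, k, k+1}. Pair m ` near m a (3 * rad k))"
proof
  fix y assume "y \<in> {y. hneighbor Xs (k, a) y}"
  then obtain m b where y: "y = (m, b)" "hneighbor Xs (k, a) (m, b)" by (cases y) auto
  have d: "dist a b < rad k + rad m" "b \<in> Xs m" "\<bar>k - m\<bar> \<le> 1"
    using hneighbor_dist[OF y(2)] by auto
  then have "m \<in> {k-1, k, k+1}" by auto
  moreover have "b \<in> near m a (3 * rad k)"
    using d rad_neighbor[of k m] by (auto simp: near_def)
  ultimately show "y \<in> (\<Union>m\<in>{k-1, k, k+1}. Pair m ` near m a (3 * rad k))"
    using y(1) by blast
qed

lemma finite_neighbors [simp]: "finite {y. hneighbor Xs x y}"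
  by (cases x) (auto intro: finite_subset[OF neighbors_subset])

text \<open>Neighbouring centres are less than \<open>3 * rad k\<close> apart, which is at most
  \<open>6 * rad m\<close> as the levels differ by at most one; hence \<open>cnt 6\<close> on each
  of three levels.\<close>

lemma card_neighbors: "real (card {y. hneighbor Xs x y}) \<le> 3 * cnt 6"
proof (cases x)
  case (Pair k a)
  have "card {y. hneighbor Xs x y} \<le> card (\<Union>m\<in>{k-1, k, k+1}. Pair m ` near m a (3 * rad k))"
    unfolding Pair by (intro card_mono neighbors_subset) auto
  also have "\<dots> \<le> (\<Sum>m\<in>{k-1, k, k+1}. card (Pair m ` near m a (3 * rad k)))"
    by (intro card_UN_le) auto
  also have "\<dots> \<le> (\<Sum>m\<in>{k-1, k, k+1}. card (near m a (3 * rad k)))"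
    by (intro sum_mono card_image_le) auto
  finally have "real (card {y. hneighbor Xs x y}) \<le> (\<Sum>m\<in>{k-1, k, k+1}. real (card (near m a (3 * rad k))))"
    by (metis of_nat_le_iff of_nat_sum)
  also have "\<dots> \<le> (\<Sum>m\<in>{k-1, k, k+1}. cnt 6)"
  proof (intro sum_mono card_near)
    fix m assume "m \<in> {k-1, k, k+1}"
    then show "3 * rad k \<le> 6 * rad m"
      using rad_neighbor[of m k] by auto
  qed auto
  also have "\<dots> = 3 * cnt 6" by simp
  finally show ?thesis .
qed

lemma dnorm_le_sum: "dnorm Xs u x \<le> (\<Sum>y\<in>{y. hneighbor Xs x y}. cmod (u y - u x))"
  using L2_set_le_sum[of "{y. hneighbor Xs x y}" "\<lambda>y. cmod (u y - u x)"]
  by (simp add: dnorm_def L2_set_def)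

lemma dnorm_triangle: "dnorm Xs (\<lambda>x. u x + w x) x \<le> dnorm Xs u x + dnorm Xs w x"
proof -
  let ?N = "{y. hneighbor Xs x y}"
  have "dnorm Xs (\<lambda>x. u x + w x) x \<le> L2_set (\<lambda>y. cmod (u y - u x) + cmod (w y - w x)) ?N"
    unfolding dnorm_def L2_set_def[symmetric]
  proof (intro L2_set_mono)
    fix y
    show "cmod (u y + w y - (u x + w x)) \<le> cmod (u y - u x) + cmod (w y - w x)"
      using norm_triangle_ineq[of "u y - u x" "w y - w x"] by (simp add: algebra_simps)
  qed auto
  also have "\<dots> \<le> dnorm Xs u x + dnorm Xs w x"
    unfolding dnorm_def L2_set_def[symmetric] by (rule L2_set_triangle_ineq)
  finally show ?thesis .
qed

lemma dnorm_uminus: "dnorm Xs (\<lambda>x. - u x) x = dnorm Xs u x"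
  by (simp add: dnorm_def norm_minus_commute)

lemma dnorm_diff: "dnorm Xs (\<lambda>x. u x - w x) x \<le> dnorm Xs u x + dnorm Xs w x"
  using dnorm_triangle[of u "\<lambda>x. - w x" x] by (simp add: dnorm_uminus)

lemma neighbor_diff_le:
  assumes "hneighbor Xs x y"
  shows "cmod (u y - u x) \<le> dnorm Xs u x"
  using member_le_L2_set[of "{y. hneighbor Xs x y}" y "\<lambda>y. cmod (u y - u x)"] assms
  by (simp add: dnorm_def L2_set_def)

text \<open>A common point z makes the vertices equal or neighbours. Later estimates control
  differences of averages by exhibiting such a point.\<close>

lemma diff_le_dnorm:
  assumes "a \<in> Xs k" "b \<in> Xs m" "\<bar>k - m\<bar> \<le> 1" "z \<in> ball a (rad k)" "z \<in> ball b (rad m)"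
  shows "cmod (u (m, b) - u (k, a)) \<le> dnorm Xs u (k, a)"
proof (cases "(k, a) = (m, b)")
  case True
  then show ?thesis by simp
next
  case False
  then have "hneighbor Xs (k, a) (m, b)"
    using assms unfolding hneighbor_def filling_vertices_def by auto
  then show ?thesis by (rule neighbor_diff_le)
qed

lemma locint_ball: "locally_integrable M f \<Longrightarrow> set_integrable M (ball a r) f"
  by (auto simp: locally_integrable_def)

lemma set_integrable_const: "set_integrable M (ball a r) (\<lambda>_. c :: 'b :: {banach, second_countable_topology})"
  unfolding set_integrable_def
  by (intro integrable_scaleR_left integrable_real_indicator) (auto simp: emeasure_ball_finite)

lemma locint_const: "locally_integrable M (\<lambda>_. c)"
  by (simp add: locally_integrable_def set_integrable_const)

lemma locint_diff: "locally_integrable M f \<Longrightarrow> locally_integrable M g \<Longrightarrow> locally_integrable M (\<lambda>z. f z - g z)"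
  by (auto simp: locally_integrable_def intro: set_integral_diff)

lemma locint_add: "locally_integrable M f \<Longrightarrow> locally_integrable M g \<Longrightarrow> locally_integrable M (\<lambda>z. f z + g z)"
  by (auto simp: locally_integrable_def intro: set_integral_add)

lemma Pavg_diff:
  "locally_integrable M f \<Longrightarrow> locally_integrable M g \<Longrightarrow>
    Pavg M (\<lambda>z. f z - g z) x = Pavg M f x - Pavg M g x"
  by (cases x) (simp add: Pavg_def set_integral_diff locint_ball diff_divide_distrib)

lemma Pavg_add:
  "locally_integrable M f \<Longrightarrow> locally_integrable M g \<Longrightarrow>
    Pavg M (\<lambda>z. f z + g z) x = Pavg M f x + Pavg M g x"
  by (cases x) (simp add: Pavg_def set_integral_add locint_ball add_divide_distrib)

lemma Pavg_const: "Pavg M (\<lambda>_. c) x = c"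
proof (cases x)
  case (Pair k a)
  have "(LINT z:ball a (rad k)|M. c) = measure M (ball a (rad k)) *\<^sub>R c"
    unfolding set_lebesgue_integral_def
    by (subst integral_scaleR_left) (auto intro!: integrable_real_indicator)
  then show ?thesis
    using measure_ball_pos[of "rad k" a] by (simp add: Pavg_def Pair scaleR_conv_of_real)
qed

section \<open>Local L^1 seminorms and the averages they control\<close>

definition l1 :: "'a set \<Rightarrow> ('a \<Rightarrow> complex) \<Rightarrow> real" where
  "l1 A f = (LINT z:A|M. cmod (f z))"

lemma locint_norm: "locally_integrable M f \<Longrightarrow> set_integrable M (ball a r) (\<lambda>z. cmod (f z))"
  by (intro set_integrable_norm locint_ball)

lemma l1_nonneg [simp]: "0 \<le> l1 A f"
  unfolding l1_def set_lebesgue_integral_def by (rule integral_nonneg_AE) auto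

lemma l1_mono_set:
  assumes "locally_integrable M f" "ball a r \<subseteq> ball b t"
  shows "l1 (ball a r) f \<le> l1 (ball b t) f"
  unfolding l1_def set_lebesgue_integral_def
  using assms(2) locint_norm[OF assms(1)]
  by (intro integral_mono) (auto simp: set_integrable_def indicator_def)

lemma l1_triangle:
  assumes "locally_integrable M f" "locally_integrable M g"
  shows "l1 (ball a r) (\<lambda>z. f z + g z) \<le> l1 (ball a r) f + l1 (ball a r) g"
proof -
  have "l1 (ball a r) (\<lambda>z. f z + g z) \<le> (LINT z:ball a r|M. cmod (f z) + cmod (g z))"
    unfolding l1_def using assms
    by (intro set_integral_mono locint_norm locint_add set_integral_add norm_triangle_ineq)
  also have "\<dots> = l1 (ball a r) f + l1 (ball a r) g"
    unfolding l1_def using assms by (intro set_integral_add locint_norm)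
  finally show ?thesis .
qed

lemma l1_le_bound:
  assumes "locally_integrable M f" "\<And>z. z \<in> ball a r \<Longrightarrow> cmod (f z) \<le> B"
  shows "l1 (ball a r) f \<le> B * measure M (ball a r)"
proof -
  have "l1 (ball a r) f \<le> (LINT z:ball a r|M. B)"
    unfolding l1_def using assms by (intro set_integral_mono locint_norm set_integrable_const)
  then show ?thesis
    by (simp add: set_lebesgue_integral_def mult.commute)
qed

lemma norm_Pavg_le:
  assumes "locally_integrable M f"
  shows "cmod (Pavg M f (k, a)) \<le> l1 (ball a (rad k)) f / mu (k, a)"
proof -
  have "cmod (LINT z:ball a (rad k)|M. f z) \<le> l1 (ball a (rad k)) f"
    unfolding l1_def using assms by (intro set_integral_norm_bound locint_ball)
  then show ?thesis
    by (simp add: Pavg_def norm_divide mu_def[symmetric] divide_right_mono flip: hball_rad)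
qed

definition K2 :: real where
  "K2 = 3 * cnt 6 * (2 * (C * 5 powr Q))"

lemma K2_nonneg: "0 \<le> K2"
  using cnt_ge_1[of 6] C_ge_1 by (simp add: K2_def)

text \<open>A neighbour has its centre within \<open>3 * rad k\<close> of a and radius at most
  \<open>2 * rad k\<close>, so its ball lies in \<open>ball a (5 * rad k)\<close>; with the roles
  exchanged, doubling makes the measures comparable up to \<open>C * 5 powr Q\<close>.
  \<open>K2\<close> collects this constant, the number of neighbours, and the two averages in each
  difference.\<close>

lemma dnorm_Pavg_le:
  assumes "locally_integrable M h"
  shows "dnorm Xs (Pavg M h) (k, a) \<le> K2 * l1 (ball a (5 * rad k)) h / mu (k, a)"
proof -
  let ?I = "l1 (ball a (5 * rad k)) h"
  have bnd: "cmod (Pavg M h (m, b)) \<le> C * 5 powr Q * ?I / mu (k, a)"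
    if "dist a b < rad k + rad m" "\<bar>k - m\<bar> \<le> 1" for m b
  proof -
    have rm: "rad m \<le> 2 * rad k" "rad k \<le> 2 * rad m"
      using that(2) by (auto intro!: rad_neighbor)
    have "mu (k, a) \<le> C * 5 powr Q * mu (m, b)"
      unfolding mu_def[of "(k,a)"] hball_rad
      using that rm by (intro measure_ball_le_mu) (auto simp: dist_commute)
    then have "1 / mu (m, b) \<le> C * 5 powr Q / mu (k, a)"
      using mu_pos[of "(k, a)"] mu_pos[of "(m,b)"] by (simp add: field_simps)
    moreover have "l1 (ball b (rad m)) h \<le> ?I"
    proof (intro l1_mono_set assms subsetI)
      fix z assume "z \<in> ball b (rad m)"
      then show "z \<in> ball a (5 * rad k)"
        using that rm dist_triangle[of a z b] by auto
    qed
    ultimately have "l1 (ball b (rad m)) h * (1 / mu (m, b)) \<le> ?I * (C * 5 powr Q / mu (k, a))"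
      by (intro mult_mono) auto
    then show ?thesis
      using norm_Pavg_le[OF assms, of m b] by (simp add: mult_ac)
  qed
  have "dnorm Xs (Pavg M h) (k, a) \<le> (\<Sum>y\<in>{y. hneighbor Xs (k, a) y}. cmod (Pavg M h y - Pavg M h (k, a)))"
    by (rule dnorm_le_sum)
  also have "\<dots> \<le> (\<Sum>y\<in>{y. hneighbor Xs (k, a) y}. 2 * (C * 5 powr Q * ?I / mu (k, a)))"
  proof (intro sum_mono)
    fix y assume "y \<in> {y. hneighbor Xs (k, a) y}"
    then obtain m b where y: "y = (m, b)" "hneighbor Xs (k, a) (m, b)" by (cases y) auto
    have "cmod (Pavg M h y) \<le> C * 5 powr Q * ?I / mu (k, a)"
      unfolding y(1) using hneighbor_dist[OF y(2)] by (intro bnd) auto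
    moreover have "cmod (Pavg M h (k, a)) \<le> C * 5 powr Q * ?I / mu (k, a)"
      by (intro bnd) auto
    ultimately show "cmod (Pavg M h y - Pavg M h (k, a)) \<le> 2 * (C * 5 powr Q * ?I / mu (k, a))"
      using norm_triangle_ineq4[of "Pavg M h y" "Pavg M h (k, a)"] by linarith
  qed
  also have "\<dots> = real (card {y. hneighbor Xs (k, a) y}) * (2 * (C * 5 powr Q * ?I / mu (k, a)))"
    by simp
  also have "\<dots> \<le> 3 * cnt 6 * (2 * (C * 5 powr Q * ?I / mu (k, a)))"
    using C_ge_1 by (intro mult_right_mono card_neighbors) (auto simp del: times_divide_eq_right)
  also have "\<dots> = K2 * ?I / mu (k, a)" by (simp add: K2_def)
  finally show ?thesis .
qed

section \<open>The partition of unity and the operators T_n: locality, oscillation, Lipschitz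
  bounds\<close>

lemma psi_nonneg: "a \<in> Xs k \<Longrightarrow> 0 \<le> \<psi> (k, a) z"
  and psi_outside: "a \<in> Xs k \<Longrightarrow> z \<notin> ball a (rad k) \<Longrightarrow> \<psi> (k, a) z = 0"
  and psi_lipschitz: "a \<in> Xs k \<Longrightarrow> (C'' / rad k)-lipschitz_on UNIV (\<psi> (k, a))"
  using pou by (auto simp: lipschitz_pou_def filling_vertices_def rad_def powr_minus divide_inverse)

lemma psi_diff_le: "a \<in> Xs k \<Longrightarrow> \<bar>\<psi> (k, a) z - \<psi> (k, a) w\<bar> \<le> C'' / rad k * dist z w"
  using lipschitz_onD[OF psi_lipschitz[of a k], of z w] by (simp add: dist_real_def)

lemma Cpp_nonneg: "0 \<le> C''"
proof -
  obtain a where "a \<in> Xs 0" using net[of 0] by blast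
  from lipschitz_on_nonneg[OF psi_lipschitz[OF this]] show ?thesis
    by (simp add: rad_def)
qed

text \<open>F may be any finite superset of the relevant vertices, so that two points can be
  compared over one common index set in \<open>Tn_lipschitz\<close>.\<close>

lemma sum_psi:
  assumes "finite F" "F \<subseteq> Xs k" "near k z (rad k) \<subseteq> F"
  shows "(\<Sum>a\<in>F. \<psi> (k, a) z) = 1"
proof -
  have "1 = (\<Sum>\<^sub>\<infinity>a\<in>Xs k. \<psi> (k, a) z)"
    using pou by (simp add: lipschitz_pou_def)
  also have "\<dots> = (\<Sum>\<^sub>\<infinity>a\<in>F. \<psi> (k, a) z)"
    using assms by (intro infsum_cong_neutral) (auto simp: near_def dist_commute intro!: psi_outside)
  finally show ?thesis using assms(1) by simp
qed

lemma Tn_eq_sum: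
  assumes "finite F" "F \<subseteq> Xs k" "near k z (rad k) \<subseteq> F"
  shows "Tn Xs \<psi> k u z = (\<Sum>a\<in>F. u (k, a) * complex_of_real (\<psi> (k, a) z))"
proof -
  have "Tn Xs \<psi> k u z = (\<Sum>\<^sub>\<infinity>a\<in>F. u (k, a) * complex_of_real (\<psi> (k, a) z))"
    unfolding Tn_def using assms
    by (intro infsum_cong_neutral) (auto simp: near_def dist_commute intro!: psi_outside)
  then show ?thesis using assms(1) by simp
qed

lemma Tn_eq_near: "Tn Xs \<psi> k u z = (\<Sum>a\<in>near k z (rad k). u (k, a) * complex_of_real (\<psi> (k, a) z))"
  by (intro Tn_eq_sum) (auto simp: near_subset)

lemma Tn_add: "Tn Xs \<psi> k (\<lambda>x. u x + w x) z = Tn Xs \<psi> k u z + Tn Xs \<psi> k w z"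
  by (simp add: Tn_eq_near sum.distrib algebra_simps)

lemma Tn_diff: "Tn Xs \<psi> k (\<lambda>x. u x - w x) z = Tn Xs \<psi> k u z - Tn Xs \<psi> k w z"
  by (simp add: Tn_eq_near sum_subtractf algebra_simps)

lemma Tn_cmult: "Tn Xs \<psi> k (\<lambda>x. c * u x) z = c * Tn Xs \<psi> k u z"
  by (simp add: Tn_eq_near sum_distrib_left algebra_simps)

lemma Tn_cong:
  assumes "\<And>a. a \<in> Xs k \<Longrightarrow> dist z a < rad k \<Longrightarrow> u (k, a) = w (k, a)"
  shows "Tn Xs \<psi> k u z = Tn Xs \<psi> k w z"
  using assms by (simp add: Tn_eq_near near_def)

text \<open>At z the operator forms a convex combination of the values of u at vertices whose balls
  contain z, and c can be moved inside it because the weights add up to 1.\<close>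

lemma Tn_osc:
  assumes "\<And>a. a \<in> Xs k \<Longrightarrow> dist z a < rad k \<Longrightarrow> cmod (u (k, a) - c) \<le> B"
  shows "cmod (Tn Xs \<psi> k u z - c) \<le> B"
proof -
  let ?F = "near k z (rad k)"
  have one: "(\<Sum>a\<in>?F. \<psi> (k, a) z) = 1"
    by (intro sum_psi) (auto simp: near_subset)
  have "c = c * complex_of_real (\<Sum>a\<in>?F. \<psi> (k, a) z)" using one by simp
  also have "\<dots> = (\<Sum>a\<in>?F. c * complex_of_real (\<psi> (k, a) z))"
    by (simp add: sum_distrib_left)
  finally have "Tn Xs \<psi> k u z - c = (\<Sum>a\<in>?F. (u (k, a) - c) * complex_of_real (\<psi> (k, a) z))"
    by (simp add: Tn_eq_near sum_subtractf algebra_simps)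
  also have "cmod \<dots> \<le> (\<Sum>a\<in>?F. B * \<psi> (k, a) z)"
  proof (intro sum_norm_le)
    fix a assume "a \<in> ?F"
    then show "cmod ((u (k, a) - c) * complex_of_real (\<psi> (k, a) z)) \<le> B * \<psi> (k, a) z"
      using assms[of a] psi_nonneg[of a k z] by (auto simp: near_def norm_mult intro!: mult_right_mono)
  qed
  also have "\<dots> = B * (\<Sum>a\<in>?F. \<psi> (k, a) z)" by (simp add: sum_distrib_left)
  finally show ?thesis using one by simp
qed

definition KL :: real where
  "KL = 2 * cnt 1 * C''"

lemma KL_nonneg: "0 \<le> KL"
  using cnt_ge_1[of 1] Cpp_nonneg by (simp add: KL_def)

text \<open>The weights add up to 1 at z and at w, so a constant c drops out of the difference. The
  Lipschitz constant therefore depends on the oscillation B of u and not on its size. The factor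
  \<open>2 * cnt 1\<close> in \<open>KL\<close> counts the vertices whose balls contain z or
  w.\<close>

lemma Tn_lipschitz:
  assumes "\<And>a. a \<in> Xs k \<Longrightarrow> dist z a < rad k \<or> dist w a < rad k \<Longrightarrow> cmod (u (k, a) - c) \<le> B"
    and "0 \<le> B"
  shows "cmod (Tn Xs \<psi> k u z - Tn Xs \<psi> k u w) \<le> KL * B * dist z w / rad k"
proof -
  let ?F = "near k z (rad k) \<union> near k w (rad k)"
  have F: "finite ?F" "?F \<subseteq> Xs k" by (auto simp: near_subset[THEN subsetD])
  have one: "(\<Sum>a\<in>?F. \<psi> (k, a) z) = 1" "(\<Sum>a\<in>?F. \<psi> (k, a) w) = 1"
    by (intro sum_psi F; auto)+
  have "(\<Sum>a\<in>?F. c * complex_of_real (\<psi> (k, a) z - \<psi> (k, a) w))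
      = c * complex_of_real ((\<Sum>a\<in>?F. \<psi> (k, a) z) - (\<Sum>a\<in>?F. \<psi> (k, a) w))"
    by (simp add: sum_distrib_left sum_subtractf algebra_simps)
  also have "\<dots> = 0" unfolding one by simp
  finally have c0: "(\<Sum>a\<in>?F. c * complex_of_real (\<psi> (k, a) z - \<psi> (k, a) w)) = 0" .
  have "Tn Xs \<psi> k u z - Tn Xs \<psi> k u w = (\<Sum>a\<in>?F. u (k, a) * complex_of_real (\<psi> (k, a) z - \<psi> (k, a) w))"
    using Tn_eq_sum[OF F, of z u] Tn_eq_sum[OF F, of w u] by (simp add: sum_subtractf algebra_simps)
  also have "\<dots> = (\<Sum>a\<in>?F. (u (k, a) - c) * complex_of_real (\<psi> (k, a) z - \<psi> (k, a) w))"
    using c0 by (simp add: left_diff_distrib sum_subtractf del: of_real_diff)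
  also have "cmod \<dots> \<le> (\<Sum>a\<in>?F. B * (C'' / rad k * dist z w))"
  proof (intro sum_norm_le)
    fix a assume a: "a \<in> ?F"
    show "cmod ((u (k, a) - c) * complex_of_real (\<psi> (k, a) z - \<psi> (k, a) w)) \<le> B * (C'' / rad k * dist z w)"
      unfolding norm_mult norm_of_real using a assms F(2)
      by (intro mult_mono psi_diff_le assms) (auto simp: near_def)
  qed
  also have "\<dots> = real (card ?F) * (B * (C'' / rad k * dist z w))" by simp
  also have "\<dots> \<le> (2 * cnt 1) * (B * (C'' / rad k * dist z w))"
  proof (intro mult_right_mono)
    have "real (card ?F) \<le> real (card (near k z (rad k))) + real (card (near k w (rad k)))"
      by (metis card_Un_le of_nat_add of_nat_le_iff)
    also have "\<dots> \<le> cnt 1 + cnt 1" by (intro add_mono card_near) auto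
    finally show "real (card ?F) \<le> 2 * cnt 1" by simp
  qed (use assms Cpp_nonneg in auto)
  finally show ?thesis by (simp add: KL_def mult_ac)
qed

lemma Tn_bounded_ball: "\<exists>B\<ge>0. \<forall>z\<in>ball a r. cmod (Tn Xs \<psi> k u z) \<le> B"
proof (intro exI conjI ballI)
  let ?S = "\<Sum>b\<in>near k a (r + rad k). cmod (u (k, b))"
  show "0 \<le> ?S" by (intro sum_nonneg) auto
  fix z assume z: "z \<in> ball a r"
  have "cmod (Tn Xs \<psi> k u z - 0) \<le> ?S"
  proof (intro Tn_osc)
    fix b assume "b \<in> Xs k" "dist z b < rad k"
    then have "b \<in> near k a (r + rad k)"
      using z dist_triangle_less_add[of a z r b "rad k"] by (auto simp: near_def dist_commute)
    then show "cmod (u (k, b) - 0) \<le> ?S"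
      using member_le_sum[of b "near k a (r + rad k)" "\<lambda>b. cmod (u (k, b))"] by simp
  qed
  then show "cmod (Tn Xs \<psi> k u z) \<le> ?S" by simp
qed

text \<open>For arbitrary u only a local Lipschitz bound is available, with c = 0 and B depending on
  z. Continuity supplies the measurability behind \<open>locint_Tn\<close>.\<close>

lemma continuous_Tn: "continuous_on UNIV (Tn Xs \<psi> k u)"
proof (subst continuous_on_eq_continuous_at, simp, intro ballI)
  fix z
  let ?B = "\<Sum>b\<in>near k z (2 * rad k). cmod (u (k, b))"
  have bd: "cmod (Tn Xs \<psi> k u w - Tn Xs \<psi> k u z) \<le> KL * ?B * dist w z / rad k" if "dist z w < rad k" for w
  proof (intro Tn_lipschitz[where c = 0])
    fix b assume "b \<in> Xs k" "dist w b < rad k \<or> dist z b < rad k"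
    then have "b \<in> near k z (2 * rad k)"
      using that dist_triangle_less_add[of z w "rad k" b "rad k"] rad_pos[of k]
      unfolding near_def mem_Collect_eq by (smt (verit) dist_commute)
    then show "cmod (u (k, b) - 0) \<le> ?B"
      using member_le_sum[of b "near k z (2 * rad k)" "\<lambda>b. cmod (u (k, b))"] by simp
  qed (auto intro: sum_nonneg)
  have "((\<lambda>w. Tn Xs \<psi> k u w - Tn Xs \<psi> k u z) \<longlongrightarrow> 0) (at z)"
  proof (rule Lim_null_comparison)
    show "\<forall>\<^sub>F w in at z. cmod (Tn Xs \<psi> k u w - Tn Xs \<psi> k u z) \<le> KL * ?B * dist w z / rad k"
      unfolding eventually_at using bd by (intro exI[of _ "rad k"]) (auto simp: dist_commute)
    show "((\<lambda>w. KL * ?B * dist w z / rad k) \<longlongrightarrow> 0) (at z)"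
      by (auto intro!: tendsto_eq_intros)
  qed
  then show "isCont (Tn Xs \<psi> k u) z"
    unfolding isCont_def by (simp add: LIM_zero_iff)
qed

lemma locint_bounded:
  assumes "f \<in> borel_measurable borel" "\<And>a r. \<exists>B. \<forall>z\<in>ball a r. cmod (f z) \<le> B"
  shows "locally_integrable M f"
  unfolding locally_integrable_def
proof (intro allI)
  fix a r
  obtain B where B: "\<forall>z\<in>ball a r. cmod (f z) \<le> B" using assms(2) by blast
  show "set_integrable M (ball a r) f"
    unfolding set_integrable_def
  proof (rule Bochner_Integration.integrable_bound)
    show "integrable M (\<lambda>z. indicat_real (ball a r) z *\<^sub>R B)"
      using set_integrable_const[of a r B] by (simp add: set_integrable_def)
    show "(\<lambda>z. indicat_real (ball a r) z *\<^sub>R f z) \<in> borel_measurable M"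
      using assms(1) by (intro borel_measurable_scaleR borel_measurable_indicator) (auto simp: measurable_cong_sets[OF sets_M refl])
  qed (use B in \<open>auto simp: indicator_def intro!: AE_I2 order_trans[OF _ abs_ge_self]\<close>)
qed

lemma locint_Tn: "locally_integrable M (Tn Xs \<psi> k u)"
  using Tn_bounded_ball by (intro locint_bounded borel_measurable_continuous_onI continuous_Tn) blast

lemma l1_le_sum:
  assumes "locally_integrable M h" "finite F" "\<And>b. b \<in> F \<Longrightarrow> 0 \<le> w b"
    and "\<And>z. z \<in> ball a r \<Longrightarrow> cmod (h z) \<le> (\<Sum>b\<in>F. w b * indicat_real (ball b t) z)"
  shows "l1 (ball a r) h \<le> (\<Sum>b\<in>F. w b * measure M (ball b t))"
proof -
  have int: "integrable M (\<lambda>z. w b * indicat_real (ball b t) z)" for b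
    by (intro integrable_mult_right integrable_real_indicator) auto
  have "l1 (ball a r) h \<le> (LINT z|M. (\<Sum>b\<in>F. w b * indicat_real (ball b t) z))"
    unfolding l1_def set_lebesgue_integral_def
  proof (intro integral_mono)
    show "integrable M (\<lambda>z. indicat_real (ball a r) z *\<^sub>R cmod (h z))"
      using locint_norm[OF assms(1), of a r] by (simp add: set_integrable_def)
    fix z
    show "indicat_real (ball a r) z *\<^sub>R cmod (h z) \<le> (\<Sum>b\<in>F. w b * indicat_real (ball b t) z)"
      using assms(3,4) by (cases "z \<in> ball a r") (auto intro!: sum_nonneg)
  qed (intro Bochner_Integration.integrable_sum int)
  also have "\<dots> = (\<Sum>b\<in>F. w b * measure M (ball b t))"
    using int by (subst Bochner_Integration.integral_sum) auto
  finally show ?thesis .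
qed

subsection \<open>Convergence of the discrete approximations in local \<open>L\<^sup>1\<close>\<close>

abbreviation Tp :: "int \<Rightarrow> ('a \<Rightarrow> complex) \<Rightarrow> 'a \<Rightarrow> complex" where
  "Tp k f \<equiv> Tn Xs \<psi> k (Pavg M f)"

lemma Tp_diff:
  assumes "locally_integrable M f" "locally_integrable M g"
  shows "Tp k (\<lambda>z. f z - g z) w = Tp k f w - Tp k g w"
proof -
  have "Pavg M (\<lambda>z. f z - g z) = (\<lambda>x. Pavg M f x - Pavg M g x)"
    using Pavg_diff[OF assms] by (rule ext)
  then show ?thesis by (simp only: Tn_diff)
qed

lemma Tp_add:
  assumes "locally_integrable M f" "locally_integrable M g"
  shows "Tp k (\<lambda>z. f z + g z) w = Tp k f w + Tp k g w"
proof -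
  have "Pavg M (\<lambda>z. f z + g z) = (\<lambda>x. Pavg M f x + Pavg M g x)"
    using Pavg_add[OF assms] by (rule ext)
  then show ?thesis by (simp only: Tn_add)
qed

text \<open>Integrating the modulus of an average over its own ball gives back at most the L^1 norm
  of f there, and each point lies in at most \<open>cnt 1\<close> balls. The constant is independent
  of k. The radius grows by \<open>rad k\<close> to reach the centres and by \<open>rad k\<close>
  again to contain their balls.\<close>

lemma l1_Tp_le:
  assumes "locally_integrable M f"
  shows "l1 (ball a r) (Tp k f) \<le> cnt 1 * l1 (ball a (r + 2 * rad k)) f"
proof -
  let ?F = "near k a (r + rad k)"
  have F: "b \<in> ?F" if "z \<in> ball a r" "b \<in> Xs k" "dist z b < rad k" for z b
    using that dist_triangle_less_add[of a z r b "rad k"] by (auto simp: near_def dist_commute)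
  have int: "integrable M (\<lambda>z. indicat_real (ball b t) z * cmod (f z))" for b t
    using locint_norm[OF assms, of b t] by (simp add: set_integrable_def)
  have "l1 (ball a r) (Tp k f) \<le> (\<Sum>b\<in>?F. cmod (Pavg M f (k, b)) * measure M (ball b (rad k)))"
  proof (intro l1_le_sum locint_Tn)
    fix z assume z: "z \<in> ball a r"
    have "cmod (Tp k f z) \<le> (\<Sum>b\<in>near k z (rad k). cmod (Pavg M f (k, b) * complex_of_real (\<psi> (k, b) z)))"
      unfolding Tn_eq_near by (rule norm_sum)
    also have "\<dots> \<le> (\<Sum>b\<in>near k z (rad k). cmod (Pavg M f (k, b)) * indicat_real (ball b (rad k)) z)"
    proof (intro sum_mono)
      fix b assume b: "b \<in> near k z (rad k)"
      have "\<psi> (k, b) z = (\<Sum>c\<in>{b}. \<psi> (k, c) z)" by simp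
      also have "\<dots> \<le> (\<Sum>c\<in>near k z (rad k). \<psi> (k, c) z)"
        using b near_subset[of k z "rad k"] by (intro sum_mono2) (auto intro: psi_nonneg)
      also have "\<dots> = 1" by (intro sum_psi) (auto simp: near_subset)
      finally have "\<psi> (k, b) z \<le> 1" .
      then show "cmod (Pavg M f (k, b) * complex_of_real (\<psi> (k, b) z))
          \<le> cmod (Pavg M f (k, b)) * indicat_real (ball b (rad k)) z"
        using b psi_nonneg[of b k z] by (auto simp: norm_mult near_def dist_commute intro!: mult_left_le)
    qed
    also have "\<dots> \<le> (\<Sum>b\<in>?F. cmod (Pavg M f (k, b)) * indicat_real (ball b (rad k)) z)"
      using F[OF z] near_subset[of k z "rad k"] by (intro sum_mono2) (auto simp: near_def[of k z])
    finally show "cmod (Tp k f z) \<le> (\<Sum>b\<in>?F. cmod (Pavg M f (k, b)) * indicat_real (ball b (rad k)) z)" .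
  qed auto
  also have "\<dots> \<le> (\<Sum>b\<in>?F. l1 (ball b (rad k)) f)"
  proof (intro sum_mono)
    fix b
    show "cmod (Pavg M f (k, b)) * measure M (ball b (rad k)) \<le> l1 (ball b (rad k)) f"
      using norm_Pavg_le[OF assms, of k b] mu_pos[of "(k, b)"] by (simp add: mu_def field_simps)
  qed
  also have "\<dots> = (LINT z|M. (\<Sum>b\<in>?F. indicat_real (ball b (rad k)) z * cmod (f z)))"
    unfolding l1_def set_lebesgue_integral_def using int
    by (subst Bochner_Integration.integral_sum) auto
  also have "\<dots> \<le> (LINT z|M. cnt 1 * (indicat_real (ball a (r + 2 * rad k)) z * cmod (f z)))"
  proof (intro integral_mono Bochner_Integration.integrable_sum int integrable_mult_right)
    fix z
    have "(\<Sum>b\<in>?F. indicat_real (ball b (rad k)) z) \<le> cnt 1 * indicat_real (ball a (r + 2 * rad k)) z"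
    proof (cases "z \<in> ball a (r + 2 * rad k)")
      case True
      have "(\<Sum>b\<in>?F. indicat_real (ball b (rad k)) z) = (\<Sum>b\<in>{b\<in>?F. z \<in> ball b (rad k)}. 1)"
        by (intro sum.mono_neutral_cong_right) (auto simp: indicator_def)
      also have "\<dots> = real (card {b\<in>?F. z \<in> ball b (rad k)})" by simp
      also have "\<dots> \<le> real (card (near k z (rad k)))"
        using finite_near[of k z "rad k"] by (intro of_nat_mono card_mono) (auto simp: near_def dist_commute)
      also have "\<dots> \<le> cnt 1" by (intro card_near) auto
      finally show ?thesis using True by simp
    next
      case False
      have "z \<notin> ball b (rad k)" if "b \<in> ?F" for b
        using that False dist_triangle_less_add[of a b "r + rad k" z "rad k"]
        by (auto simp: near_def dist_commute)
      then have "(\<Sum>b\<in>?F. indicat_real (ball b (rad k)) z) = 0"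
        by (intro sum.neutral) auto
      then show ?thesis using False by simp
    qed
    then have "(\<Sum>b\<in>?F. indicat_real (ball b (rad k)) z) * cmod (f z)
        \<le> (cnt 1 * indicat_real (ball a (r + 2 * rad k)) z) * cmod (f z)"
      by (intro mult_right_mono) auto
    then show "(\<Sum>b\<in>?F. indicat_real (ball b (rad k)) z * cmod (f z))
        \<le> cnt 1 * (indicat_real (ball a (r + 2 * rad k)) z * cmod (f z))"
      unfolding sum_distrib_right by (simp only: mult.assoc)
  qed
  also have "\<dots> = cnt 1 * l1 (ball a (r + 2 * rad k)) f"
    unfolding l1_def set_lebesgue_integral_def by simp
  finally show ?thesis .
qed

text \<open>The levels run through the natural numbers here; \<open>l1_Tp_tendsto\<close> moves the
  statement to a sequence starting at an arbitrary integer level.\<close>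

definition approx :: "('a \<Rightarrow> complex) \<Rightarrow> bool" where
  "approx f \<longleftrightarrow> locally_integrable M f \<and>
     (\<forall>a r. (\<lambda>j. l1 (ball a r) (\<lambda>z. Tp (int j) f z - f z)) \<longlonglongrightarrow> 0)"

lemma locint_approx: "locally_integrable M f \<Longrightarrow> locally_integrable M (\<lambda>z. Tp k f z - f z)"
  by (intro locint_diff locint_Tn)

text \<open>The operators are uniformly bounded on local \<open>L\<^sup>1\<close>, so \<open>approx\<close> is closed under local \<open>L\<^sup>1\<close> limits;
  this carries it from Lipschitz functions to indicators of open and Borel sets and to integrable functions.\<close>
lemma approx_limit:
  assumes "\<And>i. approx (F i)" "locally_integrable M f"
    and lim: "\<And>a r. (\<lambda>i. l1 (ball a r) (\<lambda>z. F i z - f z)) \<longlonglongrightarrow> 0"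
  shows "approx f"
  unfolding approx_def
proof (intro conjI allI assms(2))
  fix a r
  have Fi: "locally_integrable M (F i)" for i using assms(1) by (simp add: approx_def)
  have bd: "l1 (ball a r) (\<lambda>z. Tp (int j) f z - f z) \<le>
      l1 (ball a r) (\<lambda>z. Tp (int j) (F i) z - F i z) + (cnt 1 + 1) * l1 (ball a (r + 2)) (\<lambda>z. F i z - f z)"
    for i j
  proof -
    have d: "locally_integrable M (\<lambda>z. f z - F i z)" "locally_integrable M (\<lambda>z. F i z - f z)"
      by (intro locint_diff assms Fi)+
    \<comment> \<open>Levels are nonnegative here, so the enlargement of the radius in
      \<open>l1_Tp_le\<close> is at most 2, uniformly in j.\<close>
    have r1: "rad (int j) \<le> 1"
      using rad_mono[of 0 "int j"] by (simp add: rad_def)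
    have eq: "Tp (int j) f z - f z = (Tp (int j) (F i) z - F i z) + (Tp (int j) (\<lambda>z. f z - F i z) z + (F i z - f z))" for z
      by (simp add: Tp_diff[OF assms(2) Fi])
    have "l1 (ball a r) (\<lambda>z. Tp (int j) f z - f z) \<le> l1 (ball a r) (\<lambda>z. Tp (int j) (F i) z - F i z)
        + l1 (ball a r) (\<lambda>z. Tp (int j) (\<lambda>z. f z - F i z) z + (F i z - f z))"
      unfolding eq by (intro l1_triangle locint_approx Fi locint_add locint_Tn d)
    also have "l1 (ball a r) (\<lambda>z. Tp (int j) (\<lambda>z. f z - F i z) z + (F i z - f z))
        \<le> l1 (ball a r) (Tp (int j) (\<lambda>z. f z - F i z)) + l1 (ball a r) (\<lambda>z. F i z - f z)"
      by (intro l1_triangle locint_Tn d)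
    also have "l1 (ball a r) (Tp (int j) (\<lambda>z. f z - F i z))
        \<le> cnt 1 * l1 (ball a (r + 2 * rad (int j))) (\<lambda>z. f z - F i z)"
      by (rule l1_Tp_le[OF d(1)])
    also have "l1 (ball a (r + 2 * rad (int j))) (\<lambda>z. f z - F i z) \<le> l1 (ball a (r + 2)) (\<lambda>z. f z - F i z)"
      using r1 by (intro l1_mono_set d subset_ball) auto
    also have "l1 (ball a (r + 2)) (\<lambda>z. f z - F i z) = l1 (ball a (r + 2)) (\<lambda>z. F i z - f z)"
      by (simp add: l1_def norm_minus_commute)
    also have "l1 (ball a r) (\<lambda>z. F i z - f z) \<le> l1 (ball a (r + 2)) (\<lambda>z. F i z - f z)"
      by (intro l1_mono_set d subset_ball) auto
    finally show ?thesis using cnt_ge_1[of 1] by (simp add: algebra_simps)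
  qed
  show "(\<lambda>j. l1 (ball a r) (\<lambda>z. Tp (int j) f z - f z)) \<longlonglongrightarrow> 0"
  proof (rule LIMSEQ_I)
    fix e :: real assume e: "e > 0"
    have "(\<lambda>i. (cnt 1 + 1) * l1 (ball a (r + 2)) (\<lambda>z. F i z - f z)) \<longlonglongrightarrow> (cnt 1 + 1) * 0"
      by (intro tendsto_mult_left lim)
    then have "\<forall>\<^sub>F i in sequentially. (cnt 1 + 1) * l1 (ball a (r + 2)) (\<lambda>z. F i z - f z) < e / 2"
      using e by (intro order_tendstoD) auto
    then obtain i where i: "(cnt 1 + 1) * l1 (ball a (r + 2)) (\<lambda>z. F i z - f z) < e / 2"
      by (auto simp: eventually_sequentially)
    have "\<forall>\<^sub>F j in sequentially. l1 (ball a r) (\<lambda>z. Tp (int j) (F i) z - F i z) < e / 2"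
      using assms(1)[of i] e unfolding approx_def by (intro order_tendstoD) auto
    then obtain N where "\<And>j. j \<ge> N \<Longrightarrow> l1 (ball a r) (\<lambda>z. Tp (int j) (F i) z - F i z) < e / 2"
      by (auto simp: eventually_sequentially)
    then have "l1 (ball a r) (\<lambda>z. Tp (int j) f z - f z) < e" if "j \<ge> N" for j
      using order.strict_trans1[OF bd[of j i] add_strict_mono[OF _ i]] that by (metis field_sum_of_halves)
    then show "\<exists>no. \<forall>j\<ge>no. norm (l1 (ball a r) (\<lambda>z. Tp (int j) f z - f z) - 0) < e"
      by auto
  qed
qed

lemma approx_add:
  assumes "approx f" "approx g"
  shows "approx (\<lambda>z. f z + g z)"
  unfolding approx_def
proof (intro conjI allI)
  have fg: "locally_integrable M f" "locally_integrable M g" using assms by (auto simp: approx_def)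
  then show "locally_integrable M (\<lambda>z. f z + g z)" by (rule locint_add)
  fix a r
  have "(\<lambda>j. l1 (ball a r) (\<lambda>z. Tp (int j) f z - f z) + l1 (ball a r) (\<lambda>z. Tp (int j) g z - g z)) \<longlonglongrightarrow> 0 + 0"
    using assms by (intro tendsto_add) (auto simp: approx_def)
  moreover have "l1 (ball a r) (\<lambda>z. Tp (int j) (\<lambda>z. f z + g z) z - (f z + g z))
      \<le> l1 (ball a r) (\<lambda>z. Tp (int j) f z - f z) + l1 (ball a r) (\<lambda>z. Tp (int j) g z - g z)" for j
    using l1_triangle[OF locint_approx[OF fg(1)] locint_approx[OF fg(2)], of a r "int j" "int j"]
    by (simp add: Tp_add[OF fg] algebra_simps)
  ultimately show "(\<lambda>j. l1 (ball a r) (\<lambda>z. Tp (int j) (\<lambda>z. f z + g z) z - (f z + g z))) \<longlonglongrightarrow> 0"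
    by (intro tendsto_0_upper[of _ _ "\<lambda>j. l1 (ball a r) (G j)" for G]) simp_all
qed

lemma locint_cmult: "locally_integrable M f \<Longrightarrow> locally_integrable M (\<lambda>z. c * f z)"
  by (auto simp: locally_integrable_def)

lemma approx_cmult:
  assumes "approx f"
  shows "approx (\<lambda>z. c * f z)"
  unfolding approx_def
proof (intro conjI allI)
  have f: "locally_integrable M f" using assms by (auto simp: approx_def)
  then show "locally_integrable M (\<lambda>z. c * f z)" by (rule locint_cmult)
  fix a r
  have P: "Pavg M (\<lambda>z. c * f z) = (\<lambda>x. c * Pavg M f x)"
    by (simp add: Pavg_def fun_eq_iff)
  have "l1 (ball a r) (\<lambda>z. Tp (int j) (\<lambda>z. c * f z) z - c * f z) = cmod c * l1 (ball a r) (\<lambda>z. Tp (int j) f z - f z)" for j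
    unfolding P Tn_cmult right_diff_distrib[symmetric] l1_def norm_mult by simp
  moreover have "(\<lambda>j. cmod c * l1 (ball a r) (\<lambda>z. Tp (int j) f z - f z)) \<longlonglongrightarrow> cmod c * 0"
    using assms by (intro tendsto_mult_left) (auto simp: approx_def)
  ultimately show "(\<lambda>j. l1 (ball a r) (\<lambda>z. Tp (int j) (\<lambda>z. c * f z) z - c * f z)) \<longlonglongrightarrow> 0"
    by simp
qed

lemma Pavg_minus_const_le:
  assumes "locally_integrable M f" "\<And>z. z \<in> ball a (rad k) \<Longrightarrow> cmod (f z - c) \<le> B"
  shows "cmod (Pavg M f (k, a) - c) \<le> B"
proof -
  have d: "locally_integrable M (\<lambda>z. f z - c)" using assms locint_const by (intro locint_diff)
  have "cmod (Pavg M f (k, a) - c) = cmod (Pavg M (\<lambda>z. f z - c) (k, a))"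
    using Pavg_diff[OF assms(1) locint_const, of c "(k, a)"] by (simp add: Pavg_const)
  also have "\<dots> \<le> l1 (ball a (rad k)) (\<lambda>z. f z - c) / mu (k, a)"
    by (rule norm_Pavg_le[OF d])
  also have "\<dots> \<le> B * measure M (ball a (rad k)) / mu (k, a)"
    using assms by (intro divide_right_mono l1_le_bound d) auto
  also have "\<dots> = B" using mu_neq_0[of "(k, a)"] unfolding mu_def by simp
  finally show ?thesis .
qed

text \<open>Convergence is even uniform: each average entering T_k at z is taken over a ball of
  radius \<open>rad k\<close> that contains z, so it differs from f(z) by at most
  \<open>L * (2 * rad k)\<close>.\<close>

lemma approx_lipschitz:
  assumes "L-lipschitz_on UNIV f"
  shows "approx f"
  unfolding approx_def
proof (intro conjI allI)
  have lip: "cmod (f z - f w) \<le> L * dist z w" for z w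
    using lipschitz_onD[OF assms, of z w] by (simp add: dist_norm)
  have L: "0 \<le> L" by (rule lipschitz_on_nonneg[OF assms])
  show f: "locally_integrable M f"
  proof (intro locint_bounded borel_measurable_continuous_onI lipschitz_on_continuous_on[OF assms])
    fix a r
    have "cmod (f z) \<le> cmod (f a) + L * r" if "z \<in> ball a r" for z
    proof -
      have "L * dist z a \<le> L * r"
        using that L by (intro mult_left_mono) (auto simp: dist_commute)
      then show ?thesis
        using lip[of z a] norm_triangle_sub[of "f z" "f a"] by linarith
    qed
    then show "\<exists>B. \<forall>z\<in>ball a r. cmod (f z) \<le> B" by blast
  qed
  fix a r
  have "cmod (Tp k f z - f z) \<le> L * (2 * rad k)" for k z
  proof (intro Tn_osc Pavg_minus_const_le f)
    fix b w assume "dist z b < rad k" "w \<in> ball b (rad k)"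
    then have "dist w z \<le> 2 * rad k"
      using dist_triangle[of w z b] by (auto simp: dist_commute)
    then show "cmod (f w - f z) \<le> L * (2 * rad k)"
      using lip[of w z] mult_left_mono[of "dist w z" "2 * rad k" L] L by linarith
  qed
  then have "l1 (ball a r) (\<lambda>z. Tp (int j) f z - f z) \<le> L * (2 * rad (int j)) * measure M (ball a r)" for j
    by (intro l1_le_bound locint_approx f)
  moreover have "(\<lambda>j. L * (2 * rad (int j)) * measure M (ball a r)) \<longlonglongrightarrow> L * (2 * 0) * measure M (ball a r)"
  proof (intro tendsto_mult tendsto_const)
    have "rad (int j) = (1 / 2) ^ j" for j
      by (simp add: rad_def powr_minus powr_realpow field_simps)
    then show "(\<lambda>j. rad (int j)) \<longlonglongrightarrow> 0" by (simp add: LIMSEQ_realpow_zero)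
  qed
  ultimately show "(\<lambda>j. l1 (ball a r) (\<lambda>z. Tp (int j) f z - f z)) \<longlonglongrightarrow> 0"
    by (intro tendsto_0_upper[of _ _ "\<lambda>j. l1 (ball a r) (G j)" for G]) simp_all
qed

lemma l1_dominated:
  assumes "\<And>i. locally_integrable M (F i)" "locally_integrable M f"
    and "\<And>z. (\<lambda>i. F i z) \<longlonglongrightarrow> f z" "\<And>(i::nat) z. cmod (F i z) \<le> w z"
    and "set_integrable M (ball a r) w"
  shows "(\<lambda>i. l1 (ball a r) (\<lambda>z. F i z - f z)) \<longlonglongrightarrow> 0"
proof -
  have int: "set_integrable M (ball a r) (\<lambda>z. F i z - f z)" for i
    by (intro locint_ball locint_diff assms)
  have "(\<lambda>i. LINT z|M. indicat_real (ball a r) z *\<^sub>R cmod (F i z - f z)) \<longlonglongrightarrow> (LINT z|M. 0)"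
  proof (rule integral_dominated_convergence)
    show "integrable M (\<lambda>z. indicat_real (ball a r) z *\<^sub>R w z + indicat_real (ball a r) z *\<^sub>R cmod (f z))"
      using assms(5) locint_norm[OF assms(2), of a r] by (simp add: set_integrable_def)
    show "(\<lambda>z. indicat_real (ball a r) z *\<^sub>R cmod (F i z - f z)) \<in> borel_measurable M" for i
      using locint_norm[OF locint_diff[OF assms(1)[of i] assms(2)], of a r]
      by (auto simp: set_integrable_def)
    show "AE z in M. (\<lambda>i. indicat_real (ball a r) z *\<^sub>R cmod (F i z - f z)) \<longlonglongrightarrow> 0"
    proof (rule AE_I2)
      fix z
      have "(\<lambda>i. indicat_real (ball a r) z *\<^sub>R cmod (F i z - f z)) \<longlonglongrightarrow> indicat_real (ball a r) z *\<^sub>R cmod (f z - f z)"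
        by (intro tendsto_scaleR tendsto_const tendsto_norm tendsto_diff assms)
      then show "(\<lambda>i. indicat_real (ball a r) z *\<^sub>R cmod (F i z - f z)) \<longlonglongrightarrow> 0" by simp
    qed
    show "AE z in M. norm (indicat_real (ball a r) z *\<^sub>R cmod (F i z - f z))
        \<le> indicat_real (ball a r) z *\<^sub>R w z + indicat_real (ball a r) z *\<^sub>R cmod (f z)" for i
    proof (rule AE_I2)
      fix z
      have "cmod (F i z - f z) \<le> w z + cmod (f z)"
        using norm_triangle_ineq4[of "F i z" "f z"] assms(4)[of i z] by linarith
      then show "norm (indicat_real (ball a r) z *\<^sub>R cmod (F i z - f z))
        \<le> indicat_real (ball a r) z *\<^sub>R w z + indicat_real (ball a r) z *\<^sub>R cmod (f z)"
        by (auto simp: indicator_def)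
    qed
  qed auto
  then show ?thesis by (simp add: l1_def set_lebesgue_integral_def)
qed

lemma locint_indicator: "A \<in> sets borel \<Longrightarrow> locally_integrable M (indicator A)"
  by (intro locint_bounded) (auto intro!: exI[of _ 1] simp: indicator_def)

lemma approx_open:
  assumes "open U"
  shows "approx (indicator U)"
proof (cases "- U = {}")
  case True
  then have "U = UNIV" by auto
  then have "indicator U = (\<lambda>_::'a. 1 :: complex)" by auto
  moreover have "approx (\<lambda>_. 1)"
    by (intro approx_lipschitz[of 0]) (auto intro: lipschitz_onI)
  ultimately show ?thesis by simp
next
  case False
  \<comment> \<open>Lipschitz functions with values in [0,1] that converge pointwise to the
    indicator of U. For U = UNIV this fails, as \<open>infdist\<close> to the empty set is 0; hence
    the case split.\<close>
  define F where "F = (\<lambda>(i::nat) z. complex_of_real (min 1 (real i * infdist z (- U))))"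
  have Fb: "cmod (F i z) \<le> 1" for i z
    by (auto simp: F_def norm_of_real infdist_nonneg min_def)
  have apF: "approx (F i)" for i
  proof (rule approx_lipschitz)
    have "\<bar>infdist z (- U) - infdist w (- U)\<bar> \<le> dist z w" for z w
      using infdist_triangle[of z "- U" w] infdist_triangle[of w "- U" z] by (auto simp: dist_commute)
    then have d: "\<bar>real i * infdist z (- U) - real i * infdist w (- U)\<bar> \<le> real i * dist z w" for z w
      unfolding right_diff_distrib[symmetric] abs_mult by (intro mult_mono) auto
    show "(real i)-lipschitz_on UNIV (F i)"
    proof (intro lipschitz_onI)
      fix z w :: 'a
      have "dist (F i z) (F i w) = \<bar>min 1 (real i * infdist z (- U)) - min 1 (real i * infdist w (- U))\<bar>"
        unfolding F_def dist_norm of_real_diff[symmetric] norm_of_real by simp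
      also have "\<dots> \<le> \<bar>real i * infdist z (- U) - real i * infdist w (- U)\<bar>" by linarith
      finally show "dist (F i z) (F i w) \<le> real i * dist z w" using d[of z w] by linarith
    qed auto
  qed
  show ?thesis
  proof (rule approx_limit[OF apF])
    show "locally_integrable M (indicator U)" using assms by (intro locint_indicator) auto
    fix a r
    show "(\<lambda>i. l1 (ball a r) (\<lambda>z. F i z - indicator U z)) \<longlonglongrightarrow> 0"
    proof (rule l1_dominated)
      show "locally_integrable M (F i)" for i using apF by (simp add: approx_def)
      show "locally_integrable M (indicator U)" using assms by (intro locint_indicator) auto
      show "set_integrable M (ball a r) (\<lambda>_. 1::real)" by (rule set_integrable_const)
      fix z
      show "(\<lambda>i. F i z) \<longlonglongrightarrow> indicator U z"
      proof (cases "z \<in> U")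
        case True
        have "0 < infdist z (- U)"
          using True False assms by (intro infdist_pos_not_in_closed) (auto simp: closed_Compl)
        then obtain N :: nat where N: "1 < real N * infdist z (- U)"
          using reals_Archimedean3 by blast
        have "F i z = 1" if "i \<ge> N" for i
        proof -
          have "real N * infdist z (- U) \<le> real i * infdist z (- U)"
            using that infdist_nonneg by (intro mult_right_mono) auto
          then show ?thesis using N by (auto simp: F_def)
        qed
        then show ?thesis using True by (intro tendsto_eventually) (auto simp: eventually_sequentially)
      next
        case False
        then show ?thesis by (simp add: F_def)
      qed
    qed (use Fb in auto)
  qed
qed

lemma Int_stable_open: "Int_stable {S::'a set. open S}"
  by (auto simp: Int_stable_def)

text \<open>Dynkin's pi-lambda argument, starting from the intersection-stable open sets.
  Complements are handled by linearity, UNIV being open; disjoint unions by finite sums and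
  dominated convergence on each ball.\<close>

lemma approx_borel:
  assumes "A \<in> sets borel"
  shows "approx (indicator A)"
proof (rule sigma_sets_induct_disjoint[OF Int_stable_open, of UNIV])
  show "A \<in> sigma_sets UNIV {S. open S}" using assms by (simp add: borel_def)
  show "approx (indicator S)" if "S \<in> {S. open S}" for S using that approx_open by auto
  show "approx (indicator {})" by (rule approx_open) simp
  have borel: "S \<in> sigma_sets UNIV {S. open S} \<Longrightarrow> S \<in> sets borel" for S :: "'a set"
    by (simp add: borel_def)
  show "approx (indicator (UNIV - S))" if "approx (indicator S)" for S
  proof -
    have "approx (\<lambda>z. indicator UNIV z + (- 1) * indicator S z)"
      by (intro approx_add approx_cmult that approx_open) auto
    moreover have "(\<lambda>z. indicator UNIV z + (- 1) * indicator S z) = (indicator (UNIV - S) :: 'a \<Rightarrow> complex)"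
      by (auto simp: indicator_def)
    ultimately show ?thesis by simp
  qed
  show "approx (indicator (\<Union>i. S i))"
    if S: "disjoint_family S" "range S \<subseteq> sigma_sets UNIV {S. open S}" "\<And>i. approx (indicator (S i))" for S :: "nat \<Rightarrow> 'a set"
  proof -
    have Sb: "S i \<in> sets borel" for i using S(2) borel by blast
    have eq: "(\<lambda>z. \<Sum>i<n. indicator (S i) z) = (indicator (\<Union>i<n. S i) :: 'a \<Rightarrow> complex)" for n
      using disjoint_family_on_mono[OF _ S(1), of "{..<n}"]
      by (intro ext indicator_UN_disjoint[symmetric]) auto
    have ap: "approx (indicator (\<Union>i<n. S i))" for n
      unfolding eq[symmetric]
    proof (induction n)
      case 0
      show ?case using approx_lipschitz[of 0 "\<lambda>_. 0"] by (simp add: lipschitz_on_def)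
    next
      case (Suc n)
      then show ?case using approx_add[OF Suc S(3)[of n]] by simp
    qed
    have lU: "locally_integrable M (indicator (\<Union>i. S i))"
      using Sb by (intro locint_indicator) auto
    show ?thesis
    proof (rule approx_limit[OF ap lU])
      fix a r
      show "(\<lambda>n. l1 (ball a r) (\<lambda>z. indicator (\<Union>i<n. S i) z - indicator (\<Union>i. S i) z)) \<longlonglongrightarrow> 0"
      proof (rule l1_dominated[OF _ lU])
        show "locally_integrable M (indicator (\<Union>i<n. S i))" for n
          using ap by (simp add: approx_def)
        show "set_integrable M (ball a r) (\<lambda>_. 1::real)" by (rule set_integrable_const)
        show "cmod (indicator (\<Union>i<n. S i) z) \<le> 1" for n z by (simp add: indicator_def)
        show "(\<lambda>n. indicator (\<Union>i<n. S i) z :: complex) \<longlonglongrightarrow> indicator (\<Union>i. S i) z" for z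
          by (rule LIMSEQ_indicator_UN)
      qed
    qed
  qed
qed auto

lemma locint_integrable: "integrable M f \<Longrightarrow> locally_integrable M f"
  unfolding locally_integrable_def set_integrable_def
  by (auto intro!: integrable_mult_indicator)

lemma approx_integrable:
  assumes "integrable M f"
  shows "approx f"
  using assms
proof (induction rule: integrable_induct)
  case (base A c)
  have "approx (\<lambda>z. c * indicator A z)"
    using base by (intro approx_cmult approx_borel) auto
  moreover have "(\<lambda>z. c * indicator A z) = (\<lambda>z. indicat_real A z *\<^sub>R c)"
    by (auto simp: indicator_def)
  ultimately show ?case by simp
next
  case (add f g)
  then show ?case by (intro approx_add)
next
  case (lim f s)
  show ?case
  proof (rule approx_limit[OF lim(5) locint_integrable[OF lim(4)]])
    fix a r
    show "(\<lambda>i. l1 (ball a r) (\<lambda>z. s i z - f z)) \<longlonglongrightarrow> 0"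
    proof (rule l1_dominated[OF locint_integrable[OF lim(1)] locint_integrable[OF lim(4)]])
      show "(\<lambda>i. s i z) \<longlonglongrightarrow> f z" for z using lim(2) by simp
      show "cmod (s i z) \<le> 2 * cmod (f z)" for i z using lim(3) by simp
      show "set_integrable M (ball a r) (\<lambda>z. 2 * cmod (f z))"
        using locint_norm[OF locint_integrable[OF lim(4)], of a r] by simp
    qed
  qed
qed

text \<open>The operator is local: on \<open>ball a r\<close> the functions T_j(Pf) with j \<ge> 0
  depend only on the values of f in \<open>ball a (r + 2)\<close>, so f may be cut off to an
  integrable function.\<close>

lemma approx_locally_integrable:
  assumes "locally_integrable M f"
  shows "(\<lambda>j. l1 (ball a r) (\<lambda>z. Tp (int j) f z - f z)) \<longlonglongrightarrow> 0"
proof -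
  define g where "g = (\<lambda>z. indicat_real (ball a (r + 2)) z *\<^sub>R f z)"
  have "integrable M g" using locint_ball[OF assms, of a "r + 2"] by (simp add: g_def set_integrable_def)
  then have "(\<lambda>j. l1 (ball a r) (\<lambda>z. Tp (int j) g z - g z)) \<longlonglongrightarrow> 0"
    using approx_integrable by (simp add: approx_def)
  moreover have "l1 (ball a r) (\<lambda>z. Tp (int j) g z - g z) = l1 (ball a r) (\<lambda>z. Tp (int j) f z - f z)" for j
    unfolding l1_def
  proof (intro set_lebesgue_integral_cong allI impI)
    have r1: "rad (int j) \<le> 1"
      using rad_mono[of 0 "int j"] by (simp add: rad_def)
    fix z assume z: "z \<in> ball a r"
    have "Tp (int j) g z = Tp (int j) f z"
    proof (rule Tn_cong)
      fix b assume b: "dist z b < rad (int j)"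
      have "w \<in> ball a (r + 2)" if "w \<in> ball b (rad (int j))" for w
        using b z that r1 dist_triangle[of a b z] dist_triangle[of a w b] by auto
      then have "(LINT w:ball b (rad (int j))|M. g w) = (LINT w:ball b (rad (int j))|M. f w)"
        by (intro set_lebesgue_integral_cong) (auto simp: g_def)
      then show "Pavg M g (int j, b) = Pavg M f (int j, b)" by (simp add: Pavg_def)
    qed
    moreover have "g z = f z" using z by (auto simp: g_def indicator_def)
    ultimately show "cmod (Tp (int j) g z - g z) = cmod (Tp (int j) f z - f z)" by simp
  qed auto
  ultimately show ?thesis by simp
qed

subsection \<open>Level norms\<close>

text \<open>\<open>nb p k w a\<close> says that the weighted \<open>\<ell>\<^sup>p\<close> norm of \<open>w\<close> on level \<open>k\<close> is at most \<open>a\<close>; up to constants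
  this is the \<open>L\<^sup>p\<close> norm of \<open>level_fun\<close>.\<close>
definition nb :: "ennreal \<Rightarrow> int \<Rightarrow> ('a \<Rightarrow> real) \<Rightarrow> real \<Rightarrow> bool" where
  "nb p k w a \<longleftrightarrow> (if p = \<infinity> then \<forall>x\<in>Xs k. w x \<le> a
     else \<forall>F. finite F \<and> F \<subseteq> Xs k \<longrightarrow> (\<Sum>x\<in>F. w x powr enn2real p * mu (k, x)) \<le> a powr enn2real p)"

lemma nb_mono:
  assumes "nb p k w' b" "\<And>x. x \<in> Xs k \<Longrightarrow> 0 \<le> w x" "\<And>x. x \<in> Xs k \<Longrightarrow> w x \<le> w' x" "0 \<le> b" "b \<le> a"
  shows "nb p k w a"
proof (cases "p = \<infinity>")
  case True
  then show ?thesis using assms by (simp add: nb_def) (meson order_trans)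
next
  case False
  have "(\<Sum>x\<in>F. w x powr enn2real p * mu (k, x)) \<le> a powr enn2real p" if F: "finite F" "F \<subseteq> Xs k" for F
  proof -
    have "(\<Sum>x\<in>F. w x powr enn2real p * mu (k, x)) \<le> (\<Sum>x\<in>F. w' x powr enn2real p * mu (k, x))"
      using F assms by (intro sum_mono mult_right_mono powr_mono2) auto
    also have "\<dots> \<le> b powr enn2real p" using assms(1) F False by (auto simp: nb_def)
    also have "\<dots> \<le> a powr enn2real p" using assms by (intro powr_mono2) auto
    finally show ?thesis .
  qed
  then show ?thesis using False by (simp add: nb_def)
qed

lemma nb_cmult:
  assumes "nb p k w a" "0 \<le> c" "0 \<le> a" "\<And>x. x \<in> Xs k \<Longrightarrow> 0 \<le> w x"
  shows "nb p k (\<lambda>x. c * w x) (c * a)"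
proof (cases "p = \<infinity>")
  case True
  then show ?thesis using assms by (auto simp: nb_def intro!: mult_left_mono)
next
  case False
  have "(\<Sum>x\<in>F. (c * w x) powr enn2real p * mu (k, x)) \<le> (c * a) powr enn2real p" if F: "finite F" "F \<subseteq> Xs k" for F
  proof -
    have "(\<Sum>x\<in>F. (c * w x) powr enn2real p * mu (k, x)) = c powr enn2real p * (\<Sum>x\<in>F. w x powr enn2real p * mu (k, x))"
      unfolding sum_distrib_left using F assms by (intro sum.cong) (auto simp: powr_mult)
    also have "\<dots> \<le> c powr enn2real p * a powr enn2real p"
      using assms F False by (intro mult_left_mono) (auto simp: nb_def)
    finally show ?thesis using assms by (simp add: powr_mult)
  qed
  then show ?thesis using False by (simp add: nb_def)
qed

lemma enn2real_pos: "0 < p \<Longrightarrow> p \<noteq> \<infinity> \<Longrightarrow> 0 < enn2real p"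
  by (simp add: enn2real_positive_iff less_top)

text \<open>Since \<open>enn2real \<infinity> = 0\<close> and \<open>1 / 0 = 0\<close>, the exponent \<open>1 / enn2real p\<close> in the following constants
  is \<open>0\<close> for \<open>p = \<infinity>\<close>, which is the right value.\<close>
definition Kadd :: "ennreal \<Rightarrow> real" where
  "Kadd p = 2 * 2 powr (1 / enn2real p)"

lemma Kadd_ge_2: "2 \<le> Kadd p"
  by (simp add: Kadd_def ge_one_powr_ge_zero)

text \<open>In \<open>Kadd\<close> the factor 2 comes from \<open>powr_add_le\<close>, and
  \<open>2 powr (1 / p)\<close> from replacing both a and b by a + b; this is valid for all finite p
  > 0, below 1 as well.\<close>

lemma nb_add:
  assumes "nb p k w a" "nb p k w' b" "0 \<le> a" "0 \<le> b" "0 < p"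
    "\<And>x. x \<in> Xs k \<Longrightarrow> 0 \<le> w x" "\<And>x. x \<in> Xs k \<Longrightarrow> 0 \<le> w' x"
  shows "nb p k (\<lambda>x. w x + w' x) (Kadd p * (a + b))"
proof (cases "p = \<infinity>")
  case True
  have "w x + w' x \<le> Kadd p * (a + b)" if "x \<in> Xs k" for x
  proof -
    have "w x + w' x \<le> 1 * (a + b)" using assms True that by (auto simp: nb_def intro: add_mono)
    also have "\<dots> \<le> Kadd p * (a + b)" using Kadd_ge_2[of p] assms by (intro mult_right_mono) auto
    finally show ?thesis .
  qed
  then show ?thesis using True by (simp add: nb_def)
next
  case False
  let ?r = "enn2real p"
  have r: "0 < ?r" using assms False by (intro enn2real_pos)
  have "(\<Sum>x\<in>F. (w x + w' x) powr ?r * mu (k, x)) \<le> (Kadd p * (a + b)) powr ?r" if F: "finite F" "F \<subseteq> Xs k" for F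
  proof -
    have "(\<Sum>x\<in>F. (w x + w' x) powr ?r * mu (k, x)) \<le> (\<Sum>x\<in>F. 2 powr ?r * (w x powr ?r + w' x powr ?r) * mu (k, x))"
      using F assms r by (intro sum_mono mult_right_mono powr_add_le) auto
    also have "\<dots> = 2 powr ?r * ((\<Sum>x\<in>F. w x powr ?r * mu (k, x)) + (\<Sum>x\<in>F. w' x powr ?r * mu (k, x)))"
      by (simp add: sum_distrib_left sum.distrib algebra_simps)
    also have "\<dots> \<le> 2 powr ?r * (a powr ?r + b powr ?r)"
      using assms F False by (intro mult_left_mono add_mono) (auto simp: nb_def)
    also have "\<dots> \<le> 2 powr ?r * ((a + b) powr ?r + (a + b) powr ?r)"
      using assms r by (intro mult_left_mono add_mono powr_mono2) auto
    also have "\<dots> = (Kadd p * (a + b)) powr ?r"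
      using assms r by (simp add: Kadd_def powr_mult powr_powr)
    finally show ?thesis .
  qed
  then show ?thesis using False by (simp add: nb_def)
qed

definition Kpar :: "ennreal \<Rightarrow> real" where
  "Kpar p = (C * 4 powr Q) powr (1 / enn2real p)"

text \<open>The number of descendants of a vertex grows with k - m, but their balls lie in the ball
  of the parent with bounded overlap, so their total measure is at most a fixed multiple of its
  measure. The constant is therefore independent of k - m.\<close>

lemma nb_parent:
  assumes "nb p m w a" "0 \<le> a" "0 < p" "m < k" "\<And>x. x \<in> Xs m \<Longrightarrow> 0 \<le> w x"
    and par: "\<And>x. x \<in> Xs k \<Longrightarrow> par x \<in> Xs m \<and> dist x (par x) < rad m / 2"
  shows "nb p k (\<lambda>x. w (par x)) (Kpar p * a)"
proof (cases "p = \<infinity>")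
  case True
  then show ?thesis using assms C_ge_1 by (auto simp: nb_def Kpar_def)
next
  case False
  let ?r = "enn2real p"
  have r: "0 < ?r" using assms False by (intro enn2real_pos)
  have "(\<Sum>x\<in>F. w (par x) powr ?r * mu (k, x)) \<le> (Kpar p * a) powr ?r" if F: "finite F" "F \<subseteq> Xs k" for F
  proof -
    have "(\<Sum>x\<in>F. w (par x) powr ?r * mu (k, x))
        = (\<Sum>b\<in>par ` F. \<Sum>x | x \<in> F \<and> par x = b. w (par x) powr ?r * mu (k, x))"
      by (rule sum.image_gen[OF F(1)])
    also have "\<dots> = (\<Sum>b\<in>par ` F. w b powr ?r * (\<Sum>x | x \<in> F \<and> par x = b. mu (k, x)))"
      by (auto simp: sum_distrib_left intro!: sum.cong)
    also have "\<dots> \<le> (\<Sum>b\<in>par ` F. w b powr ?r * (C * 4 powr Q * mu (m, b)))"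
    proof (intro sum_mono mult_left_mono)
      fix b assume "b \<in> par ` F"
      show "(\<Sum>x | x \<in> F \<and> par x = b. mu (k, x)) \<le> C * 4 powr Q * mu (m, b)"
        unfolding mu_def[of "(m, b)"] hball_rad
      proof (intro sum_mu_le)
        fix x assume x: "x \<in> {x. x \<in> F \<and> par x = b}"
        then have d: "dist x b < rad m / 2" using par F by auto
        have "rad k \<le> rad m / 2" using rad_mono[of "m + 1" k] assms(4) by (simp add: rad_Suc)
        then show "ball x (rad k) \<subseteq> ball b (rad m)"
          using d dist_triangle_less_add[of b x "rad m / 2" _ "rad k"]
          by (auto simp: dist_commute) (smt (verit) dist_commute dist_triangle field_sum_of_halves)
      qed (use F in auto)
    qed auto
    also have "\<dots> = C * 4 powr Q * (\<Sum>b\<in>par ` F. w b powr ?r * mu (m, b))"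
      by (simp add: sum_distrib_left mult_ac)
    also have "\<dots> \<le> C * 4 powr Q * a powr ?r"
      using assms(1) F False par C_ge_1 by (intro mult_left_mono) (auto simp: nb_def)
    also have "\<dots> = (Kpar p * a) powr ?r"
      using assms r C_ge_1 by (simp add: Kpar_def powr_mult powr_powr)
    finally show ?thesis .
  qed
  then show ?thesis using False by (simp add: nb_def)
qed

subsection \<open>Fine scales\<close>

abbreviation DP :: "('a \<Rightarrow> complex) \<Rightarrow> int \<times> 'a \<Rightarrow> real" where
  "DP f \<equiv> dnorm Xs (Pavg M f)"

definition K3 :: real where
  "K3 = K2 * (KL * 5) * (C * 5 powr Q)"

lemma K3_nonneg: "0 \<le> K3"
  using K2_nonneg KL_nonneg C_ge_1 by (simp add: K3_def)

text \<open>Subtracting the value at x leaves \<open>DP\<close> unchanged, so the Lipschitz bound of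
  T_n(Pf) over the radius \<open>5 * rad k\<close> can be fed into \<open>dnorm_Pavg_le\<close>; the
  quotient of \<open>rad k\<close> and \<open>rad n\<close> is the gain. From k \<ge> n + 3 on,
  \<open>5 * rad k\<close> is below \<open>rad n\<close>, and the whole ball lies in the ball of the
  vertex (n - 1, b), whose radius is \<open>2 * rad n\<close>. \<open>K3\<close> multiplies the
  three constants met on the way.\<close>

lemma DP_Tp_fine:
  assumes "locally_integrable M f" "n + 3 \<le> k" "b \<in> Xs (n - 1)" "dist x b < rad n"
  shows "DP (Tp n f) (k, x) \<le> K3 * rad (k - n) * DP f (n - 1, b)"
proof -
  let ?g = "Tp n f"
  let ?c = "?g x" and ?v = "DP f (n - 1, b)"
  let ?h = "\<lambda>z. ?g z - ?c"
  have h: "locally_integrable M ?h" by (intro locint_diff locint_Tn locint_const)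
  have "Pavg M ?h = (\<lambda>y. Pavg M ?g y - ?c)"
    using Pavg_diff[OF locint_Tn locint_const] by (auto simp: Pavg_const)
  then have eq: "DP ?g (k, x) = DP ?h (k, x)" by (simp add: dnorm_def)
  have r3: "rad (n + 3) = rad n / 8"
    using rad_add[of n 3] by (simp add: rad_def powr_minus)
  have rk: "5 * rad k < rad n"
    using rad_mono[OF assms(2)] r3 rad_pos[of n] by linarith
  have rn: "rad (n - 1) = 2 * rad n" by (rule rad_pred)
  have "cmod (?h z) \<le> KL * ?v * (5 * rad k) / rad n" if z: "z \<in> ball x (5 * rad k)" for z
  proof -
    have "dist x z < 5 * rad k" "dist b x < rad n" using z assms(4) by (auto simp: dist_commute)
    then have "dist b z < 2 * rad n" "dist b x < 2 * rad n"
      using rk rad_pos[of n] dist_triangle[of b z x] by linarith+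
    then have zb: "z \<in> ball b (rad (n - 1))" "x \<in> ball b (rad (n - 1))"
      by (simp_all add: rn)
    have "cmod (?g z - ?g x) \<le> KL * ?v * dist z x / rad n"
    proof (intro Tn_lipschitz)
      \<comment> \<open>The vertex (n, a) shares z or x with the ball of (n - 1, b), so the average
        at (n - 1, b) is a common reference value for all vertices involved. This is why level n - 1
        enters.\<close>
      fix a assume a: "a \<in> Xs n" "dist z a < rad n \<or> dist x a < rad n"
      show "cmod (Pavg M f (n, a) - Pavg M f (n - 1, b)) \<le> ?v"
        using a(2)
      proof
        assume "dist z a < rad n"
        then show ?thesis using a(1) assms(3) zb by (intro diff_le_dnorm[where z = z]) (auto simp: dist_commute)
      next
        assume "dist x a < rad n"
        then show ?thesis using a(1) assms(3) zb by (intro diff_le_dnorm[where z = x]) (auto simp: dist_commute)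
      qed
    qed simp
    also have "\<dots> \<le> KL * ?v * (5 * rad k) / rad n"
      using z KL_nonneg by (intro divide_right_mono mult_left_mono) (auto simp: dist_commute)
    finally show ?thesis .
  qed
  then have "l1 (ball x (5 * rad k)) ?h \<le> KL * ?v * (5 * rad k) / rad n * measure M (ball x (5 * rad k))"
    by (intro l1_le_bound h)
  also have "\<dots> \<le> KL * ?v * (5 * rad k) / rad n * (C * 5 powr Q * mu (k, x))"
    using KL_nonneg by (intro mult_left_mono measure_ball_le_mu) auto
  finally have l: "l1 (ball x (5 * rad k)) ?h \<le> KL * ?v * (5 * rad k) / rad n * (C * 5 powr Q * mu (k, x))" .
  have "DP ?h (k, x) \<le> K2 * l1 (ball x (5 * rad k)) ?h / mu (k, x)"
    by (rule dnorm_Pavg_le[OF h])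
  also have "\<dots> \<le> K2 * (KL * ?v * (5 * rad k) / rad n * (C * 5 powr Q * mu (k, x))) / mu (k, x)"
    using l K2_nonneg by (intro divide_right_mono mult_left_mono) auto
  also have "\<dots> = K3 * rad (k - n) * ?v"
    by (simp add: K3_def rad_minus)
  finally show ?thesis unfolding eq .
qed

lemma nb_DP_Tp_fine:
  assumes "locally_integrable M f" "n + 3 \<le> k" "0 < p" "0 \<le> a" "nb p (n - 1) (\<lambda>x. DP f (n - 1, x)) a"
  shows "nb p k (\<lambda>x. DP (Tp n f) (k, x)) (K3 * rad (k - n) * (Kpar p * a))"
proof -
  \<comment> \<open>Half of \<open>rad (n - 1)\<close> is \<open>rad n\<close>, exactly the distance
    that \<open>DP_Tp_fine\<close> allows.\<close>
  have "\<forall>x. \<exists>b. b \<in> Xs (n - 1) \<and> dist x b < rad (n - 1) / 2" using net by blast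
  then obtain par where par: "\<And>x. par x \<in> Xs (n - 1) \<and> dist x (par x) < rad (n - 1) / 2" by metis
  have c: "0 \<le> K3 * rad (k - n)" using K3_nonneg by simp
  have K0: "0 \<le> Kpar p" by (simp add: Kpar_def)
  have "nb p k (\<lambda>x. DP f (n - 1, par x)) (Kpar p * a)"
    using assms par by (intro nb_parent[where m = "n - 1"]) auto
  then have "nb p k (\<lambda>x. K3 * rad (k - n) * DP f (n - 1, par x)) (K3 * rad (k - n) * (Kpar p * a))"
    using c K0 assms by (intro nb_cmult) auto
  then show ?thesis
  proof (rule nb_mono)
    show "DP (Tp n f) (k, x) \<le> K3 * rad (k - n) * DP f (n - 1, par x)" for x
      using assms par[of x] by (intro DP_Tp_fine) (auto simp: rad_pred)
    show "0 \<le> K3 * rad (k - n) * (Kpar p * a)" using c K0 assms by simp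
  qed simp_all
qed

subsection \<open>Coarse scales\<close>

text \<open>The radius \<open>9 * rad k\<close> is \<open>5 * rad k\<close> from \<open>dnorm_Pavg_le\<close> plus \<open>rad m\<close>, which is at most \<open>4 * rad k\<close>
  for \<open>k \<le> m + 2\<close>.\<close>
definition avg :: "('a \<Rightarrow> complex) \<Rightarrow> int \<Rightarrow> int \<Rightarrow> 'a \<Rightarrow> real" where
  "avg f k m x = (\<Sum>b\<in>near m x (9 * rad k). mu (m, b) / mu (k, x) * DP f (m, b))"

lemma avg_nonneg [simp]: "0 \<le> avg f k m x"
  by (simp add: avg_def sum_nonneg)

lemma rad_coarse: "k \<le> m + 2 \<Longrightarrow> rad m \<le> 4 * rad k"
proof -
  assume "k \<le> m + 2"
  moreover have "rad (m + 2) = rad m / 4" by (simp add: rad_add) (simp add: rad_def powr_minus)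
  ultimately show ?thesis using rad_mono[of k "m + 2"] by simp
qed

text \<open>Both T_m and T_(m+1) combine at z averages at vertices sharing z with the ball of (m,
  a), so both stay within \<open>DP f (m, a)\<close> of the average at (m, a).\<close>

lemma Tp_step_le:
  assumes "a \<in> Xs m" "dist z a < rad m"
  shows "cmod (Tp (m + 1) f z - Tp m f z) \<le> 2 * DP f (m, a)"
proof -
  let ?c = "Pavg M f (m, a)"
  have "cmod (Tp (m + 1) f z - ?c) \<le> DP f (m, a)"
  proof (intro Tn_osc)
    fix b assume "b \<in> Xs (m + 1)" "dist z b < rad (m + 1)"
    then show "cmod (Pavg M f (m + 1, b) - ?c) \<le> DP f (m, a)"
      using assms by (intro diff_le_dnorm[where z = z]) (auto simp: dist_commute)
  qed
  moreover have "cmod (Tp m f z - ?c) \<le> DP f (m, a)"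
  proof (intro Tn_osc)
    fix b assume "b \<in> Xs m" "dist z b < rad m"
    then show "cmod (Pavg M f (m, b) - ?c) \<le> DP f (m, a)"
      using assms by (intro diff_le_dnorm[where z = z]) (auto simp: dist_commute)
  qed
  ultimately show ?thesis
    using norm_triangle_ineq4[of "Tp (m + 1) f z - ?c" "Tp m f z - ?c"] by simp
qed

lemma l1_step_le:
  assumes "locally_integrable M f" "k \<le> m + 2"
  shows "l1 (ball x (5 * rad k)) (\<lambda>z. Tp (m + 1) f z - Tp m f z) \<le> 2 * mu (k, x) * avg f k m x"
proof -
  let ?F = "near m x (9 * rad k)"
  have "l1 (ball x (5 * rad k)) (\<lambda>z. Tp (m + 1) f z - Tp m f z)
      \<le> (\<Sum>b\<in>?F. 2 * DP f (m, b) * measure M (ball b (rad m)))"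
  proof (intro l1_le_sum locint_diff locint_Tn)
    fix z assume z: "z \<in> ball x (5 * rad k)"
    obtain a where a: "a \<in> Xs m" "dist z a < rad m / 2" using net by blast
    then have za: "dist z a < rad m" using rad_pos[of m] by linarith
    have "dist x a < 9 * rad k"
      using z za rad_coarse[OF assms(2)] dist_triangle[of x a z] by auto
    then have aF: "a \<in> ?F" using a by (simp add: near_def)
    have "cmod (Tp (m + 1) f z - Tp m f z) \<le> 2 * DP f (m, a) * indicat_real (ball a (rad m)) z"
      using Tp_step_le[OF a(1) za] za by (simp add: dist_commute)
    also have "\<dots> \<le> (\<Sum>b\<in>?F. 2 * DP f (m, b) * indicat_real (ball b (rad m)) z)"
      using aF by (intro member_le_sum) auto
    finally show "cmod (Tp (m + 1) f z - Tp m f z) \<le> (\<Sum>b\<in>?F. 2 * DP f (m, b) * indicat_real (ball b (rad m)) z)" .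
  qed auto
  also have "\<dots> = 2 * mu (k, x) * avg f k m x"
    unfolding avg_def sum_distrib_left by (intro sum.cong) (auto simp: mu_def[of "(m, _)"])
  finally show ?thesis .
qed

text \<open>The remainder is kept explicit and N finite; the limit is taken only in the last step of
  \<open>nb_coarse_fin\<close> and \<open>nb_coarse_inf\<close>.\<close>

lemma l1_telescope:
  assumes "locally_integrable M f" "k \<le> n + 2"
  shows "l1 (ball x (5 * rad k)) (\<lambda>z. Tp n f z - f z) \<le>
    2 * mu (k, x) * (\<Sum>i<N. avg f k (n + int i) x) + l1 (ball x (5 * rad k)) (\<lambda>z. Tp (n + int N) f z - f z)"
proof (induction N)
  case (Suc N)
  let ?B = "ball x (5 * rad k)" and ?m = "n + int N"
  have "l1 ?B (\<lambda>z. Tp ?m f z - f z)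
      = l1 ?B (\<lambda>z. (Tp (?m + 1) f z - f z) + (Tp ?m f z - Tp (?m + 1) f z))"
    by simp
  also have "\<dots> \<le> l1 ?B (\<lambda>z. Tp (?m + 1) f z - f z) + l1 ?B (\<lambda>z. Tp ?m f z - Tp (?m + 1) f z)"
    by (intro l1_triangle locint_diff locint_Tn assms)
  also have "l1 ?B (\<lambda>z. Tp ?m f z - Tp (?m + 1) f z) = l1 ?B (\<lambda>z. Tp (?m + 1) f z - Tp ?m f z)"
    by (simp add: l1_def norm_minus_commute)
  also have "\<dots> \<le> 2 * mu (k, x) * avg f k ?m x"
    using assms by (intro l1_step_le) auto
  finally show ?case
    using Suc by (simp add: algebra_simps)
qed simp

lemma l1_Tp_tendsto:
  assumes "locally_integrable M f"
  shows "(\<lambda>N. l1 (ball x r) (\<lambda>z. Tp (n + int N) f z - f z)) \<longlonglongrightarrow> 0"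
proof -
  define g where "g = (\<lambda>m. l1 (ball x r) (\<lambda>z. Tp m f z - f z))"
  have g: "(\<lambda>j. g (int j)) \<longlonglongrightarrow> 0" unfolding g_def by (rule approx_locally_integrable[OF assms])
  have "(\<lambda>N. g (n + int N)) \<longlonglongrightarrow> 0"
  proof (cases "n \<ge> 0")
    case True
    then have "int (N + nat n) = n + int N" for N by simp
    then show ?thesis using LIMSEQ_ignore_initial_segment[OF g, of "nat n"] by (simp only:)
  next
    case False
    then have eq: "n + int (N + nat (- n)) = int N" for N by simp
    show ?thesis
      by (rule LIMSEQ_offset[where k = "nat (- n)"]) (unfold eq, rule g)
  qed
  then show ?thesis by (simp add: g_def)
qed

text \<open>The contribution of the telescope's remainder to the bound of
  \<open>dnorm_Pavg_le\<close>. It vanishes as N grows for each fixed vertex, with no uniformity in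
  x.\<close>

definition err :: "('a \<Rightarrow> complex) \<Rightarrow> int \<Rightarrow> int \<Rightarrow> 'a \<Rightarrow> nat \<Rightarrow> real" where
  "err f n k x N = K2 * (l1 (ball x (5 * rad k)) (\<lambda>z. Tp (n + int N) f z - f z) / mu (k, x))"

lemma err_tendsto:
  assumes "locally_integrable M f"
  shows "err f n k x \<longlonglongrightarrow> 0"
proof -
  have "(\<lambda>N. K2 * (l1 (ball x (5 * rad k)) (\<lambda>z. Tp (n + int N) f z - f z) / mu (k, x))) \<longlonglongrightarrow> K2 * (0 / mu (k, x))"
    using l1_Tp_tendsto[OF assms] by (intro tendsto_mult tendsto_divide tendsto_const) auto
  then show ?thesis by (simp add: err_def[abs_def])
qed

lemma DP_coarse:
  assumes "locally_integrable M f" "k \<le> n + 2"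
  shows "DP (\<lambda>z. Tp n f z - f z) (k, x) - err f n k x N \<le> 2 * K2 * (\<Sum>i<N. avg f k (n + int i) x)"
proof -
  let ?B = "ball x (5 * rad k)"
  have "DP (\<lambda>z. Tp n f z - f z) (k, x) \<le> K2 * l1 ?B (\<lambda>z. Tp n f z - f z) / mu (k, x)"
    by (intro dnorm_Pavg_le locint_approx assms)
  also have "\<dots> \<le> K2 * (2 * mu (k, x) * (\<Sum>i<N. avg f k (n + int i) x)
      + l1 ?B (\<lambda>z. Tp (n + int N) f z - f z)) / mu (k, x)"
    using K2_nonneg by (intro divide_right_mono mult_left_mono l1_telescope assms) auto
  also have "\<dots> = 2 * K2 * (\<Sum>i<N. avg f k (n + int i) x) + err f n k x N"
    by (simp add: err_def field_simps)
  finally show ?thesis by simp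
qed

text \<open>The packing constant times a doubling constant; 13 is the 9 of \<open>avg\<close> plus
  the 4 of \<open>rad_coarse\<close>.\<close>

definition KW :: real where
  "KW = C * 4 powr Q * (C * 13 powr Q)"

lemma KW_pos: "0 < KW"
  using C_ge_1 by (simp add: KW_def)

lemma sum_weights_le:
  assumes "k \<le> m + 2"
  shows "(\<Sum>b\<in>near m x (9 * rad k). mu (m, b) / mu (k, x)) \<le> KW"
proof -
  have "(\<Sum>b\<in>near m x (9 * rad k). mu (m, b)) \<le> C * 4 powr Q * measure M (ball x (13 * rad k))"
  proof (intro sum_mu_le near_subset subsetI)
    fix b z assume "b \<in> near m x (9 * rad k)" "z \<in> ball b (rad m)"
    then show "z \<in> ball x (13 * rad k)"
      using rad_coarse[OF assms] dist_triangle[of x z b] by (auto simp: near_def)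
  qed auto
  also have "\<dots> \<le> C * 4 powr Q * (C * 13 powr Q * mu (k, x))"
    using C_ge_1 by (intro mult_left_mono measure_ball_le_mu) auto
  finally have "(\<Sum>b\<in>near m x (9 * rad k). mu (m, b)) / mu (k, x) \<le> KW"
    using mu_pos[of "(k, x)"] by (simp add: KW_def field_simps)
  then show ?thesis by (simp add: sum_divide_distrib)
qed

text \<open>The exponent lost, per power r, in averaging from level m to the coarser level k: zero
  for r \<ge> 1. The hypothesis on p amounts to \<open>sigma p < s * p\<close>, see
  \<open>sigma_less\<close>.\<close>

definition sigma :: "real \<Rightarrow> real" where
  "sigma r = Q * max 0 (1 - r)"

definition KA :: "real \<Rightarrow> real" where
  "KA r = max (KW powr (r - 1)) (C * 10 powr Q)"

lemma KA_pos: "0 < KA r"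
  using KW_pos by (auto simp: KA_def less_max_iff_disj)

text \<open>For r \<ge> 1 the weights have total at most \<open>KW\<close>, and Jensen's inequality
  loses no power of the scales. For r < 1 subadditivity leaves
  \<open>(mu (k, x) / mu (m, b)) powr (1 - r)\<close>, which doubling bounds by a multiple of
  \<open>(rad k / rad m) powr sigma r\<close>.\<close>

lemma avg_powr_le:
  assumes "k \<le> m + 2" "0 < r"
  shows "avg f k m x powr r * mu (k, x) \<le>
    KA r * (rad k / rad m) powr sigma r * (\<Sum>b\<in>near m x (9 * rad k). DP f (m, b) powr r * mu (m, b))"
proof (cases "1 \<le> r")
  case True
  let ?B = "near m x (9 * rad k)"
  have "avg f k m x powr r \<le> KW powr (r - 1) * (\<Sum>b\<in>?B. mu (m, b) / mu (k, x) * DP f (m, b) powr r)"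
    unfolding avg_def using True KW_pos by (intro sum_powr_le_ge1 sum_weights_le assms) auto
  then have "avg f k m x powr r * mu (k, x)
      \<le> KW powr (r - 1) * (\<Sum>b\<in>?B. mu (m, b) / mu (k, x) * DP f (m, b) powr r) * mu (k, x)"
    by (intro mult_right_mono) auto
  also have "\<dots> = KW powr (r - 1) * (\<Sum>b\<in>?B. DP f (m, b) powr r * mu (m, b))"
    unfolding mult.assoc sum_distrib_right by (simp add: mult_ac)
  also have "\<dots> \<le> KA r * (\<Sum>b\<in>?B. DP f (m, b) powr r * mu (m, b))"
    by (intro mult_right_mono sum_nonneg) (auto simp: KA_def)
  also have "\<dots> = KA r * (rad k / rad m) powr sigma r * (\<Sum>b\<in>?B. DP f (m, b) powr r * mu (m, b))"
    using True by (simp add: sigma_def)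
  finally show ?thesis .
next
  case False
  let ?B = "near m x (9 * rad k)"
  have r1: "r < 1" using False by simp
  have "avg f k m x powr r \<le> (\<Sum>b\<in>?B. (mu (m, b) / mu (k, x) * DP f (m, b)) powr r)"
    unfolding avg_def using r1 assms by (intro sum_powr_le_le1) auto
  then have "avg f k m x powr r * mu (k, x)
      \<le> (\<Sum>b\<in>?B. (mu (m, b) / mu (k, x) * DP f (m, b)) powr r * mu (k, x))"
    unfolding sum_distrib_right[symmetric] by (intro mult_right_mono) auto
  also have "\<dots> \<le> (\<Sum>b\<in>?B. C * 10 powr Q * (rad k / rad m) powr sigma r * (DP f (m, b) powr r * mu (m, b)))"
  proof (intro sum_mono)
    fix b assume b: "b \<in> ?B"
    \<comment> \<open>The ball of (k, x) lies within \<open>9 * rad k + rad k\<close> of b, that is,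
      within \<open>?t * rad m\<close>; doubling applies since \<open>?t\<close> is at least
      1.\<close>
    let ?t = "10 * rad k / rad m"
    have "rad m \<le> 10 * rad k" using rad_coarse[OF assms(1)] rad_pos[of k] by linarith
    then have t: "1 \<le> ?t" by simp
    have "mu (k, x) \<le> C * ?t powr Q * mu (m, b)"
      unfolding mu_def[of "(k, x)"] hball_rad
      using b t by (intro measure_ball_le_mu) (auto simp: near_def dist_commute)
    then have "mu (k, x) / mu (m, b) \<le> C * ?t powr Q"
      using mu_pos[of "(m, b)"] by (simp add: field_simps)
    then have "(mu (k, x) / mu (m, b)) powr (1 - r) \<le> (C * ?t powr Q) powr (1 - r)"
      using r1 by (intro powr_mono2) auto
    also have "\<dots> = (C * 10 powr Q) powr (1 - r) * (rad k / rad m) powr sigma r"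
      using r1 C_ge_1 by (simp add: sigma_def powr_mult powr_divide powr_powr)
    also have "\<dots> \<le> (C * 10 powr Q) * (rad k / rad m) powr sigma r"
    proof (intro mult_right_mono)
      have "1 \<le> C * 10 powr Q"
        using mult_mono[of 1 C 1 "10 powr Q"] C_ge_1 Q_pos by (simp add: ge_one_powr_ge_zero)
      then show "(C * 10 powr Q) powr (1 - r) \<le> C * 10 powr Q"
        using powr_mono[of "1 - r" 1 "C * 10 powr Q"] assms by simp
    qed simp
    finally have le: "(mu (k, x) / mu (m, b)) powr (1 - r) \<le> (C * 10 powr Q) * (rad k / rad m) powr sigma r" .
    have "(mu (m, b) / mu (k, x) * DP f (m, b)) powr r * mu (k, x)
        = DP f (m, b) powr r * mu (m, b) * (mu (k, x) / mu (m, b)) powr (1 - r)"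
      using mu_pos[of "(k, x)"] mu_pos[of "(m, b)"]
      by (simp add: powr_mult powr_divide powr_diff)
    also have "\<dots> \<le> DP f (m, b) powr r * mu (m, b) * ((C * 10 powr Q) * (rad k / rad m) powr sigma r)"
      by (intro mult_left_mono le) auto
    finally show "(mu (m, b) / mu (k, x) * DP f (m, b)) powr r * mu (k, x)
        \<le> C * 10 powr Q * (rad k / rad m) powr sigma r * (DP f (m, b) powr r * mu (m, b))"
      by (simp add: mult_ac)
  qed
  also have "\<dots> = C * 10 powr Q * ((rad k / rad m) powr sigma r * (\<Sum>b\<in>?B. DP f (m, b) powr r * mu (m, b)))"
    by (simp add: sum_distrib_left mult_ac)
  also have "\<dots> \<le> KA r * ((rad k / rad m) powr sigma r * (\<Sum>b\<in>?B. DP f (m, b) powr r * mu (m, b)))"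
    by (intro mult_right_mono mult_nonneg_nonneg sum_nonneg) (auto simp: KA_def)
  finally show ?thesis by (simp only: mult.assoc)
qed

text \<open>After exchanging the sums, each fine vertex b is counted once for every coarse vertex
  near it. These lie within \<open>9 * rad k\<close> on level k itself, so there are at most
  \<open>cnt 9\<close> of them, however large m is.\<close>

lemma sum_avg_powr_le:
  assumes "k \<le> m + 2" "0 < r" "finite F" "F \<subseteq> Xs k"
    and T: "\<And>G. finite G \<Longrightarrow> G \<subseteq> Xs m \<Longrightarrow> (\<Sum>b\<in>G. DP f (m, b) powr r * mu (m, b)) \<le> T"
  shows "(\<Sum>x\<in>F. avg f k m x powr r * mu (k, x)) \<le> KA r * cnt 9 * (rad k / rad m) powr sigma r * T"
proof -
  let ?w = "\<lambda>b. DP f (m, b) powr r * mu (m, b)"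
  define G where "G = (\<Union>x\<in>F. near m x (9 * rad k))"
  have G: "finite G" "G \<subseteq> Xs m" using assms(3) near_subset by (auto simp: G_def)
  have "(\<Sum>x\<in>F. \<Sum>b\<in>near m x (9 * rad k). ?w b) = (\<Sum>x\<in>F. \<Sum>b | b \<in> G \<and> dist x b < 9 * rad k. ?w b)"
    by (intro sum.cong refl) (auto simp: G_def near_def)
  also have "\<dots> = (\<Sum>b\<in>G. \<Sum>x | x \<in> F \<and> dist x b < 9 * rad k. ?w b)"
    using G assms by (intro sum.swap_restrict) auto
  also have "\<dots> \<le> (\<Sum>b\<in>G. cnt 9 * ?w b)"
  proof (intro sum_mono)
    fix b
    have "(\<Sum>x | x \<in> F \<and> dist x b < 9 * rad k. ?w b) = real (card {x. x \<in> F \<and> dist x b < 9 * rad k}) * ?w b"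
      by simp
    also have "\<dots> \<le> cnt 9 * ?w b"
      using assms by (intro mult_right_mono card_near_finite[where z = b and k = k]) (auto simp: dist_commute)
    finally show "(\<Sum>x | x \<in> F \<and> dist x b < 9 * rad k. ?w b) \<le> cnt 9 * ?w b" .
  qed
  also have "\<dots> \<le> cnt 9 * T"
    using cnt_ge_1[of 9] T[OF G] by (auto simp: sum_distrib_left[symmetric] intro!: mult_left_mono)
  finally have *: "(\<Sum>x\<in>F. \<Sum>b\<in>near m x (9 * rad k). ?w b) \<le> cnt 9 * T" .
  have "(\<Sum>x\<in>F. avg f k m x powr r * mu (k, x))
      \<le> (\<Sum>x\<in>F. KA r * (rad k / rad m) powr sigma r * (\<Sum>b\<in>near m x (9 * rad k). ?w b))"
    using assms by (intro sum_mono avg_powr_le)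
  also have "\<dots> = KA r * (rad k / rad m) powr sigma r * (\<Sum>x\<in>F. \<Sum>b\<in>near m x (9 * rad k). ?w b)"
    by (simp add: sum_distrib_left)
  also have "\<dots> \<le> KA r * (rad k / rad m) powr sigma r * (cnt 9 * T)"
    using KA_pos[of r] by (intro mult_left_mono *) auto
  finally show ?thesis by (simp only: mult_ac)
qed

lemma rad_add_nat: "rad (n + int i) = rad n * 2 powr (- real i)"
  by (simp add: rad_def powr_add[symmetric])

lemma nb_coarse_fin:
  assumes "0 < s" "0 < p" "p \<noteq> \<infinity>" "sigma (enn2real p) < s * enn2real p"
  shows "\<exists>K\<ge>0. \<exists>eps>0. \<forall>f n k S. locally_integrable M f \<longrightarrow> 0 \<le> S \<longrightarrow> k \<le> n + 2 \<longrightarrow>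
     (\<forall>m\<ge>n. nb p m (\<lambda>x. DP f (m, x)) (rad m powr s * S)) \<longrightarrow>
     nb p k (\<lambda>x. DP (\<lambda>z. Tp n f z - f z) (k, x)) (rad k powr s * (K * ((rad n / rad k) powr eps * S)))"
proof -
  define r where "r = enn2real p"
  define eps where "eps = (s * r - sigma r) / r"
  \<comment> \<open>The terms of level n + i decay like \<open>2 powr (- eps * i)\<close> before
    powers are taken. Half of this pays for \<open>sum_powr_le_geometric\<close>, the other half
    makes the sum over i converge.\<close>
  define d where "d = eps / 2"
  define c where "c = (1 / (1 - 2 powr (- d))) powr r"
  define c2 where "c2 = 1 / (1 - 2 powr (- (r * d)))"
  define K0 where "K0 = (2 * K2) powr r * (c * (KA r * cnt 9 * c2))"
  have r: "0 < r" unfolding r_def using assms by (intro enn2real_pos)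
  have eps: "0 < eps" using assms r by (simp add: eps_def r_def)
  have d: "0 < d" using eps by (simp add: d_def)
  have rd: "0 < r * d" using r d by simp
  have pow1: "2 powr - d < 1" "2 powr (- (r * d)) < 1" using d rd by (auto simp: powr_less_one)
  have c0: "0 \<le> c" by (simp add: c_def)
  have c20: "0 \<le> c2" using pow1 by (simp add: c2_def)
  have K00: "0 \<le> K0" using K2_nonneg c0 c20 KA_pos[of r] cnt_ge_1[of 9] by (simp add: K0_def)
  have main: "nb p k (\<lambda>x. DP (\<lambda>z. Tp n f z - f z) (k, x)) (rad k powr s * (K0 powr (1 / r) * ((rad n / rad k) powr eps * S)))"
    if f: "locally_integrable M f" and S: "0 \<le> S" and kn: "k \<le> n + 2"
      and hyp: "\<forall>m\<ge>n. nb p m (\<lambda>x. DP f (m, x)) (rad m powr s * S)" for f n k S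
  proof -
    let ?D = "\<lambda>x. DP (\<lambda>z. Tp n f z - f z) (k, x)"
    let ?R = "(rad k powr s * (K0 powr (1 / r) * ((rad n / rad k) powr eps * S))) powr r"
    have Req: "?R = K0 * ((rad k / rad n) powr sigma r * (rad n powr (s * r) * S powr r))"
    proof -
      have "?R = K0 * (rad k powr (s * r) * ((rad n / rad k) powr (eps * r) * S powr r))"
        using K00 r by (simp add: powr_mult powr_powr mult_ac)
      also have "eps * r = s * r - sigma r" using r by (simp add: eps_def)
      also have "rad k powr (s * r) * ((rad n / rad k) powr (s * r - sigma r) * S powr r)
          = (rad k / rad n) powr sigma r * (rad n powr (s * r) * S powr r)"
        by (simp add: powr_divide powr_diff field_simps)
      finally show ?thesis .
    qed
    have "(\<Sum>x\<in>F. ?D x powr r * mu (k, x)) \<le> ?R" if F: "finite F" "F \<subseteq> Xs k" for F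
    proof -
      \<comment> \<open>The difference may be negative and real powers are controlled only for
        nonnegative bases, so it is cut at 0. In the limit the cut disappears because
        \<open>?D\<close> is nonnegative.\<close>
      let ?E = "\<lambda>N x. max 0 (?D x - err f n k x N)"
      have bd: "(\<Sum>x\<in>F. ?E N x powr r * mu (k, x)) \<le> ?R" for N
      proof -
        let ?A = "\<lambda>i x. avg f k (n + int i) x"
        have A: "(\<Sum>x\<in>F. ?A i x powr r * mu (k, x)) \<le>
            KA r * cnt 9 * (rad k / rad (n + int i)) powr sigma r * ((rad (n + int i) powr s * S) powr r)" for i
          using kn r F hyp[rule_format, of "n + int i"] assms(3)
          by (intro sum_avg_powr_le) (auto simp: nb_def r_def)
        have expo: "2 powr (r * d * real i) * ((rad k / rad (n + int i)) powr sigma r * ((rad (n + int i) powr s * S) powr r))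
            = 2 powr (- (r * d) * real i) * ((rad k / rad n) powr sigma r * (rad n powr (s * r) * S powr r))" for i
        proof -
          have a: "(rad k / rad (n + int i)) powr sigma r = (rad k / rad n) powr sigma r * 2 powr (real i * sigma r)"
            by (simp add: rad_add_nat powr_divide powr_mult powr_powr powr_minus field_simps)
          have b: "(rad (n + int i) powr s * S) powr r = rad n powr (s * r) * 2 powr (- real i * (s * r)) * S powr r"
            by (simp add: rad_add_nat powr_mult powr_powr mult_ac)
          have e: "r * d * real i + (real i * sigma r + - real i * (s * r)) = - (r * d) * real i"
            using r by (simp add: d_def eps_def field_simps)
          show ?thesis unfolding a b e[symmetric] powr_add by (simp add: mult_ac)
        qed
        have "(\<Sum>x\<in>F. ?E N x powr r * mu (k, x)) \<le> (\<Sum>x\<in>F. (2 * K2 * (\<Sum>i<N. ?A i x)) powr r * mu (k, x))"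
          using r K2_nonneg DP_coarse[OF f kn]
          by (intro sum_mono mult_right_mono powr_mono2) (auto intro!: mult_nonneg_nonneg sum_nonneg)
        also have "\<dots> \<le> (\<Sum>x\<in>F. (2 * K2) powr r * (c * (\<Sum>i<N. 2 powr (r * d * real i) * ?A i x powr r)) * mu (k, x))"
        proof (intro sum_mono mult_right_mono)
          fix x
          have "(2 * K2 * (\<Sum>i<N. ?A i x)) powr r = (2 * K2) powr r * (\<Sum>i<N. ?A i x) powr r"
            by (rule powr_mult)
          also have "\<dots> \<le> (2 * K2) powr r * (c * (\<Sum>i<N. 2 powr (r * d * real i) * ?A i x powr r))"
            unfolding c_def using r d by (intro mult_left_mono sum_powr_le_geometric) auto
          finally show "(2 * K2 * (\<Sum>i<N. ?A i x)) powr r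
              \<le> (2 * K2) powr r * (c * (\<Sum>i<N. 2 powr (r * d * real i) * ?A i x powr r))" .
        qed simp
        also have "\<dots> = (2 * K2) powr r * (c * (\<Sum>i<N. 2 powr (r * d * real i) * (\<Sum>x\<in>F. ?A i x powr r * mu (k, x))))"
          unfolding sum_distrib_left sum_distrib_right by (subst sum.swap) (simp add: mult_ac)
        also have "\<dots> \<le> (2 * K2) powr r * (c * (\<Sum>i<N. 2 powr (r * d * real i) *
            (KA r * cnt 9 * (rad k / rad (n + int i)) powr sigma r * ((rad (n + int i) powr s * S) powr r))))"
          using c0 by (intro mult_left_mono sum_mono A) auto
        also have "\<dots> = (2 * K2) powr r * (c * (\<Sum>i<N. (KA r * cnt 9) * (2 powr (- (r * d) * real i) *
            ((rad k / rad n) powr sigma r * (rad n powr (s * r) * S powr r)))))"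
          unfolding expo[symmetric] by (simp add: mult_ac)
        also have "\<dots> = (2 * K2) powr r * (c * (KA r * cnt 9 * ((\<Sum>i<N. 2 powr (- (r * d) * real i)) *
            ((rad k / rad n) powr sigma r * (rad n powr (s * r) * S powr r)))))"
          by (simp add: sum_distrib_left sum_distrib_right)
        also have "\<dots> \<le> (2 * K2) powr r * (c * (KA r * cnt 9 * (c2 *
            ((rad k / rad n) powr sigma r * (rad n powr (s * r) * S powr r)))))"
          unfolding c2_def using c0 KA_pos[of r] cnt_ge_1[of 9] rd
          by (intro mult_left_mono mult_right_mono geometric_powr_sum_le) auto
        also have "\<dots> = K0 * ((rad k / rad n) powr sigma r * (rad n powr (s * r) * S powr r))"
          unfolding K0_def by (simp only: mult.assoc)
        also have "\<dots> = ?R" by (rule Req[symmetric])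
        finally show ?thesis .
      qed
      have "(\<lambda>N. \<Sum>x\<in>F. ?E N x powr r * mu (k, x)) \<longlonglongrightarrow> (\<Sum>x\<in>F. max 0 (?D x - 0) powr r * mu (k, x))"
      proof (intro tendsto_sum tendsto_mult tendsto_const)
        fix x
        have "(\<lambda>N. ?E N x) \<longlonglongrightarrow> max 0 (?D x - 0)"
          by (intro tendsto_max tendsto_const tendsto_diff err_tendsto f)
        then show "(\<lambda>N. ?E N x powr r) \<longlonglongrightarrow> max 0 (?D x - 0) powr r"
          using r by (rule_tac tendsto_powr'[OF _ tendsto_const]) simp_all
      qed
      then have "(\<Sum>x\<in>F. max 0 (?D x - 0) powr r * mu (k, x)) \<le> ?R"
        using bd by (intro tendsto_upperbound[OF _ always_eventually]) auto
      then show ?thesis by simp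
    qed
    then show ?thesis using assms(3) by (simp add: nb_def r_def)
  qed
  show ?thesis
  proof (rule exI[of _ "K0 powr (1 / r)"], rule conjI, simp, rule exI[of _ eps], rule conjI[OF eps], intro allI impI)
    fix f n k S
    assume "locally_integrable M f" "0 \<le> S" "k \<le> n + 2" "\<forall>m\<ge>n. nb p m (\<lambda>x. DP f (m, x)) (rad m powr s * S)"
    then show "nb p k (\<lambda>x. DP (\<lambda>z. Tp n f z - f z) (k, x)) (rad k powr s * (K0 powr (1 / r) * ((rad n / rad k) powr eps * S)))"
      by (rule main)
  qed
qed

text \<open>With a supremum in place of a sum, averaging costs only the total weight
  \<open>KW\<close>, so the decay exponent is s itself.\<close>

lemma nb_coarse_inf:
  assumes "0 < s"
  shows "\<exists>K\<ge>0. \<exists>eps>0. \<forall>f n k S. locally_integrable M f \<longrightarrow> 0 \<le> S \<longrightarrow> k \<le> n + 2 \<longrightarrow>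
     (\<forall>m\<ge>n. nb \<infinity> m (\<lambda>x. DP f (m, x)) (rad m powr s * S)) \<longrightarrow>
     nb \<infinity> k (\<lambda>x. DP (\<lambda>z. Tp n f z - f z) (k, x)) (rad k powr s * (K * ((rad n / rad k) powr eps * S)))"
proof -
  define c where "c = 1 / (1 - 2 powr (- s))"
  define K where "K = 2 * K2 * (KW * c)"
  have c0: "0 \<le> c" using assms by (simp add: c_def powr_less_one less_imp_le)
  have K0: "0 \<le> K" using K2_nonneg KW_pos c0 by (simp add: K_def)
  have main: "DP (\<lambda>z. Tp n f z - f z) (k, x) \<le> rad k powr s * (K * ((rad n / rad k) powr s * S))"
    if f: "locally_integrable M f" and S: "0 \<le> S" and kn: "k \<le> n + 2"
      and hyp: "\<forall>m\<ge>n. \<forall>x\<in>Xs m. DP f (m, x) \<le> rad m powr s * S" for f n k S x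
  proof -
    let ?D = "DP (\<lambda>z. Tp n f z - f z) (k, x)"
    have eq: "rad k powr s * (K * ((rad n / rad k) powr s * S)) = K * (rad n powr s * S)"
      by (simp add: powr_divide)
    have A: "avg f k (n + int i) x \<le> KW * (rad n powr s * S) * 2 powr (- s * real i)" for i
    proof -
      have "avg f k (n + int i) x \<le> (\<Sum>b\<in>near (n + int i) x (9 * rad k).
          mu (n + int i, b) / mu (k, x) * (rad (n + int i) powr s * S))"
        unfolding avg_def using hyp near_subset[of "n + int i" x "9 * rad k"]
        by (intro sum_mono mult_left_mono) auto
      also have "\<dots> = (\<Sum>b\<in>near (n + int i) x (9 * rad k). mu (n + int i, b) / mu (k, x)) * (rad (n + int i) powr s * S)"
        by (simp add: sum_distrib_right)
      also have "\<dots> \<le> KW * (rad (n + int i) powr s * S)"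
        using kn S by (intro mult_right_mono sum_weights_le) auto
      also have "\<dots> = KW * (rad n powr s * S) * 2 powr (- s * real i)"
        by (simp add: rad_add_nat powr_mult powr_powr mult_ac)
      finally show ?thesis .
    qed
    have bd: "?D - err f n k x N \<le> K * (rad n powr s * S)" for N
    proof -
      have "?D - err f n k x N \<le> 2 * K2 * (\<Sum>i<N. avg f k (n + int i) x)"
        by (rule DP_coarse[OF f kn])
      also have "\<dots> \<le> 2 * K2 * (\<Sum>i<N. KW * (rad n powr s * S) * 2 powr (- s * real i))"
        using K2_nonneg by (intro mult_left_mono sum_mono A) auto
      also have "\<dots> = 2 * K2 * (KW * (rad n powr s * S) * (\<Sum>i<N. 2 powr (- s * real i)))"
        by (simp add: sum_distrib_left)
      also have "\<dots> \<le> 2 * K2 * (KW * (rad n powr s * S) * c)"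
        unfolding c_def using K2_nonneg KW_pos S assms
        by (intro mult_left_mono geometric_powr_sum_le) auto
      finally show ?thesis by (simp add: K_def mult_ac)
    qed
    have "(\<lambda>N. ?D - err f n k x N) \<longlonglongrightarrow> ?D - 0"
      by (intro tendsto_diff tendsto_const err_tendsto f)
    then have "?D - 0 \<le> K * (rad n powr s * S)"
      using bd by (intro tendsto_upperbound[OF _ always_eventually]) auto
    then show ?thesis unfolding eq by simp
  qed
  show ?thesis
    by (rule exI[of _ K], intro conjI K0, rule exI[of _ s]) (use assms main in \<open>auto simp: nb_def\<close>)
qed

subsection \<open>The level-wise estimate\<close>

lemma DP_diff_le:
  assumes "locally_integrable M f" "locally_integrable M g"
  shows "DP (\<lambda>z. g z - f z) x \<le> DP g x + DP f x"
proof -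
  have "Pavg M (\<lambda>z. g z - f z) = (\<lambda>x. Pavg M g x - Pavg M f x)"
    using Pavg_diff[OF assms(2,1)] by (rule ext)
  then show ?thesis by (simp only: dnorm_diff)
qed

lemma DP_le_diff:
  assumes "locally_integrable M f" "locally_integrable M g"
  shows "DP g x \<le> DP (\<lambda>z. g z - f z) x + DP f x"
proof -
  have "Pavg M (\<lambda>z. g z - f z) = (\<lambda>x. Pavg M g x - Pavg M f x)"
    using Pavg_diff[OF assms(2,1)] by (rule ext)
  then show ?thesis
    using dnorm_triangle[of "\<lambda>x. Pavg M g x - Pavg M f x" "Pavg M f" x] by (simp only: diff_add_cancel)
qed

lemma rad_ratio: "(rad n / rad k) powr e = 2 powr (e * real_of_int (k - n))"
  by (simp add: rad_def powr_diff[symmetric] powr_powr algebra_simps)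

text \<open>The lower bound on p rearranges to Q (1 - p) < s p; this makes the exponent
  \<open>eps\<close> in \<open>nb_coarse_fin\<close> positive.\<close>

lemma sigma_less:
  assumes "0 < s" "ennreal (Q / (Q + s)) < p" "p \<noteq> \<infinity>"
  shows "sigma (enn2real p) < s * enn2real p"
proof -
  let ?r = "enn2real p"
  have "p = ennreal ?r" using assms(3) by (simp add: less_top)
  then have "ennreal (Q / (Q + s)) < ennreal ?r" using assms(2) by metis
  then have r: "Q / (Q + s) < ?r" using Q_pos assms(1) by (simp add: ennreal_less_iff)
  have "0 < Q / (Q + s)" using Q_pos assms(1) by simp
  then have r0: "0 < ?r" using r by linarith
  have "Q < ?r * (Q + s)" using r Q_pos assms(1) by (simp add: field_simps)
  then have "Q * (1 - ?r) < s * ?r" by (simp add: algebra_simps)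
  moreover have "0 < s * ?r" using r0 assms by simp
  ultimately show ?thesis by (auto simp: sigma_def max_def)
qed

lemma nb_coarse:
  assumes "0 < s" "ennreal (Q / (Q + s)) < p"
  shows "\<exists>K\<ge>0. \<exists>eps>0. \<forall>f n k S. locally_integrable M f \<longrightarrow> 0 \<le> S \<longrightarrow> k \<le> n + 2 \<longrightarrow>
     (\<forall>m\<ge>n. nb p m (\<lambda>x. DP f (m, x)) (rad m powr s * S)) \<longrightarrow>
     nb p k (\<lambda>x. DP (\<lambda>z. Tp n f z - f z) (k, x)) (rad k powr s * (K * ((rad n / rad k) powr eps * S)))"
proof (cases "p = \<infinity>")
  case True
  show ?thesis unfolding True by (rule nb_coarse_inf[OF assms(1)])
next
  case False
  have "0 < p" using assms(2) by (rule le_less_trans[rotated]) simp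
  then show ?thesis using nb_coarse_fin[OF assms(1) _ False sigma_less[OF assms False]] by simp
qed

text \<open>In the coarse range the telescope bounds h = T_n(Pf) - f, and T_n(Pf) is recovered as h
  + f. In the fine range the Lipschitz gain bounds T_n(Pf), and h is recovered by subtracting f.
  Below level n the bound for h contains no a, only a decaying multiple of S; this is what yields
  convergence. S must cover level n - 1, the level of the parents in the fine range.\<close>

lemma nb_key:
  assumes s: "0 < s" "s < 1" and p: "ennreal (Q / (Q + s)) < p"
  shows "\<exists>K\<ge>0. \<exists>eps>0. \<forall>f n k S a. locally_integrable M f \<longrightarrow> 0 \<le> S \<longrightarrow> 0 \<le> a \<longrightarrow>
     (\<forall>m\<ge>n - 1. nb p m (\<lambda>x. DP f (m, x)) (rad m powr s * S)) \<longrightarrow>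
     nb p k (\<lambda>x. DP f (k, x)) (rad k powr s * a) \<longrightarrow>
     nb p k (\<lambda>x. DP (\<lambda>z. Tp n f z - f z) (k, x))
       (rad k powr s * (K * ((if n \<le> k then a else 0) + 2 powr (- eps * \<bar>real_of_int (k - n)\<bar>) * S))) \<and>
     nb p k (\<lambda>x. DP (Tp n f) (k, x))
       (rad k powr s * (K * (a + 2 powr (- eps * \<bar>real_of_int (k - n)\<bar>) * S)))"
proof -
  have p0: "0 < p" using p by (rule le_less_trans[rotated]) simp
  obtain K1 e1 where K1: "0 \<le> K1" and e1: "0 < e1" and
    coarse: "\<And>f n k S. locally_integrable M f \<Longrightarrow> 0 \<le> S \<Longrightarrow> k \<le> n + 2 \<Longrightarrow>
     (\<forall>m\<ge>n. nb p m (\<lambda>x. DP f (m, x)) (rad m powr s * S)) \<Longrightarrow>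
     nb p k (\<lambda>x. DP (\<lambda>z. Tp n f z - f z) (k, x)) (rad k powr s * (K1 * ((rad n / rad k) powr e1 * S)))"
    using nb_coarse[OF s(1) p] by blast
  \<comment> \<open>\<open>e1\<close> is the decay towards coarse levels; 1 - s is what remains of
    the Lipschitz gain after the smoothness weight is paid on fine levels.\<close>
  define eps where "eps = min e1 (1 - s)"
  \<comment> \<open>On levels n + 1 and n + 2 the coarse bound has grown by up to
    \<open>2 powr (2 * e1)\<close> while the target has decayed by up to the same factor;
    \<open>2 powr (4 * e1)\<close> covers both.\<close>
  define Ka where "Ka = K1 * 2 powr (4 * e1)"
  define Kb where "Kb = K3 * Kpar p * 2 powr s"
  define K where "K = Kadd p * (Ka + Kb + 1)"
  have eps: "0 < eps" "eps \<le> e1" "eps \<le> 1 - s" using e1 s by (auto simp: eps_def)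
  have Ka0: "0 \<le> Ka" using K1 by (simp add: Ka_def)
  have Kb0: "0 \<le> Kb" using K3_nonneg by (simp add: Kb_def Kpar_def)
  have Kadd0: "0 \<le> Kadd p" "1 \<le> Kadd p" using Kadd_ge_2[of p] by auto
  have K0: "0 \<le> K" using Ka0 Kb0 Kadd0 by (simp add: K_def)
  have main: "nb p k (\<lambda>x. DP (\<lambda>z. Tp n f z - f z) (k, x))
       (rad k powr s * (K * ((if n \<le> k then a else 0) + 2 powr (- eps * \<bar>real_of_int (k - n)\<bar>) * S))) \<and>
     nb p k (\<lambda>x. DP (Tp n f) (k, x))
       (rad k powr s * (K * (a + 2 powr (- eps * \<bar>real_of_int (k - n)\<bar>) * S)))"
    if f: "locally_integrable M f" and S: "0 \<le> S" and a: "0 \<le> a"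
      and hyp: "\<forall>m\<ge>n - 1. nb p m (\<lambda>x. DP f (m, x)) (rad m powr s * S)"
      and hypk: "nb p k (\<lambda>x. DP f (k, x)) (rad k powr s * a)" for f n k S a
  proof -
    define j where "j = real_of_int (k - n)"
    define W where "W = 2 powr (- eps * \<bar>j\<bar>) * S"
    define R where "R = rad k powr s"
    have W0: "0 \<le> W" using S by (simp add: W_def)
    have R0: "0 \<le> R" by (simp add: R_def)
    have g: "locally_integrable M (Tp n f)" by (rule locint_Tn)
    let ?h = "\<lambda>z. Tp n f z - f z"
    have mono: "nb p k u b" if "nb p k u b'" "\<And>x. 0 \<le> u x" "0 \<le> b'" "b' \<le> b" for u b b'
      using nb_mono[OF that(1), of u b] that by simp
    have comb: "nb p k u (R * (K * (x + W)))"
      if u: "nb p k u (Kadd p * (R * (c * W) + R * x))" "\<And>x. 0 \<le> u x" and c: "0 \<le> c" "c \<le> Ka + Kb + 1" and x: "0 \<le> x" for u c x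
    proof (rule mono[OF u])
      show "0 \<le> Kadd p * (R * (c * W) + R * x)"
        using R0 W0 c x Kadd0 by (intro mult_nonneg_nonneg add_nonneg_nonneg) auto
      have "c * W + 1 * x \<le> (Ka + Kb + 1) * W + (Ka + Kb + 1) * x"
        using c x W0 Ka0 Kb0 by (intro add_mono mult_right_mono) auto
      then have "Kadd p * (R * (c * W + x)) \<le> Kadd p * (R * ((Ka + Kb + 1) * (x + W)))"
        using Kadd0 R0 by (intro mult_left_mono) (auto simp: algebra_simps)
      then show "Kadd p * (R * (c * W) + R * x) \<le> R * (K * (x + W))"
        by (simp add: K_def algebra_simps)
    qed
    have hypk': "nb p k (\<lambda>x. DP f (k, x)) (R * a)" using hypk by (simp add: R_def)
    show ?thesis
      unfolding j_def[symmetric] W_def[symmetric] R_def[symmetric]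
    proof (cases "k \<le> n + 2")
      case True
      have expo: "e1 * j \<le> 4 * e1 + - eps * \<bar>j\<bar>"
      proof (cases "j \<le> 0")
        case True
        then have "eps * \<bar>j\<bar> \<le> e1 * \<bar>j\<bar>" using eps by (intro mult_right_mono) auto
        then show ?thesis using True e1 by simp
      next
        case False
        have j2: "0 < j" "j \<le> 2" using \<open>k \<le> n + 2\<close> False by (auto simp: j_def)
        have "e1 * j \<le> e1 * 2" "eps * j \<le> e1 * 2" using j2 e1 eps by (auto intro!: mult_mono)
        then show ?thesis using j2 by simp
      qed
      have h1: "nb p k (\<lambda>x. DP ?h (k, x)) (R * (K1 * ((rad n / rad k) powr e1 * S)))"
        unfolding R_def using hyp True by (intro coarse f S) auto
      have "(rad n / rad k) powr e1 * S \<le> 2 powr (4 * e1) * W"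
        unfolding rad_ratio j_def[symmetric] W_def mult.assoc[symmetric] powr_add[symmetric]
        using expo S by (intro mult_right_mono powr_mono) auto
      then have "R * (K1 * ((rad n / rad k) powr e1 * S)) \<le> R * (K1 * (2 powr (4 * e1) * W))"
        using R0 K1 by (intro mult_left_mono) auto
      then have h: "nb p k (\<lambda>x. DP ?h (k, x)) (R * (Ka * W))"
        using R0 K1 S by (intro mono[OF h1]) (auto simp: Ka_def mult.assoc)
      let ?y = "if n \<le> k then a else 0"
      have y: "0 \<le> ?y" using a by simp
      have "R * (Ka * W) \<le> R * (K * (?y + W))"
      proof (intro mult_left_mono R0)
        have "Ka * W \<le> K * W"
        proof (intro mult_right_mono W0)
          have "1 * Ka \<le> Kadd p * (Ka + Kb + 1)" using Kadd0 Ka0 Kb0 by (intro mult_mono) auto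
          then show "Ka \<le> K" by (simp add: K_def)
        qed
        also have "\<dots> \<le> K * (?y + W)" using y K0 by (intro mult_left_mono) auto
        finally show "Ka * W \<le> K * (?y + W)" .
      qed
      then have 1: "nb p k (\<lambda>x. DP ?h (k, x)) (R * (K * (?y + W)))"
        using R0 Ka0 W0 by (intro mono[OF h]) auto
      have "nb p k (\<lambda>x. DP ?h (k, x) + DP f (k, x)) (Kadd p * (R * (Ka * W) + R * a))"
        using R0 Ka0 W0 a by (intro nb_add h hypk' p0) auto
      then have s: "nb p k (\<lambda>x. DP ?h (k, x) + DP f (k, x)) (R * (K * (a + W)))"
        using Ka0 Kb0 a by (rule_tac comb) auto
      have b0: "0 \<le> R * (K * (a + W))" using R0 K0 a W0 by simp
      have 2: "nb p k (\<lambda>x. DP (Tp n f) (k, x)) (R * (K * (a + W)))"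
        by (rule nb_mono[OF s]) (use b0 in \<open>auto intro: DP_le_diff f g\<close>)
      show "nb p k (\<lambda>x. DP ?h (k, x)) (R * (K * (?y + W))) \<and> nb p k (\<lambda>x. DP (Tp n f) (k, x)) (R * (K * (a + W)))"
        using 1 2 by blast
    next
      case False
      have kn: "n + 3 \<le> k" "n \<le> k" using False by auto
      have j0: "0 \<le> j" using kn by (simp add: j_def)
      have "nb p k (\<lambda>x. DP (Tp n f) (k, x)) (K3 * rad (k - n) * (Kpar p * (rad (n - 1) powr s * S)))"
        using hyp kn p0 S by (intro nb_DP_Tp_fine f) auto
      \<comment> \<open>The part \<open>rad (k - n) powr s\<close> of the gain converts the weight
        of level n into that of level k and leaves the exponent 1 - s; \<open>2 powr s\<close> in
        \<open>Kb\<close> comes from \<open>rad (n - 1)\<close> being twice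
        \<open>rad n\<close>.\<close>
      moreover have "K3 * rad (k - n) * (Kpar p * (rad (n - 1) powr s * S)) = R * (Kb * (rad (k - n) powr (1 - s) * S))"
      proof -
        have "rad (k - n) * rad (n - 1) powr s = R * (2 powr s * rad (k - n) powr (1 - s))"
          by (simp add: R_def rad_pred[of n] rad_minus[of k n] powr_mult powr_divide powr_diff)
        then have "K3 * Kpar p * S * (rad (k - n) * rad (n - 1) powr s) = K3 * Kpar p * S * (R * (2 powr s * rad (k - n) powr (1 - s)))"
          by (simp only:)
        then show ?thesis by (simp add: Kb_def mult_ac)
      qed
      moreover have "rad (k - n) powr (1 - s) * S \<le> W"
      proof -
        have "rad (k - n) powr (1 - s) = 2 powr (- (1 - s) * j)"
          by (simp add: rad_def powr_powr j_def algebra_simps)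
        also have "\<dots> \<le> 2 powr (- eps * \<bar>j\<bar>)"
          using j0 mult_right_mono[OF eps(3) j0] by (intro powr_mono) (auto simp: algebra_simps)
        finally show ?thesis unfolding W_def using S by (intro mult_right_mono) auto
      qed
      then have "R * (Kb * (rad (k - n) powr (1 - s) * S)) \<le> R * (Kb * W)"
        using R0 Kb0 by (intro mult_left_mono) auto
      ultimately have h: "nb p k (\<lambda>x. DP (Tp n f) (k, x)) (R * (Kb * W))"
        using R0 Kb0 S by (rule_tac mono) auto
      have "nb p k (\<lambda>x. DP (Tp n f) (k, x) + DP f (k, x)) (Kadd p * (R * (Kb * W) + R * a))"
        using R0 Kb0 W0 a by (intro nb_add h hypk' p0) auto
      then have s: "nb p k (\<lambda>x. DP (Tp n f) (k, x) + DP f (k, x)) (R * (K * (a + W)))"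
        using Ka0 Kb0 a by (rule_tac comb[where c = Kb]) auto
      have b0: "0 \<le> R * (K * (a + W))" using R0 K0 a W0 by simp
      have "nb p k (\<lambda>x. DP ?h (k, x)) (R * (K * (a + W)))"
        by (rule nb_mono[OF s]) (use b0 in \<open>auto intro: DP_diff_le f g\<close>)
      moreover have "nb p k (\<lambda>x. DP (Tp n f) (k, x)) (R * (K * (a + W)))"
        by (rule nb_mono[OF s]) (use b0 in auto)
      ultimately show "nb p k (\<lambda>x. DP ?h (k, x)) (R * (K * ((if n \<le> k then a else 0) + W)))
          \<and> nb p k (\<lambda>x. DP (Tp n f) (k, x)) (R * (K * (a + W)))"
        using kn by simp
    qed
  qed
  show ?thesis
  proof (rule exI[of _ K], rule conjI[OF K0], rule exI[of _ eps], rule conjI[OF eps(1)], intro allI impI)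
    fix f n k S a
    assume "locally_integrable M f" "0 \<le> S" "0 \<le> a"
      "\<forall>m\<ge>n - 1. nb p m (\<lambda>x. DP f (m, x)) (rad m powr s * S)"
      "nb p k (\<lambda>x. DP f (k, x)) (rad k powr s * a)"
    then show "nb p k (\<lambda>x. DP (\<lambda>z. Tp n f z - f z) (k, x))
       (rad k powr s * (K * ((if n \<le> k then a else 0) + 2 powr (- eps * \<bar>real_of_int (k - n)\<bar>) * S))) \<and>
     nb p k (\<lambda>x. DP (Tp n f) (k, x))
       (rad k powr s * (K * (a + 2 powr (- eps * \<bar>real_of_int (k - n)\<bar>) * S)))"
      by (rule main)
  qed
qed

subsection \<open>Level norms as Lebesgue norms\<close>

definition level :: "(int \<times> 'a \<Rightarrow> real) \<Rightarrow> int \<Rightarrow> 'a \<Rightarrow> real" where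
  "level v k z = (\<Sum>x\<in>near k z (rad k). v (k, x))"

lemma level_fun_eq:
  assumes "\<And>x. 0 \<le> v x"
  shows "level_fun Xs v k z = ennreal (level v k z)"
proof -
  have "level_fun Xs v k z = (\<Sum>\<^sub>\<infinity>x\<in>near k z (rad k). ennreal (v (k, x)))"
    unfolding level_fun_def using assms
    by (intro infsum_cong_neutral) (auto simp: near_def dist_commute indicator_def)
  also have "\<dots> = ennreal (level v k z)"
    using assms by (simp add: level_def)
  finally show ?thesis .
qed

lemma level_nonneg: "(\<And>x. 0 \<le> v x) \<Longrightarrow> 0 \<le> level v k z"
  by (simp add: level_def sum_nonneg)

lemma le_level: "(\<And>x. 0 \<le> v x) \<Longrightarrow> x \<in> Xs k \<Longrightarrow> dist z x < rad k \<Longrightarrow> v (k, x) \<le> level v k z"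
  unfolding level_def using finite_near[of k z "rad k"]
  by (intro member_le_sum) (auto simp: near_def)

text \<open>The index set of \<open>level\<close> varies with z. Sums over the vertices within
  distance j of a base point are finite combinations of indicators of balls, and at each z they are
  eventually constant in j with value \<open>level v k z\<close>.\<close>

lemma level_measurable [measurable]: "level v k \<in> borel_measurable M"
proof -
  obtain z0 :: 'a where True by simp
  let ?u = "\<lambda>(j::nat) z. \<Sum>x\<in>near k z0 (real j). v (k, x) * indicat_real (ball x (rad k)) z"
  show ?thesis
  proof (rule borel_measurable_LIMSEQ_real)
    show "?u j \<in> borel_measurable M" for j
      by (intro borel_measurable_sum borel_measurable_times borel_measurable_const borel_measurable_indicator) simp
    fix z
    obtain J :: nat where J: "dist z0 z + rad k \<le> real J" using real_arch_simple by blast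
    have "?u j z = level v k z" if "j \<ge> J" for j
      unfolding level_def
    proof (intro sum.mono_neutral_cong_right ballI)
      show "near k z (rad k) \<subseteq> near k z0 (real j)"
      proof
        fix x assume "x \<in> near k z (rad k)"
        moreover have "real J \<le> real j" using that by simp
        ultimately show "x \<in> near k z0 (real j)"
          using J dist_triangle[of z0 x z] by (auto simp: near_def)
      qed
      show "v (k, x) * indicat_real (ball x (rad k)) z = 0" if "x \<in> near k z0 (real j) - near k z (rad k)" for x
        using that by (auto simp: near_def dist_commute)
      show "v (k, x) * indicat_real (ball x (rad k)) z = v (k, x)" if "x \<in> near k z (rad k)" for x
        using that by (auto simp: near_def dist_commute)
    qed simp
    then show "(\<lambda>j. ?u j z) \<longlonglongrightarrow> level v k z"
      by (intro tendsto_eventually) (auto simp: eventually_sequentially)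
  qed
qed

lemma Lp_level_fin:
  assumes "\<And>x. 0 \<le> v x" "p \<noteq> \<infinity>"
  shows "Lp_enorm M p (level_fun Xs v k)
    = enn_powr (\<integral>\<^sup>+ z. ennreal (level v k z powr enn2real p) \<partial>M) (1 / enn2real p)"
  using assms by (simp add: Lp_enorm_def level_fun_eq[OF assms(1)] enn_powr_ennreal level_nonneg)

lemma nn_integral_indicators:
  assumes "finite F" "\<And>x. x \<in> F \<Longrightarrow> 0 \<le> w x"
  shows "(\<integral>\<^sup>+ z. ennreal (\<Sum>x\<in>F. w x * indicat_real (ball x (rad k)) z) \<partial>M) = ennreal (\<Sum>x\<in>F. w x * mu (k, x))"
proof -
  have "(\<integral>\<^sup>+ z. ennreal (\<Sum>x\<in>F. w x * indicat_real (ball x (rad k)) z) \<partial>M)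
      = (\<integral>\<^sup>+ z. (\<Sum>x\<in>F. ennreal (w x) * indicator (ball x (rad k)) z) \<partial>M)"
  proof (intro nn_integral_cong)
    fix z
    have "(\<Sum>x\<in>F. ennreal (w x) * indicator (ball x (rad k)) z) = (\<Sum>x\<in>F. ennreal (w x * indicat_real (ball x (rad k)) z))"
      by (intro sum.cong refl) (simp add: indicator_def)
    also have "\<dots> = ennreal (\<Sum>x\<in>F. w x * indicat_real (ball x (rad k)) z)"
      using assms by (intro sum_ennreal) auto
    finally show "ennreal (\<Sum>x\<in>F. w x * indicat_real (ball x (rad k)) z)
        = (\<Sum>x\<in>F. ennreal (w x) * indicator (ball x (rad k)) z)" by simp
  qed
  also have "\<dots> = (\<Sum>x\<in>F. \<integral>\<^sup>+ z. ennreal (w x) * indicator (ball x (rad k)) z \<partial>M)"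
    by (intro nn_integral_sum borel_measurable_times_ennreal borel_measurable_const borel_measurable_indicator) simp
  also have "\<dots> = (\<Sum>x\<in>F. ennreal (w x * mu (k, x)))"
    using assms by (intro sum.cong refl)
      (simp add: nn_integral_cmult_indicator emeasure_ball_eq mu_def ennreal_mult)
  also have "\<dots> = ennreal (\<Sum>x\<in>F. w x * mu (k, x))"
    using assms by (intro sum_ennreal) auto
  finally show ?thesis .
qed

text \<open>For finite p, \<open>nb\<close> speaks of finite sets of vertices, so the integral is
  first restricted to balls around a base point, where finitely many vertices matter; monotone
  convergence removes the restriction. Overlap costs \<open>cnt 1\<close>.\<close>

lemma Lp_le_of_nb:
  assumes v: "\<And>x. 0 \<le> v x" and nb: "nb p k (\<lambda>x. v (k, x)) a" and a: "0 \<le> a" and p: "0 < p"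
  shows "Lp_enorm M p (level_fun Xs v k) \<le> ennreal (cnt 1 * a)"
proof (cases "p = \<infinity>")
  case True
  have "level v k z \<le> cnt 1 * a" for z
  proof -
    have "level v k z \<le> (\<Sum>x\<in>near k z (rad k). a)"
      unfolding level_def using nb True near_subset[of k z "rad k"] by (intro sum_mono) (auto simp: nb_def)
    also have "\<dots> = real (card (near k z (rad k))) * a" by simp
    also have "\<dots> \<le> cnt 1 * a" using a by (intro mult_right_mono card_near) auto
    finally show ?thesis .
  qed
  moreover have "level_fun Xs v k \<in> borel_measurable M"
    unfolding level_fun_eq[OF v, abs_def] by measurable
  ultimately show ?thesis
    using True by (auto simp: Lp_enorm_def level_fun_eq[OF v] intro!: esssup_I ennreal_leI AE_I2)
next
  case False
  let ?r = "enn2real p"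
  have r: "0 < ?r" using p False by (intro enn2real_pos)
  obtain z0 :: 'a where True by simp
  let ?f = "\<lambda>(j::nat) z. ennreal (level v k z powr ?r) * indicator (ball z0 (real j)) z"
  have bd: "(\<integral>\<^sup>+ z. ?f j z \<partial>M) \<le> ennreal ((cnt 1 * a) powr ?r)" for j
  proof -
    let ?F = "near k z0 (real j + rad k)"
    let ?w = "\<lambda>x. cnt 1 powr ?r * v (k, x) powr ?r"
    have "(\<integral>\<^sup>+ z. ?f j z \<partial>M) \<le> (\<integral>\<^sup>+ z. ennreal (\<Sum>x\<in>?F. ?w x * indicat_real (ball x (rad k)) z) \<partial>M)"
    proof (intro nn_integral_mono)
      fix z
      show "?f j z \<le> ennreal (\<Sum>x\<in>?F. ?w x * indicat_real (ball x (rad k)) z)"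
      proof (cases "z \<in> ball z0 (real j)")
        case True
        have "level v k z powr ?r \<le> cnt 1 powr ?r * (\<Sum>x\<in>near k z (rad k). v (k, x) powr ?r)"
          unfolding level_def using r v by (intro sum_powr_card_le card_near) auto
        also have "\<dots> = (\<Sum>x\<in>near k z (rad k). ?w x * indicat_real (ball x (rad k)) z)"
          unfolding sum_distrib_left by (intro sum.cong) (auto simp: near_def dist_commute)
        also have "\<dots> \<le> (\<Sum>x\<in>?F. ?w x * indicat_real (ball x (rad k)) z)"
        proof (intro sum_mono2)
          show "near k z (rad k) \<subseteq> ?F"
            using True dist_triangle_less_add[of z0 z "real j" _ "rad k"] by (auto simp: near_def dist_commute)
        qed auto
        finally show ?thesis using True by (simp add: ennreal_leI)
      qed simp
    qed
    also have "\<dots> = ennreal (\<Sum>x\<in>?F. ?w x * mu (k, x))"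
      by (intro nn_integral_indicators) auto
    also have "(\<Sum>x\<in>?F. ?w x * mu (k, x)) = cnt 1 powr ?r * (\<Sum>x\<in>?F. v (k, x) powr ?r * mu (k, x))"
      by (simp add: sum_distrib_left mult_ac)
    also have "ennreal \<dots> \<le> ennreal (cnt 1 powr ?r * a powr ?r)"
      using nb False near_subset[of k z0 "real j + rad k"] by (intro ennreal_leI mult_left_mono) (auto simp: nb_def)
    finally show ?thesis by (simp add: powr_mult)
  qed
  have sup: "ennreal (level v k z powr ?r) = (SUP j. ?f j z)" for z
  proof (rule antisym)
    obtain J :: nat where J: "dist z0 z < real J" using reals_Archimedean2 by blast
    have "ennreal (level v k z powr ?r) = ?f J z" using J by simp
    also have "\<dots> \<le> (SUP j. ?f j z)" by (rule SUP_upper) simp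
    finally show "ennreal (level v k z powr ?r) \<le> (SUP j. ?f j z)" .
  qed (auto intro!: SUP_least simp: indicator_def)
  have "(\<integral>\<^sup>+ z. ennreal (level v k z powr ?r) \<partial>M) = (\<integral>\<^sup>+ z. (SUP j. ?f j z) \<partial>M)"
    using sup by simp
  also have "\<dots> = (SUP j. \<integral>\<^sup>+ z. ?f j z \<partial>M)"
  proof (intro nn_integral_monotone_convergence_SUP)
    show "incseq ?f"
      by (auto simp: incseq_def le_fun_def indicator_def)
    show "?f j \<in> borel_measurable M" for j
      by (intro borel_measurable_times_ennreal borel_measurable_indicator) simp_all
  qed
  also have "\<dots> \<le> ennreal ((cnt 1 * a) powr ?r)" by (intro SUP_least bd)
  finally have "Lp_enorm M p (level_fun Xs v k) \<le> enn_powr (ennreal ((cnt 1 * a) powr ?r)) (1 / ?r)"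
    unfolding Lp_level_fin[of v, OF v False] using r by (intro enn_powr_mono) auto
  also have "\<dots> = ennreal (cnt 1 * a)"
    using r a cnt_ge_1[of 1] by (simp add: enn_powr_ennreal powr_powr)
  finally show ?thesis .
qed

definition KL2 :: "ennreal \<Rightarrow> real" where
  "KL2 p = cnt 1 powr (1 / enn2real p)"

text \<open>For finite p, bounded overlap compares the sum of powers with the power of the sum under
  the integral. For p = \<infinity>, a value above a would make \<open>level\<close> exceed a on a
  whole vertex ball, which has positive measure.\<close>

lemma nb_of_Lp_le:
  assumes v: "\<And>x. 0 \<le> v x" and le: "Lp_enorm M p (level_fun Xs v k) \<le> ennreal a" and a: "0 \<le> a" and p: "0 < p"
  shows "nb p k (\<lambda>x. v (k, x)) (KL2 p * a)"
proof (cases "p = \<infinity>")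
  case True
  have "AE z in M. level_fun Xs v k z \<le> ennreal a"
    using esssup_AE[of "level_fun Xs v k" M] le True by (auto simp: Lp_enorm_def elim: eventually_mono)
  then have ae: "AE z in M. level v k z \<le> a"
    unfolding level_fun_eq[OF v] using a by (auto simp: ennreal_le_iff)
  have "v (k, x) \<le> a" if x: "x \<in> Xs k" for x
  proof (rule ccontr)
    assume "\<not> v (k, x) \<le> a"
    then have "\<not> level v k z \<le> a" if "z \<in> ball x (rad k)" for z
      using le_level[of v x k z] v x that by (force simp: dist_commute)
    then have "AE z in M. z \<notin> ball x (rad k)" using ae by (auto elim!: eventually_mono)
    then have "emeasure M (ball x (rad k)) = 0"
      by (subst (asm) AE_iff_measurable[where N = "ball x (rad k)"]) auto
    then show False
      using measure_ball_pos[of "rad k" x] by (simp add: emeasure_ball_eq)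
  qed
  then show ?thesis using True cnt_ge_1[of 1] by (simp add: nb_def KL2_def)
next
  case False
  let ?r = "enn2real p"
  have r: "0 < ?r" using p False by (intro enn2real_pos)
  have I: "(\<integral>\<^sup>+ z. ennreal (level v k z powr ?r) \<partial>M) \<le> ennreal (a powr ?r)"
    using le r a unfolding Lp_level_fin[of v, OF v False] by (intro enn_powr_le_imp)
  have "(\<Sum>x\<in>F. v (k, x) powr ?r * mu (k, x)) \<le> (KL2 p * a) powr ?r" if F: "finite F" "F \<subseteq> Xs k" for F
  proof -
    have "ennreal (\<Sum>x\<in>F. v (k, x) powr ?r * mu (k, x))
        = (\<integral>\<^sup>+ z. ennreal (\<Sum>x\<in>F. v (k, x) powr ?r * indicat_real (ball x (rad k)) z) \<partial>M)"
      using F by (intro nn_integral_indicators[symmetric]) auto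
    also have "\<dots> \<le> (\<integral>\<^sup>+ z. ennreal (cnt 1) * ennreal (level v k z powr ?r) \<partial>M)"
    proof (intro nn_integral_mono)
      fix z
      have "(\<Sum>x\<in>F. v (k, x) powr ?r * indicat_real (ball x (rad k)) z)
          \<le> (\<Sum>x\<in>near k z (rad k). v (k, x) powr ?r)"
      proof -
        have "(\<Sum>x\<in>F. v (k, x) powr ?r * indicat_real (ball x (rad k)) z)
            = (\<Sum>x\<in>F \<inter> near k z (rad k). v (k, x) powr ?r)"
          using F by (intro sum.mono_neutral_cong_right) (auto simp: near_def dist_commute indicator_def)
        also have "\<dots> \<le> (\<Sum>x\<in>near k z (rad k). v (k, x) powr ?r)"
          by (intro sum_mono2) auto
        finally show ?thesis .
      qed
      also have "\<dots> \<le> cnt 1 * level v k z powr ?r"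
        unfolding level_def using r v by (intro sum_powr_card_le card_near) auto
      finally show "ennreal (\<Sum>x\<in>F. v (k, x) powr ?r * indicat_real (ball x (rad k)) z)
          \<le> ennreal (cnt 1) * ennreal (level v k z powr ?r)"
        using cnt_ge_1[of 1] by (simp add: ennreal_mult[symmetric] ennreal_leI)
    qed
    also have "\<dots> = ennreal (cnt 1) * (\<integral>\<^sup>+ z. ennreal (level v k z powr ?r) \<partial>M)"
      by (intro nn_integral_cmult) simp
    also have "\<dots> \<le> ennreal (cnt 1) * ennreal (a powr ?r)" by (intro mult_left_mono I) auto
    also have "\<dots> = ennreal (cnt 1 * a powr ?r)" using cnt_ge_1[of 1] by (simp add: ennreal_mult)
    finally have "(\<Sum>x\<in>F. v (k, x) powr ?r * mu (k, x)) \<le> cnt 1 * a powr ?r"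
      using cnt_ge_1[of 1] by (subst (asm) ennreal_le_iff) auto
    also have "\<dots> = (KL2 p * a) powr ?r"
      using r cnt_ge_1[of 1] by (simp add: KL2_def powr_mult powr_powr)
    finally show ?thesis .
  qed
  then show ?thesis using False by (simp add: nb_def)
qed

subsection \<open>Summation over the levels\<close>

text \<open>The numbers \<open>b\<^sub>k\<close> of the overview. The factor
  \<open>rad k powr s\<close> in the \<open>nb\<close> statements cancels the weight, so those
  statements bound \<open>bk\<close> up to constants.\<close>

definition bk :: "ennreal \<Rightarrow> real \<Rightarrow> int \<Rightarrow> (int \<times> 'a \<Rightarrow> real) \<Rightarrow> ennreal" where
  "bk p s k v = ennreal (2 powr (real_of_int k * s)) * Lp_enorm M p (level_fun Xs v k)"

lemma rad_powr_cancel: "2 powr (real_of_int k * s) * rad k powr s = 1"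
  by (simp add: rad_def powr_powr powr_add[symmetric])

lemma bk_le_of_nb:
  assumes "\<And>x. 0 \<le> v x" "nb p k (\<lambda>x. v (k, x)) (rad k powr s * b)" "0 \<le> b" "0 < p"
  shows "bk p s k v \<le> ennreal (cnt 1 * b)"
proof -
  have "Lp_enorm M p (level_fun Xs v k) \<le> ennreal (cnt 1 * (rad k powr s * b))"
    using assms by (intro Lp_le_of_nb) auto
  then have "bk p s k v \<le> ennreal (2 powr (real_of_int k * s)) * ennreal (cnt 1 * (rad k powr s * b))"
    unfolding bk_def by (intro mult_left_mono) auto
  also have "\<dots> = ennreal (2 powr (real_of_int k * s) * (cnt 1 * (rad k powr s * b)))"
    using assms cnt_ge_1[of 1] by (simp add: ennreal_mult)
  also have "2 powr (real_of_int k * s) * (cnt 1 * (rad k powr s * b)) = (2 powr (real_of_int k * s) * rad k powr s) * (cnt 1 * b)"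
    by (simp only: mult_ac)
  finally show ?thesis by (simp only: rad_powr_cancel mult_1)
qed

lemma nb_of_bk_le:
  assumes "\<And>x. 0 \<le> v x" "bk p s k v \<le> ennreal b" "0 \<le> b" "0 < p"
  shows "nb p k (\<lambda>x. v (k, x)) (rad k powr s * (KL2 p * b))"
proof -
  let ?L = "Lp_enorm M p (level_fun Xs v k)"
  have "?L = ennreal (rad k powr s * 2 powr (real_of_int k * s)) * ?L"
    using rad_powr_cancel[of k s] by (simp add: mult.commute)
  also have "\<dots> = ennreal (rad k powr s) * bk p s k v"
    by (simp add: bk_def ennreal_mult mult.assoc)
  also have "\<dots> \<le> ennreal (rad k powr s) * ennreal b" by (intro mult_left_mono assms) auto
  also have "\<dots> = ennreal (rad k powr s * b)" using assms by (simp add: ennreal_mult)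
  finally have "nb p k (\<lambda>x. v (k, x)) (KL2 p * (rad k powr s * b))"
    using assms by (intro nb_of_Lp_le) auto
  then show ?thesis by (simp only: mult_ac)
qed

text \<open>\<open>nb_key\<close> carried over to Lebesgue norms: \<open>KL2 p\<close> enters when
  the hypotheses are translated, \<open>cnt 1\<close> when the conclusions are translated
  back.\<close>

lemma bk_key:
  assumes s: "0 < s" "s < 1" and p: "ennreal (Q / (Q + s)) < p"
  shows "\<exists>K\<ge>0. \<exists>e>0. \<forall>f n k S a. locally_integrable M f \<longrightarrow> 0 \<le> S \<longrightarrow> 0 \<le> a \<longrightarrow>
     (\<forall>m\<ge>n - 1. bk p s m (DP f) \<le> ennreal S) \<longrightarrow> bk p s k (DP f) \<le> ennreal a \<longrightarrow>
     bk p s k (DP (\<lambda>z. Tp n f z - f z))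
       \<le> ennreal (K * ((if n \<le> k then a else 0) + 2 powr (- e * \<bar>real_of_int (k - n)\<bar>) * S)) \<and>
     bk p s k (DP (Tp n f)) \<le> ennreal (K * (a + 2 powr (- e * \<bar>real_of_int (k - n)\<bar>) * S))"
proof -
  have p0: "0 < p" using p by (rule le_less_trans[rotated]) simp
  obtain K e where K: "0 \<le> K" and e: "0 < e" and
    key: "\<And>f n k S a. locally_integrable M f \<Longrightarrow> 0 \<le> S \<Longrightarrow> 0 \<le> a \<Longrightarrow>
     (\<forall>m\<ge>n - 1. nb p m (\<lambda>x. DP f (m, x)) (rad m powr s * S)) \<Longrightarrow>
     nb p k (\<lambda>x. DP f (k, x)) (rad k powr s * a) \<Longrightarrow>
     nb p k (\<lambda>x. DP (\<lambda>z. Tp n f z - f z) (k, x))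
       (rad k powr s * (K * ((if n \<le> k then a else 0) + 2 powr (- e * \<bar>real_of_int (k - n)\<bar>) * S))) \<and>
     nb p k (\<lambda>x. DP (Tp n f) (k, x))
       (rad k powr s * (K * (a + 2 powr (- e * \<bar>real_of_int (k - n)\<bar>) * S)))"
    using nb_key[OF s p] by blast
  have L0: "0 \<le> KL2 p" by (simp add: KL2_def)
  have c0: "0 \<le> cnt 1" using cnt_ge_1[of 1] by simp
  show ?thesis
  proof (rule exI[of _ "cnt 1 * (K * KL2 p)"], rule conjI, use K L0 c0 in simp,
      rule exI[of _ e], rule conjI[OF e], intro allI impI)
    fix f n k S a
    assume f: "locally_integrable M f" and S: "0 \<le> S" and a: "0 \<le> a"
      and hyp: "\<forall>m\<ge>n - 1. bk p s m (DP f) \<le> ennreal S" and hypk: "bk p s k (DP f) \<le> ennreal a"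
    let ?w = "2 powr (- e * \<bar>real_of_int (k - n)\<bar>)"
    let ?y = "if n \<le> k then a else 0"
    have "\<forall>m\<ge>n - 1. nb p m (\<lambda>x. DP f (m, x)) (rad m powr s * (KL2 p * S))"
      using hyp S p0 by (auto intro!: nb_of_bk_le)
    moreover have "nb p k (\<lambda>x. DP f (k, x)) (rad k powr s * (KL2 p * a))"
      using hypk a p0 by (intro nb_of_bk_le) auto
    ultimately have nb1: "nb p k (\<lambda>x. DP (\<lambda>z. Tp n f z - f z) (k, x))
         (rad k powr s * (K * ((if n \<le> k then KL2 p * a else 0) + ?w * (KL2 p * S))))"
      and nb2: "nb p k (\<lambda>x. DP (Tp n f) (k, x)) (rad k powr s * (K * (KL2 p * a + ?w * (KL2 p * S))))"
      using key[OF f, of "KL2 p * S" "KL2 p * a" n k] L0 S a by auto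
    have e1: "(if n \<le> k then KL2 p * a else 0) + ?w * (KL2 p * S) = KL2 p * (?y + ?w * S)"
      by (simp add: algebra_simps)
    have e2: "KL2 p * a + ?w * (KL2 p * S) = KL2 p * (a + ?w * S)"
      by (simp add: algebra_simps)
    have "bk p s k (DP (\<lambda>z. Tp n f z - f z)) \<le> ennreal (cnt 1 * (K * (KL2 p * (?y + ?w * S))))"
      using K L0 S a p0 by (intro bk_le_of_nb nb1[unfolded e1]) (auto intro!: mult_nonneg_nonneg add_nonneg_nonneg)
    moreover have "bk p s k (DP (Tp n f)) \<le> ennreal (cnt 1 * (K * (KL2 p * (a + ?w * S))))"
      using K L0 S a p0 by (intro bk_le_of_nb nb2[unfolded e2]) (auto intro!: mult_nonneg_nonneg add_nonneg_nonneg)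
    ultimately show "bk p s k (DP (\<lambda>z. Tp n f z - f z)) \<le> ennreal (cnt 1 * (K * KL2 p) * (?y + ?w * S)) \<and>
       bk p s k (DP (Tp n f)) \<le> ennreal (cnt 1 * (K * KL2 p) * (a + ?w * S))"
      by (simp only: mult.assoc conj_absorb)
  qed
qed

lemma I_norm_inf: "I_norm M Xs s p \<infinity> v = (SUP k. bk p s k v)"
  by (simp add: I_norm_def bk_def)

lemma I_norm_fin:
  assumes "q \<noteq> \<infinity>"
  shows "I_norm M Xs s p q v = enn_powr (\<Sum>\<^sub>\<infinity>k\<in>UNIV. enn_powr (bk p s k v) (enn2real q)) (1 / enn2real q)"
proof -
  have "ennreal (2 powr (real_of_int k * s * enn2real q)) * enn_powr (Lp_enorm M p (level_fun Xs v k)) (enn2real q)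
      = enn_powr (bk p s k v) (enn2real q)" for k
    unfolding bk_def by (subst enn_powr_mult) (auto simp: powr_powr)
  then show ?thesis using assms by (simp add: I_norm_def)
qed

lemma infsum_ennreal_SUP:
  fixes g :: "int \<Rightarrow> ennreal"
  shows "(\<Sum>\<^sub>\<infinity>k\<in>UNIV. g k) = (SUP J\<in>{J. finite J}. \<Sum>k\<in>J. g k)"
  by (subst nonneg_infsum_complete) auto

lemma I_norm_fin_le:
  assumes "q \<noteq> \<infinity>" "0 < q" "\<And>k. bk p s k v \<le> ennreal (b k)" "\<And>k. 0 \<le> b k" "0 \<le> T"
    and "\<And>J. finite J \<Longrightarrow> (\<Sum>k\<in>J. b k powr enn2real q) \<le> T"
  shows "I_norm M Xs s p q v \<le> ennreal (T powr (1 / enn2real q))"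
proof -
  let ?r = "enn2real q"
  have r: "0 < ?r" using assms by (intro enn2real_pos)
  have "(\<Sum>\<^sub>\<infinity>k\<in>UNIV. enn_powr (bk p s k v) ?r) \<le> ennreal T"
    unfolding infsum_ennreal_SUP
  proof (rule SUP_least)
    fix J :: "int set" assume J: "J \<in> {J. finite J}"
    have "(\<Sum>k\<in>J. enn_powr (bk p s k v) ?r) \<le> (\<Sum>k\<in>J. ennreal (b k powr ?r))"
      using assms r enn_powr_mono[OF assms(3)] by (intro sum_mono) (auto simp: enn_powr_ennreal)
    also have "\<dots> = ennreal (\<Sum>k\<in>J. b k powr ?r)" by (intro sum_ennreal) auto
    also have "\<dots> \<le> ennreal T" using J assms by (intro ennreal_leI) auto
    finally show "(\<Sum>k\<in>J. enn_powr (bk p s k v) ?r) \<le> ennreal T" .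
  qed
  then have "I_norm M Xs s p q v \<le> enn_powr (ennreal T) (1 / ?r)"
    unfolding I_norm_fin[OF assms(1)] using r by (intro enn_powr_mono) auto
  then show ?thesis using assms by (simp add: enn_powr_ennreal)
qed

text \<open>\<open>enn2real\<close> sends \<infinity> to 0. Finiteness of the whole norm excludes
  this default on every level, so the level norms may be handled as real numbers.\<close>

lemma I_norm_fin_levels:
  assumes "q \<noteq> \<infinity>" "0 < q" "I_norm M Xs s p q v < \<infinity>"
  shows "bk p s k v = ennreal (enn2real (bk p s k v))"
    and "finite J \<Longrightarrow> (\<Sum>k\<in>J. enn2real (bk p s k v) powr enn2real q) \<le> enn2real (I_norm M Xs s p q v) powr enn2real q"
proof -
  let ?r = "enn2real q" and ?N = "I_norm M Xs s p q v"
  have r: "0 < ?r" using assms by (intro enn2real_pos)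
  have N: "?N = ennreal (enn2real ?N)" using assms(3) by (simp add: less_top)
  have sum_le: "(\<Sum>k\<in>J. enn_powr (bk p s k v) ?r) \<le> ennreal (enn2real ?N powr ?r)" if "finite J" for J
  proof -
    have "(\<Sum>k\<in>J. enn_powr (bk p s k v) ?r) \<le> (\<Sum>\<^sub>\<infinity>k\<in>UNIV. enn_powr (bk p s k v) ?r)"
      unfolding infsum_ennreal_SUP using that by (intro SUP_upper) auto
    also have "\<dots> \<le> ennreal (enn2real ?N powr ?r)"
      using r N by (intro enn_powr_le_imp) (auto simp: I_norm_fin[OF assms(1)])
    finally show ?thesis .
  qed
  have bk: "bk p s k v = ennreal (enn2real (bk p s k v))" for k
  proof -
    have "enn_powr (bk p s k v) ?r \<le> ennreal (enn2real ?N powr ?r)" using sum_le[of "{k}"] by simp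
    then have "bk p s k v \<noteq> \<infinity>" by (auto simp: enn_powr_def top_unique)
    then show ?thesis by (simp add: less_top)
  qed
  show "bk p s k v = ennreal (enn2real (bk p s k v))" by (rule bk)
  show "(\<Sum>k\<in>J. enn2real (bk p s k v) powr ?r) \<le> enn2real ?N powr ?r" if "finite J"
  proof -
    have "ennreal (\<Sum>k\<in>J. enn2real (bk p s k v) powr ?r) = (\<Sum>k\<in>J. ennreal (enn2real (bk p s k v) powr ?r))"
      by (intro sum_ennreal[symmetric]) auto
    also have "\<dots> = (\<Sum>k\<in>J. enn_powr (bk p s k v) ?r)"
      using bk by (intro sum.cong refl) (metis enn_powr_ennreal enn2real_nonneg)
    finally have "ennreal (\<Sum>k\<in>J. enn2real (bk p s k v) powr ?r) \<le> ennreal (enn2real ?N powr ?r)"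
      using sum_le[OF that] by simp
    then show ?thesis by (subst (asm) ennreal_le_iff) auto
  qed
qed

subsection \<open>Boundedness and convergence\<close>

lemma Tp_bounded_inf:
  assumes s: "0 < s" "s < 1" and p: "ennreal (Q / (Q + s)) < p"
  shows "\<exists>C'::real. \<forall>f\<in>besov_space M Xs s p \<infinity>. \<forall>n::int.
    besov_norm M Xs s p \<infinity> (Tp n f) \<le> ennreal C' * besov_norm M Xs s p \<infinity> f"
proof -
  obtain K e where K: "0 \<le> K" and e: "0 < e" and
    key: "\<And>f n k S a. locally_integrable M f \<Longrightarrow> 0 \<le> S \<Longrightarrow> 0 \<le> a \<Longrightarrow>
     (\<forall>m\<ge>n - 1. bk p s m (DP f) \<le> ennreal S) \<Longrightarrow> bk p s k (DP f) \<le> ennreal a \<Longrightarrow>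
     bk p s k (DP (Tp n f)) \<le> ennreal (K * (a + 2 powr (- e * \<bar>real_of_int (k - n)\<bar>) * S))"
    using bk_key[OF s p] by blast
  show ?thesis
  proof (rule exI[of _ "2 * K"], intro ballI allI)
    fix f n assume "f \<in> besov_space M Xs s p \<infinity>"
    then have f: "locally_integrable M f" and fin: "besov_norm M Xs s p \<infinity> f < \<infinity>"
      by (auto simp: besov_space_def)
    define S where "S = enn2real (besov_norm M Xs s p \<infinity> f)"
    have S: "besov_norm M Xs s p \<infinity> f = ennreal S" "0 \<le> S" using fin by (auto simp: S_def less_top)
    have le: "bk p s m (DP f) \<le> ennreal S" for m
      unfolding S(1)[symmetric] besov_norm_def I_norm_inf by (rule SUP_upper) simp
    have "besov_norm M Xs s p \<infinity> (Tp n f) \<le> ennreal (2 * K * S)"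
      unfolding besov_norm_def I_norm_inf
    proof (rule SUP_least)
      fix k :: int
      have "bk p s k (DP (Tp n f)) \<le> ennreal (K * (S + 2 powr (- e * \<bar>real_of_int (k - n)\<bar>) * S))"
        using le S f by (intro key) auto
      also have "\<dots> \<le> ennreal (2 * K * S)"
      proof (rule ennreal_leI)
        have "2 powr (- e * \<bar>real_of_int (k - n)\<bar>) \<le> 2 powr 0"
          using e by (intro powr_mono) auto
        then have "2 powr (- e * \<bar>real_of_int (k - n)\<bar>) * S \<le> 1 * S"
          using S by (intro mult_right_mono) auto
        then have "K * (S + 2 powr (- e * \<bar>real_of_int (k - n)\<bar>) * S) \<le> K * (S + S)"
          using K by (intro mult_left_mono) auto
        then show "K * (S + 2 powr (- e * \<bar>real_of_int (k - n)\<bar>) * S) \<le> 2 * K * S" by simp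
      qed
      finally show "bk p s k (DP (Tp n f)) \<le> ennreal (2 * K * S)" .
    qed
    then show "besov_norm M Xs s p \<infinity> (Tp n f) \<le> ennreal (2 * K) * besov_norm M Xs s p \<infinity> f"
      unfolding S(1) using K S by (simp add: ennreal_mult)
  qed
qed

lemma Tp_bounded_fin:
  assumes s: "0 < s" "s < 1" and p: "ennreal (Q / (Q + s)) < p" and q: "0 < q" "q \<noteq> \<infinity>"
  shows "\<exists>C'::real. \<forall>f\<in>besov_space M Xs s p q. \<forall>n::int.
    besov_norm M Xs s p q (Tp n f) \<le> ennreal C' * besov_norm M Xs s p q f"
proof -
  obtain K e where K: "0 \<le> K" and e: "0 < e" and
    key: "\<And>f n k S a. locally_integrable M f \<Longrightarrow> 0 \<le> S \<Longrightarrow> 0 \<le> a \<Longrightarrow>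
     (\<forall>m\<ge>n - 1. bk p s m (DP f) \<le> ennreal S) \<Longrightarrow> bk p s k (DP f) \<le> ennreal a \<Longrightarrow>
     bk p s k (DP (Tp n f)) \<le> ennreal (K * (a + 2 powr (- e * \<bar>real_of_int (k - n)\<bar>) * S))"
    using bk_key[OF s p] by blast
  let ?r = "enn2real q"
  have r: "0 < ?r" using q by (intro enn2real_pos)
  define L where "L = K powr ?r * (2 powr ?r * (1 + 2 / (1 - 2 powr (- (?r * e)))))"
  have L0: "0 \<le> L" using r e by (simp add: L_def powr_less_one less_imp_le)
  show ?thesis
  proof (rule exI[of _ "L powr (1 / ?r)"], intro ballI allI)
    fix f n assume "f \<in> besov_space M Xs s p q"
    then have f: "locally_integrable M f" and fin: "besov_norm M Xs s p q f < \<infinity>"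
      by (auto simp: besov_space_def)
    let ?c = "\<lambda>k. enn2real (bk p s k (DP f))"
    define S where "S = enn2real (besov_norm M Xs s p q f)"
    have S: "besov_norm M Xs s p q f = ennreal S" "0 \<le> S" using fin by (auto simp: S_def less_top)
    note lev = I_norm_fin_levels[OF q(2,1) fin[unfolded besov_norm_def], folded besov_norm_def, folded S_def]
    \<comment> \<open>A single term of the q-sum is at most the whole sum, so the norm of f itself
      serves as the bound S.\<close>
    have cS: "?c m \<le> S" for m
    proof -
      have "?c m powr ?r \<le> S powr ?r" using lev(2)[of "{m}"] by simp
      then show ?thesis using r S(2) by (meson enn2real_nonneg not_less powr_less_mono2)
    qed
    let ?b = "\<lambda>k. K * (?c k + 2 powr (- e * \<bar>real_of_int (k - n)\<bar>) * S)"
    have "I_norm M Xs s p q (DP (Tp n f)) \<le> ennreal ((L * S powr ?r) powr (1 / ?r))"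
    proof (rule I_norm_fin_le[OF q(2,1)])
      show "bk p s k (DP (Tp n f)) \<le> ennreal (?b k)" for k
      proof (intro key f S(2) allI impI)
        show "bk p s m (DP f) \<le> ennreal S" for m
          by (subst lev(1)) (intro ennreal_leI cS)
        show "bk p s k (DP f) \<le> ennreal (?c k)" by (subst lev(1)) simp
      qed simp
      show b0: "0 \<le> ?b k" for k using K S by simp
      show "0 \<le> L * S powr ?r" using L0 by simp
      show "(\<Sum>k\<in>J. ?b k powr ?r) \<le> L * S powr ?r" if "finite J" for J
        unfolding L_def
        by (rule sum_levels_le[where c = ?c and A = UNIV and S = S and n = n, OF r e K S(2)])
          (use that lev(2) b0 in auto)
    qed
    also have "(L * S powr ?r) powr (1 / ?r) = L powr (1 / ?r) * S"
      using r S by (simp add: powr_mult powr_powr)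
    finally show "besov_norm M Xs s p q (Tp n f) \<le> ennreal (L powr (1 / ?r)) * besov_norm M Xs s p q f"
      unfolding S(1) unfolding besov_norm_def using S by (simp add: ennreal_mult)
  qed
qed

text \<open>For finite q the q-sum of f over levels \<ge> N can be made at most any d > 0. Both
  ingredients of the level-wise bound, the levels k \<ge> n and S, are then controlled by d, and the
  norm of h by a fixed multiple of \<open>d powr (1 / q)\<close>.\<close>

lemma Tp_tendsto:
  assumes s: "0 < s" "s < 1" and p: "ennreal (Q / (Q + s)) < p" and q: "0 < q" "q \<noteq> \<infinity>"
    and fB: "f \<in> besov_space M Xs s p q"
  shows "((\<lambda>n::int. besov_norm M Xs s p q (\<lambda>z. Tp n f z - f z)) \<longlongrightarrow> 0) at_top"
proof -
  obtain K e where K: "0 \<le> K" and e: "0 < e" and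
    key: "\<And>f n k S a. locally_integrable M f \<Longrightarrow> 0 \<le> S \<Longrightarrow> 0 \<le> a \<Longrightarrow>
     (\<forall>m\<ge>n - 1. bk p s m (DP f) \<le> ennreal S) \<Longrightarrow> bk p s k (DP f) \<le> ennreal a \<Longrightarrow>
     bk p s k (DP (\<lambda>z. Tp n f z - f z))
       \<le> ennreal (K * ((if n \<le> k then a else 0) + 2 powr (- e * \<bar>real_of_int (k - n)\<bar>) * S))"
    using bk_key[OF s p] by blast
  let ?r = "enn2real q"
  have r: "0 < ?r" using q by (intro enn2real_pos)
  define L where "L = K powr ?r * (2 powr ?r * (1 + 2 / (1 - 2 powr (- (?r * e)))))"
  have L0: "0 \<le> L" using r e by (simp add: L_def powr_less_one less_imp_le)
  from fB have f: "locally_integrable M f" and fin: "besov_norm M Xs s p q f < \<infinity>"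
    by (auto simp: besov_space_def)
  define c where "c = (\<lambda>k. enn2real (bk p s k (DP f)))"
  have c0: "0 \<le> c k" for k by (simp add: c_def)
  note lev = I_norm_fin_levels[OF q(2,1) fin[unfolded besov_norm_def]]
  have bkc: "bk p s k (DP f) = ennreal (c k)" for k unfolding c_def by (rule lev(1))
  define U where "U = (SUP J\<in>{J. finite J}. \<Sum>k\<in>J. c k powr ?r)"
  have bdd: "bdd_above ((\<lambda>J. \<Sum>k\<in>J. c k powr ?r) ` {J. finite J})"
    using lev(2) by (intro bdd_aboveI2[where M = "enn2real (I_norm M Xs s p q (DP f)) powr ?r"]) (auto simp: c_def)
  have tail: "\<exists>N. \<forall>J. finite J \<and> J \<subseteq> {N..} \<longrightarrow> (\<Sum>k\<in>J. c k powr ?r) \<le> d" if d: "0 < d" for d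
  proof -
    \<comment> \<open>A finite \<open>J0\<close> already captures all but d of the supremum U.
      Levels beyond \<open>J0\<close> are disjoint from it and share what is left.\<close>
    have "U - d < U" using d by simp
    then obtain J0 where J0: "finite J0" "U - d < (\<Sum>k\<in>J0. c k powr ?r)"
      unfolding U_def by (subst (asm) less_cSUP_iff[OF _ bdd]) auto
    obtain N where N: "\<And>k. k \<in> J0 \<Longrightarrow> k < N"
      using J0(1) by (metis Max_ge bdd_above_finite bdd_above.unfold le_less_trans less_add_one zless_add1_eq gt_ex)
    have "(\<Sum>k\<in>J. c k powr ?r) \<le> d" if J: "finite J" "J \<subseteq> {N..}" for J
    proof -
      have "(\<Sum>k\<in>J0. c k powr ?r) + (\<Sum>k\<in>J. c k powr ?r) = (\<Sum>k\<in>J0 \<union> J. c k powr ?r)"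
        using J J0 N by (intro sum.union_disjoint[symmetric]) force+
      also have "\<dots> \<le> U" unfolding U_def using J J0 by (intro cSUP_upper bdd) auto
      finally show ?thesis using J0 by simp
    qed
    then show ?thesis by blast
  qed
  have ev: "eventually (\<lambda>n::int. besov_norm M Xs s p q (\<lambda>z. Tp n f z - f z) \<le> ennreal ((L * d) powr (1 / ?r))) at_top"
    if d: "0 < d" for d
  proof -
    obtain N where N: "\<And>J. finite J \<Longrightarrow> J \<subseteq> {N..} \<Longrightarrow> (\<Sum>k\<in>J. c k powr ?r) \<le> d"
      using tail[OF d] by blast
    \<comment> \<open>N + 1 and not N, because S has to dominate the levels from n - 1 on.\<close>
    have "besov_norm M Xs s p q (\<lambda>z. Tp n f z - f z) \<le> ennreal ((L * d) powr (1 / ?r))" if n: "n \<ge> N + 1" for n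
    proof -
      define S where "S = d powr (1 / ?r)"
      have S: "0 \<le> S" "S powr ?r = d" using d r by (auto simp: S_def powr_powr)
      have cS: "c m \<le> S" if "m \<ge> n - 1" for m
      proof -
        have "c m powr ?r \<le> S powr ?r" using N[of "{m}"] that n S by simp
        then show ?thesis using r S(1) c0 by (meson not_less powr_less_mono2)
      qed
      let ?b = "\<lambda>k. K * ((if k \<in> {n..} then c k else 0) + 2 powr (- e * \<bar>real_of_int (k - n)\<bar>) * S)"
      show ?thesis
        unfolding besov_norm_def
      proof (rule I_norm_fin_le[OF q(2,1)])
        show "bk p s k (DP (\<lambda>z. Tp n f z - f z)) \<le> ennreal (?b k)" for k
        proof -
          have "bk p s k (DP (\<lambda>z. Tp n f z - f z))
              \<le> ennreal (K * ((if n \<le> k then c k else 0) + 2 powr (- e * \<bar>real_of_int (k - n)\<bar>) * S))"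
            using cS by (intro key f S(1) c0) (auto simp: bkc intro!: ennreal_leI)
          then show ?thesis by simp
        qed
        show b0: "0 \<le> ?b k" for k using K S c0 by simp
        show "0 \<le> L * d" using L0 d by simp
        show "(\<Sum>k\<in>J. ?b k powr ?r) \<le> L * d" if "finite J" for J
          unfolding L_def
        proof (rule sum_levels_le[where c = c and A = "{n..}" and S = S and n = n, OF r e K S(1)])
          show "(\<Sum>k\<in>J. c k powr ?r) \<le> d" if "finite J" "J \<subseteq> {n..}" for J
            using that n by (intro N) auto
        qed (use that b0 c0 S in auto)
      qed
    qed
    then show ?thesis by (auto simp: eventually_at_top_linorder)
  qed
  show ?thesis
  proof (rule order_tendstoI)
    fix a :: ennreal assume a: "0 < a"
    obtain y where y: "0 < y" "y < a" using dense[OF a] by blast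
    then obtain t where t: "y = ennreal t" "0 < t" by (cases y) auto
    \<comment> \<open>Chosen so that L * d \<le> \<open>t powr ?r\<close>; the denominator is L + 1
      because L may be 0.\<close>
    define d where "d = t powr ?r / (L + 1)"
    have d: "0 < d" using t L0 by (simp add: d_def)
    have "L * d \<le> t powr ?r" using L0 t by (simp add: d_def field_simps)
    then have "(L * d) powr (1 / ?r) \<le> (t powr ?r) powr (1 / ?r)"
      using L0 d r by (intro powr_mono2) auto
    also have "\<dots> = t" using t r by (simp add: powr_powr)
    finally have "ennreal ((L * d) powr (1 / ?r)) \<le> y" unfolding t by (rule ennreal_leI)
    then have "ennreal ((L * d) powr (1 / ?r)) < a" using y by simp
    then show "eventually (\<lambda>n::int. besov_norm M Xs s p q (\<lambda>z. Tp n f z - f z) < a) at_top"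
      using ev[OF d] by (auto elim!: eventually_mono)
  qed simp
qed

end

theorem theorem3p2:
  fixes M :: "'a::metric_space measure" and C Q C'' :: real
    and Xs :: "int \<Rightarrow> 'a set" and \<psi> :: "int \<times> 'a \<Rightarrow> 'a \<Rightarrow> real"
  assumes "doubling_mms M C Q"
    and "hyperbolic_filling Xs"
    and "lipschitz_pou Xs \<psi> C''"
  shows "(\<forall>s p q. 0 < s \<and> s < 1 \<and> ennreal (Q / (Q + s)) < p \<and> 0 < q \<longrightarrow>
            (\<exists>C'::real. \<forall>f\<in>besov_space M Xs s p q. \<forall>n::int.
               besov_norm M Xs s p q (Tn Xs \<psi> n (Pavg M f)) \<le> ennreal C' * besov_norm M Xs s p q f))
       \<and> (\<forall>s p q. 0 < s \<and> s < 1 \<and> ennreal (Q / (Q + s)) < p \<and> 0 < q \<and> q < \<infinity> \<longrightarrow>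
            (\<forall>f\<in>besov_space M Xs s p q.
               ((\<lambda>n::int. besov_norm M Xs s p q (\<lambda>z. Tn Xs \<psi> n (Pavg M f) z - f z)) \<longlongrightarrow> 0) at_top))"
proof -
  interpret besov_filling M C Q C'' Xs \<psi>
    using assms by unfold_locales
  show ?thesis
  proof (intro conjI allI impI ballI)
    fix s :: real and p q :: ennreal
    assume "0 < s \<and> s < 1 \<and> ennreal (Q / (Q + s)) < p \<and> 0 < q"
    then show "\<exists>C'::real. \<forall>f\<in>besov_space M Xs s p q. \<forall>n::int.
        besov_norm M Xs s p q (Tp n f) \<le> ennreal C' * besov_norm M Xs s p q f"
      using Tp_bounded_inf[of s p] Tp_bounded_fin[of s p q] by (cases "q = \<infinity>") simp_all
  next
    fix s :: real and p q :: ennreal and f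
    assume "0 < s \<and> s < 1 \<and> ennreal (Q / (Q + s)) < p \<and> 0 < q \<and> q < \<infinity>" "f \<in> besov_space M Xs s p q"
    then show "((\<lambda>n::int. besov_norm M Xs s p q (\<lambda>z. Tp n f z - f z)) \<longlongrightarrow> 0) at_top"
      by (intro Tp_tendsto) auto
  qed
qed

end
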